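(* Let $q$ be an odd prime and $k\ge1$ a natural number. Let $S$ be a finite subset of $\mathbb{Z}$ not containing a perfect $q$-th power. Assume that $S\in\mathcal{T}_{k,q}$. Then $$|S|\ \ge\ \frac{q^{k+1}-1}{q-1}=q^k+q^{k-1}+\cdots+1.$$
   Context: An integer is a perfect $q$-th power if it equals $r^q$ for some $r\in\mathbb{Q}$. For a natural number $N$, $\Omega(N)$ is the number of prime factors of $N$ counted with multiplicity. A finite set $S\subset\mathbb{Z}$ contains a $q$-th power modulo $N$ if there are $s\in S$ and $x\in\mathbb{Z}$ with $x^q\equiv s \pmod N$. $S$ contains a $q$-th power modulo almost every natural number $N$ with $\Omega(N)\le k$ if there exists a natural number $\Delta$ (depending on $S$) such that for every natural number $N$ with $\Omega(N)\le k$ and $\gcd(N,\Delta)=1$, $S$ contains a $q$-th power modulo $N$. $\mathcal{T}_{k,q}$ is the collection of all finite subsets $S\subset\mathbb{Z}$ that contain a $q$-th power modulo almost every natural number $N$ with $\Omega(N)\le k$. *)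

theory Defs
  imports Complex_Main "HOL-Number_Theory.Number_Theory"
begin

definition perfect_power :: "nat \<Rightarrow> int \<Rightarrow> bool" where
  "perfect_power q s \<longleftrightarrow> (\<exists>r::rat. of_int s = r ^ q)"

definition bigomega :: "nat \<Rightarrow> nat" where
  "bigomega N = size (prime_factorization N)"

definition contains_power_mod :: "nat \<Rightarrow> int set \<Rightarrow> nat \<Rightarrow> bool" where
  "contains_power_mod q S N \<longleftrightarrow> (\<exists>s\<in>S. \<exists>x::int. [x ^ q = s] (mod int N))"

text \<open>
  Natural numbers are positive here. This matters for \<open>\<Delta>\<close>: since \<open>gcd N 0 = N\<close>,
  allowing \<open>\<Delta> = 0\<close> would restrict \<open>N\<close> to 1 and make the condition nearly vacuous.
\<close>

definition contains_power_mod_almost_every :: "nat \<Rightarrow> nat \<Rightarrow> int set \<Rightarrow> bool" where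
  "contains_power_mod_almost_every k q S \<longleftrightarrow>
     (\<exists>\<Delta>::nat. \<Delta> > 0 \<and>
        (\<forall>N::nat. N > 0 \<and> bigomega N \<le> k \<and> gcd N \<Delta> = 1 \<longrightarrow> contains_power_mod q S N))"

definition power_sets :: "nat \<Rightarrow> nat \<Rightarrow> int set set" where
  "power_sets k q = {S. finite S \<and> contains_power_mod_almost_every k q S}"

end

theory Submission
  imports Defs "HOL-Analysis.Summation_Tests" "HOL-Computational_Algebra.Fundamental_Theorem_Algebra"
begin

text \<open>
  Call \<open>s\<close> a residue modulo a prime \<open>p\<close> if \<open>x ^ q \<equiv> s\<close> has a solution modulo \<open>p\<close>. The
  theorem rests on one claim: if \<open>S\<close> is finite, nonempty and free of perfect \<open>q\<close>-th powers, then
  outside any finite set of primes there is a prime modulo which fewer than \<open>card S / q\<close> elements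
  of \<open>S\<close> are residues (\<open>exists_prime_few_power_residues\<close>). Discarding from \<open>S\<close> the elements that
  are not residues modulo such a prime turns a set with fewer than \<open>1 + q + \<dots> + q ^ (k + 1)\<close>
  elements into one with fewer than \<open>1 + q + \<dots> + q ^ k\<close>. After at most \<open>k\<close> such steps
  nothing is left, and the product of the primes is a modulus without \<open>q\<close>-th powers in \<open>S\<close>.
  This is the averaging argument for the smallest set of points that meets every subspace of
  codimension \<open>k\<close>: the elements of \<open>S\<close> are vectors of exponents modulo \<open>q\<close>, and a prime
  \<open>p \<equiv> 1\<close> modulo \<open>q\<close> acts as a linear form on them, whose kernel consists of the residues.

  For the claim, weigh a prime \<open>p \<equiv> 1\<close> modulo \<open>q\<close> by \<open>ln p / p\<close>. Two facts on the
  distribution of primes are combined. First, an \<open>s\<close> that is not a perfect power is a residue modulo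
  at most one \<open>q\<close>-th of these primes: the weighted sum of \<open>q * [s is a residue] - 1\<close> is bounded
  above (\<open>sum_power_residue_int_le\<close>). Secondly, the primes modulo which all of \<open>S\<close> consists of
  residues have a divergent sum of reciprocals (\<open>not_summable_all_power_residues\<close>). If the claim
  failed, then the first sum, added over \<open>s \<in> S\<close>, would have nonnegative terms from some point on,
  and every prime of the second kind would contribute at least its weight; so the divergence would
  contradict the bound.

  Both facts concern prime ideals of degree one: in the field generated by one \<open>q\<close>-th root for the
  first, in the field generated by a root of unity and the \<open>q\<close>-th roots of all elements of \<open>S\<close>
  for the second. Both follow from results on arbitrary orders, that is on subrings \<open>R\<close> of \<open>\<complex>\<close> with a finite
  \<open>\<int>\<close>-basis, of size \<open>n\<close> say. The size of an element is its height, the largest absolute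
  value of its coordinates. Rounding the coordinates of a quotient shows that modulo a nonzero \<open>z\<close> of
  height \<open>t\<close> every element is congruent to one of height \<open>K * t\<close>, where \<open>K\<close> depends on the
  basis only (\<open>reduce_mod_multiple\<close>). Hence an ideal that contains \<open>z\<close> has at most
  \<open>(2 * K * t + 1) ^ n\<close> residue classes, and this inequality takes the place of the norm.

  For the upper bound (\<open>sum_deg_one_le\<close>), count the pairs of an element \<open>x\<close> of a box with side
  \<open>H\<close> and an ideal of degree one, of norm at most \<open>H ^ n\<close>, that contains \<open>x\<close>, with weight
  \<open>ln p\<close>. Each \<open>x\<close> contributes at most \<open>ln (H ^ n)\<close> up to a constant, and each ideal contains its
  proportion \<open>1 / p\<close> of the box up to an error that sums to a constant. Comparison with the sum of
  \<open>ln p / p\<close> over all primes gives the first fact.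

  For the divergence (\<open>not_summable_deg_one\<close>), sieve a box whose elements are congruent to 1
  modulo all small primes and are too large to be units. Each of them lies in some maximal ideal
  over a large prime \<open>p\<close>. Ideals of degree at least 2 are few, since the sum of \<open>1 / p ^ 2\<close> converges.
  If the sum of \<open>1 / p\<close> over the primes with an ideal of degree one converged too, then all these
  ideals together could not cover the box.
\<close>

section \<open>Weighted sums over primes\<close>

lemma prod_coprime_dvd_nat:
  fixes f :: "'a \<Rightarrow> nat"
  assumes "finite A" "\<And>a. a \<in> A \<Longrightarrow> f a dvd n"
    "\<And>a b. a \<in> A \<Longrightarrow> b \<in> A \<Longrightarrow> a \<noteq> b \<Longrightarrow> coprime (f a) (f b)"
  shows "prod f A dvd n"
  using assms
proof (induction A rule: finite_induct)
  case (insert a A)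
  have "coprime (f a) (prod f A)" using insert by (intro prod_coprime_right) auto
  thus ?case using insert by (auto intro!: divides_mult)
qed auto

text \<open>
  Every prime between \<open>m\<close> and \<open>2 * m\<close> divides the central binomial coefficient, which is at most
  \<open>4 ^ m\<close>.
\<close>
lemma sum_ln_primes_between:
  "(\<Sum>p | prime p \<and> m < p \<and> p \<le> 2 * m. ln (real p)) \<le> real m * ln 4"
proof -
  define A where "A = {p::nat. prime p \<and> m < p \<and> p \<le> 2 * m}"
  have fin: "finite A" unfolding A_def by (rule finite_subset[of _ "{..2*m}"]) auto
  have dvd1: "p dvd (2 * m choose m)" if "p \<in> A" for p
  proof -
    have p: "prime p" "m < p" "p \<le> 2 * m" using that by (auto simp: A_def)
    have "fact m * fact (2 * m - m) * (2 * m choose m) = (fact (2 * m) :: nat)"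
      by (rule binomial_fact_lemma) simp
    moreover have "p dvd fact (2 * m)" using p by (simp add: prime_dvd_fact_iff)
    ultimately have "p dvd fact m * fact m * (2 * m choose m)" by simp
    moreover have "\<not> p dvd fact m" using p by (simp add: prime_dvd_fact_iff)
    ultimately show ?thesis using p(1) by (metis prime_dvd_mult_iff)
  qed
  have "(\<Prod>p\<in>A. p) dvd (2 * m choose m)"
    using fin dvd1 by (intro prod_coprime_dvd_nat) (auto simp: A_def primes_coprime)
  hence "(\<Prod>p\<in>A. p) \<le> (2 * m choose m)" by (intro dvd_imp_le) auto
  also have "\<dots> \<le> 2 ^ (2 * m)" by (rule binomial_le_pow2)
  finally have le: "real (\<Prod>p\<in>A. p) \<le> 4 ^ m" 
    by (simp add: power_mult del: of_nat_prod)
  have pos: "p > 0" if "p \<in> A" for p using that by (auto simp: A_def prime_gt_0_nat)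
  have "(\<Sum>p\<in>A. ln (real p)) = ln (\<Prod>p\<in>A. real p)"
    using fin pos by (subst ln_prod) auto
  also have "\<dots> \<le> ln (4 ^ m)" 
    using le pos by (subst ln_le_cancel_iff) (auto intro!: prod_pos)
  also have "\<dots> = real m * ln 4" by (simp add: ln_realpow)
  finally show ?thesis unfolding A_def .
qed

text \<open>
  The dyadic blocks grow geometrically with ratio \<open>2 powr (1 / n)\<close>, so the last block dominates.
  This controls the boundary errors when lattice points in a box of side \<open>2 powr (N / n)\<close> are counted.
\<close>
lemma sum_ln_powr_primes_le:
  fixes n :: nat assumes "n \<ge> 1"
  shows "(\<Sum>p | prime p \<and> p \<le> 2 ^ N. ln (real p) / real p * real p powr (1 / n))
           \<le> ln 4 / (2 powr (1 / n) - 1) * 2 powr (real N / n)"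
proof -
  define c where "c = ln 4 / (2 powr (1 / real n) - 1)"
  have gt1: "2 powr (1 / real n) > 1" using assms powr_less_mono[of 0 "1 / real n" 2] by simp
  have c: "c * (2 powr (1 / real n)) = c + ln 4" "c \<ge> 0"
    using gt1 assms by (auto simp: c_def divide_simps algebra_simps)
  have "(\<Sum>p | prime p \<and> p \<le> 2 ^ N. ln (real p) / real p * real p powr (1 / n)) \<le> c * 2 powr (real N / n)"
  proof (induction N)
    case 0
    have "{p::nat. prime p \<and> p \<le> 2 ^ 0} = {}" by (auto dest: prime_ge_2_nat)
    thus ?case using c by (simp only: sum.empty) simp
  next
    case (Suc N)
    let ?f = "\<lambda>p::nat. ln (real p) / real p * real p powr (1 / n)"
    have un: "{p::nat. prime p \<and> p \<le> 2 ^ Suc N} = {p. prime p \<and> p \<le> 2 ^ N} \<union> {p. prime p \<and> 2 ^ N < p \<and> p \<le> 2 * 2 ^ N}"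
      by (auto intro: order_trans)
    have split: "(\<Sum>p | prime p \<and> p \<le> 2 ^ Suc N. ?f p)
        = (\<Sum>p | prime p \<and> p \<le> 2 ^ N. ?f p) + (\<Sum>p | prime p \<and> 2 ^ N < p \<and> p \<le> 2 * 2 ^ N. ?f p)"
      unfolding un 
      by (subst sum.union_disjoint) auto
    have "(\<Sum>p | prime p \<and> 2 ^ N < p \<and> p \<le> 2 * 2 ^ N. ?f p)
          \<le> (\<Sum>p | prime p \<and> 2 ^ N < p \<and> p \<le> 2 * 2 ^ N. ln (real p) * (2 powr (real N * (1 / n - 1))))"
    proof (rule sum_mono)
      fix p assume "p \<in> {p::nat. prime p \<and> 2 ^ N < p \<and> p \<le> 2 * 2 ^ N}"
      hence p: "prime p" "2 ^ N < p" by auto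
      have p1: "real p \<ge> 1" using prime_ge_1_nat[OF p(1)] by simp
      have "real p powr (1 / n) / real p = real p powr (1 / n - 1)"
        using p1 by (simp add: powr_diff)
      also have "\<dots> \<le> (2 ^ N) powr (1 / n - 1)"
        using p assms by (intro powr_mono2') (auto simp: field_simps)
      also have "\<dots> = 2 powr (real N * (1 / n - 1))"
        by (simp add: powr_powr flip: powr_realpow)
      finally have "ln (real p) * (real p powr (1 / n) / real p) \<le> ln (real p) * 2 powr (real N * (1 / n - 1))"
        using p1 by (intro mult_left_mono) auto
      thus "?f p \<le> ln (real p) * (2 powr (real N * (1 / n - 1)))" by (simp add: field_simps)
    qed
    also have "\<dots> = (\<Sum>p | prime p \<and> 2 ^ N < p \<and> p \<le> 2 * 2 ^ N. ln (real p)) * (2 powr (real N * (1 / n - 1)))"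
      by (rule sum_distrib_right [symmetric])
    also have "\<dots> \<le> (real (2 ^ N) * ln 4) * (2 powr (real N * (1 / n - 1)))"
      by (intro mult_right_mono sum_ln_primes_between) auto
    also have "\<dots> = ln 4 * (2 powr (real N) * 2 powr (real N * (1 / n - 1)))"
      by (simp add: powr_realpow)
    also have "2 powr (real N) * 2 powr (real N * (1 / n - 1)) = 2 powr (real N / n)"
      by (simp flip: powr_add add: algebra_simps)
    finally have block: "(\<Sum>p | prime p \<and> 2 ^ N < p \<and> p \<le> 2 * 2 ^ N. ?f p) \<le> ln 4 * 2 powr (real N / n)" .
    have "c * 2 powr (real N / n) + ln 4 * 2 powr (real N / n) = c * 2 powr (1 / real n) * 2 powr (real N / n)"
      unfolding c by (simp add: algebra_simps)
    also have "\<dots> = c * 2 powr (real (Suc N) / n)"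
      by (simp add: powr_add[symmetric] add_divide_distrib)
    finally show ?case using Suc block split by linarith
  qed
  thus ?thesis by (simp add: c_def)
qed

lemma ln_fact_ge: "ln (fact n :: real) \<ge> real n * ln (real n) - real n"
proof (cases "n = 0")
  case False
  have "real n ^ n / fact n \<le> exp (real n)"
  proof -
    have "summable (\<lambda>k. real n ^ k /\<^sub>R fact k)" by (rule summable_exp_generic)
    hence "(\<Sum>k\<in>{n}. real n ^ k /\<^sub>R fact k) \<le> (\<Sum>k. real n ^ k /\<^sub>R fact k)"
      by (intro sum_le_suminf) auto
    thus ?thesis by (simp add: exp_def field_simps)
  qed
  hence "ln (real n ^ n / fact n) \<le> ln (exp (real n))"
    using False by (subst ln_le_cancel_iff) auto
  thus ?thesis using False by (simp add: ln_div ln_realpow)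
qed simp

lemma multiplicity_fact_le:
  assumes "prime (p::nat)"
  shows "real (multiplicity p (fact n)) \<le> real n / (real p - 1)"
proof -
  have p2: "p \<ge> 2" using assms by (rule prime_ge_2_nat)
  have m1: "multiplicity p m \<le> card {j\<in>{1..n}. p ^ j dvd m}" if "m \<in> {1..n}" for m
  proof -
    have "{1..multiplicity p m} \<subseteq> {j\<in>{1..n}. p ^ j dvd m}"
    proof
      fix j assume "j \<in> {1..multiplicity p m}"
      hence j: "1 \<le> j" "j \<le> multiplicity p m" by auto
      have dvd: "p ^ j dvd m" using j by (rule_tac multiplicity_dvd') auto
      hence "p ^ j \<le> m" using that by (intro dvd_imp_le) auto
      moreover have "j < p ^ j" using p2 by (intro power_gt_expt) auto
      ultimately show "j \<in> {j\<in>{1..n}. p ^ j dvd m}" using j dvd that by auto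
    qed
    hence "card {1..multiplicity p m} \<le> card {j\<in>{1..n}. p ^ j dvd m}"
      by (intro card_mono) auto
    thus ?thesis by simp
  qed
  have cnt: "real (card {m\<in>{1..n}. d dvd m}) \<le> real n / real d" if "d > 0" for d
  proof -
    have "{m\<in>{1..n}. d dvd m} \<subseteq> (\<lambda>i. d * i) ` {1..n div d}"
      using that by (auto simp: dvd_def less_eq_div_iff_mult_less_eq mult.commute Suc_le_eq)
    hence "card {m\<in>{1..n}. d dvd m} \<le> card ((\<lambda>i. d * i) ` {1..n div d})" by (intro card_mono) auto
    also have "\<dots> \<le> card {1..n div d}" by (rule card_image_le) auto
    finally have "real (card {m\<in>{1..n}. d dvd m}) \<le> real (n div d)" by simp
    also have "\<dots> \<le> real n / real d" by (rule of_nat_div_le_of_nat)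
    finally show ?thesis .
  qed
  have "multiplicity p (fact n) = (\<Sum>m=1..n. multiplicity p m)"
  proof (induction n)
    case (Suc n)
    have "multiplicity p (fact (Suc n)) = multiplicity p (Suc n * fact n)" by (simp only: fact_Suc of_nat_id)
    also have "\<dots> = multiplicity p (Suc n) + multiplicity p (fact n)"
      using assms by (intro prime_elem_multiplicity_mult_distrib) auto
    also have "\<dots> = (\<Sum>m=1..Suc n. multiplicity p m)"
      unfolding Suc by (subst sum.nat_ivl_Suc') (simp_all only: le_add1 plus_1_eq_Suc Suc_le_mono le0)
    finally show ?case .
  qed simp
  also have "\<dots> \<le> (\<Sum>m=1..n. card {j\<in>{1..n}. p ^ j dvd m})" by (rule sum_mono) (rule m1)
  also have "\<dots> = (\<Sum>m=1..n. \<Sum>j=1..n. if p ^ j dvd m then 1 else 0)"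
    by (simp only: card_eq_sum sum.inter_filter finite_atLeastAtMost)
  also have "\<dots> = (\<Sum>j=1..n. \<Sum>m=1..n. if p ^ j dvd m then 1 else 0)" by (rule sum.swap)
  also have "\<dots> = (\<Sum>j=1..n. card {m\<in>{1..n}. p ^ j dvd m})"
    by (simp only: card_eq_sum sum.inter_filter finite_atLeastAtMost)
  finally have "real (multiplicity p (fact n)) \<le> (\<Sum>j=1..n. real (card {m\<in>{1..n}. p ^ j dvd m}))"
    by (simp flip: of_nat_sum)
  also have "\<dots> \<le> (\<Sum>j=1..n. real n / real (p ^ j))" using p2 by (intro sum_mono cnt) auto
  also have "\<dots> = real n * (\<Sum>j=1..n. (1 / real p) ^ j)"
    by (simp add: sum_distrib_left power_one_over)
  also have "(\<Sum>j=1..n. (1 / real p) ^ j) \<le> 1 / (real p - 1)"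
  proof -
    have "(\<Sum>j=1..n. (1 / real p) ^ j) \<le> (1 - (1 / real p) ^ n) / (real p - 1)" 
    proof (induction n)
      case (Suc n)
      have "(\<Sum>j=1..Suc n. (1 / real p) ^ j) \<le> (1 - (1 / real p) ^ n) / (real p - 1) + (1 / real p) ^ Suc n"
        using Suc by simp
      also have "\<dots> = (1 - (1 / real p) ^ Suc n) / (real p - 1)"
        using p2 by (simp add: field_simps)
      finally show ?case .
    qed simp
    also have "\<dots> \<le> 1 / (real p - 1)" using p2 by (intro divide_right_mono) auto
    finally show ?thesis .
  qed
  finally show ?thesis by (simp add: mult_left_mono)
qed

text \<open>
  Mertens: write \<open>ln (n!)\<close> as a sum over primes with Legendre's formula and compare with Stirling's
  lower bound. Replacing \<open>1 / (p - 1)\<close> by \<open>1 / p\<close> costs only a convergent series.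
\<close>
lemma mertens_lower:
  "\<exists>C. \<forall>n\<ge>1. ln (real n) - C \<le> (\<Sum>p | prime p \<and> p \<le> n. ln (real p) / real p)"
proof -
  define g where "g = (\<lambda>p::nat. 4 * real p powr (-3/2))"
  have sg: "summable g" unfolding g_def by (intro summable_mult) (simp add: summable_real_powr_iff)
  have gpos: "g p \<ge> 0" for p by (simp add: g_def)
  have est: "ln (real p) / (real p - 1) \<le> ln (real p) / real p + g p" if "prime p" for p
  proof -
    have p2: "real p \<ge> 2" using prime_ge_2_nat[OF that] by simp
    have "ln (real p) = 2 * ln (sqrt (real p))" using p2 by (simp add: ln_sqrt)
    also have "\<dots> \<le> 2 * sqrt (real p)" 
      using ln_le_minus_one[of "sqrt (real p)"] p2 by simp
    finally have l: "ln (real p) \<le> 2 * sqrt (real p)" .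
    have "ln (real p) / (real p - 1) - ln (real p) / real p = ln (real p) / (real p * (real p - 1))"
      using p2 by (simp add: field_simps)
    also have "\<dots> \<le> (2 * sqrt (real p)) / (real p * (real p / 2))"
      using p2 l by (intro frac_le mult_left_mono) auto
    also have "\<dots> = 4 * (real p powr (1/2) / real p powr 2)"
      using p2 by (simp add: powr_half_sqrt power2_eq_square)
    also have "real p powr (1/2) / real p powr 2 = real p powr (-3/2)"
      by (simp only: powr_diff [symmetric]) simp
    also have "4 * real p powr (-3/2) = g p" by (simp only: g_def)
    finally show ?thesis by simp
  qed
  show ?thesis
  proof (rule exI[of _ "1 + suminf g"], intro allI impI)
    fix n :: nat assume n: "n \<ge> 1"
    let ?P = "{p. prime p \<and> p \<le> n}"
    have finP: "finite ?P" by (rule finite_subset[of _ "{..n}"]) auto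
    have pf: "prime_factors (fact n) = ?P" 
      by (auto simp: in_prime_factors_iff prime_dvd_fact_iff)
    have "ln (fact n :: real) = ln (real (\<Prod>p\<in>prime_factors (fact n). p ^ multiplicity p (fact n)))"
      by (subst prod_prime_factors) auto
    also have "\<dots> = (\<Sum>p\<in>?P. ln (real (p ^ multiplicity p (fact n))))"
      unfolding pf of_nat_prod using finP by (subst ln_prod) (auto simp: prime_gt_0_nat)
    also have "\<dots> = (\<Sum>p\<in>?P. real (multiplicity p (fact n)) * ln (real p))"
      by (intro sum.cong refl) (auto simp: ln_realpow prime_gt_0_nat)
    also have "\<dots> \<le> (\<Sum>p\<in>?P. real n / (real p - 1) * ln (real p))"
      by (intro sum_mono mult_right_mono multiplicity_fact_le) (auto dest: prime_ge_1_nat)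
    also have "\<dots> = real n * (\<Sum>p\<in>?P. ln (real p) / (real p - 1))"
      by (simp add: sum_distrib_left)
    also have "\<dots> \<le> real n * (\<Sum>p\<in>?P. ln (real p) / real p + g p)"
      by (intro mult_left_mono sum_mono est) auto
    also have "\<dots> = real n * ((\<Sum>p\<in>?P. ln (real p) / real p) + sum g ?P)"
      by (simp add: sum.distrib)
    also have "\<dots> \<le> real n * ((\<Sum>p\<in>?P. ln (real p) / real p) + suminf g)"
      using sum_le_suminf[OF sg finP] gpos by (intro mult_left_mono) auto
    finally have "real n * (ln (real n) - 1) \<le> real n * ((\<Sum>p\<in>?P. ln (real p) / real p) + suminf g)"
      using ln_fact_ge[of n] by (simp add: algebra_simps)
    thus "ln (real n) - (1 + suminf g) \<le> (\<Sum>p\<in>?P. ln (real p) / real p)"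
      using n by simp
  qed
qed

section \<open>Orders in the complex numbers and their coordinates\<close>

locale complex_order =
  fixes B :: "complex set"
  assumes finite_B: "finite B"
    and one_in_B: "1 \<in> B"
    and independent_B: "\<And>c :: complex \<Rightarrow> int. (\<Sum>b\<in>B. of_int (c b) * b) = 0 \<Longrightarrow> b \<in> B \<Longrightarrow> c b = 0"
    and mult_B: "\<And>a b. a \<in> B \<Longrightarrow> b \<in> B \<Longrightarrow> \<exists>c :: complex \<Rightarrow> int. a * b = (\<Sum>d\<in>B. of_int (c d) * d)"
begin

definition comb :: "(complex \<Rightarrow> int) \<Rightarrow> complex" where
  "comb c = (\<Sum>b\<in>B. of_int (c b) * b)"

definition R :: "complex set" where "R = range comb"

definition coord :: "complex \<Rightarrow> complex \<Rightarrow> int" where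
  "coord z = (SOME c. comb c = z)"

abbreviation n :: nat where "n \<equiv> card B"

lemma n_pos: "n > 0"
  using finite_B one_in_B by (auto simp: card_gt_0_iff)

lemma comb_in_R [simp]: "comb c \<in> R" by (simp add: R_def)

lemma comb_coord:
  assumes "z \<in> R"
  shows "comb (coord z) = z"
proof -
  obtain c where "comb c = z" using assms by (auto simp: R_def)
  thus ?thesis unfolding coord_def using someI[of "\<lambda>c. comb c = z"] by blast
qed

lemma comb_add: "comb c + comb d = comb (\<lambda>b. c b + d b)"
  by (simp add: comb_def sum.distrib ring_distribs)

lemma comb_diff: "comb c - comb d = comb (\<lambda>b. c b - d b)"
  by (simp add: comb_def sum_subtractf ring_distribs)

lemma comb_scale: "of_int k * comb c = comb (\<lambda>b. k * c b)"
  by (simp add: comb_def sum_distrib_left mult.assoc)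

lemma comb_unit: "a \<in> B \<Longrightarrow> comb (\<lambda>b. if b = a then 1 else 0) = a"
proof -
  assume "a \<in> B"
  have "comb (\<lambda>b. if b = a then 1 else 0) = (\<Sum>b\<in>B. if b = a then a else 0)"
    unfolding comb_def by (intro sum.cong) auto
  thus ?thesis using \<open>a \<in> B\<close> finite_B by simp
qed

lemma coord_comb: "b \<in> B \<Longrightarrow> coord (comb c) b = c b"
proof -
  assume b: "b \<in> B"
  have "comb (coord (comb c)) - comb c = 0" by (simp add: comb_coord)
  hence "(\<Sum>b\<in>B. of_int (coord (comb c) b - c b) * b) = 0"
    unfolding comb_diff by (simp add: comb_def)
  from independent_B[OF this b] show ?thesis by simp
qed

lemma B_subset_R: "a \<in> B \<Longrightarrow> a \<in> R"
  using comb_in_R[of "\<lambda>b. if b = a then 1 else 0"] by (simp only: comb_unit)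

lemma R_add [intro]: "z \<in> R \<Longrightarrow> w \<in> R \<Longrightarrow> z + w \<in> R"
  using comb_in_R[of "\<lambda>b. coord z b + coord w b"] by (simp only: comb_add [symmetric] comb_coord)

lemma R_diff [intro]: "z \<in> R \<Longrightarrow> w \<in> R \<Longrightarrow> z - w \<in> R"
  using comb_in_R[of "\<lambda>b. coord z b - coord w b"] by (simp only: comb_diff [symmetric] comb_coord)

lemma R_scale [intro]: "z \<in> R \<Longrightarrow> of_int k * z \<in> R"
  using comb_in_R[of "\<lambda>b. k * coord z b"] by (simp only: comb_scale [symmetric] comb_coord)

lemma R_1 [simp, intro]: "1 \<in> R" using B_subset_R one_in_B .

lemma R_of_int [simp, intro]: "of_int k \<in> R"
  using R_scale[of 1 k] by simp

lemma R_of_nat [simp, intro]: "of_nat k \<in> R"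
  using R_of_int[of "int k"] by simp

lemma R_0 [simp, intro]: "0 \<in> R" using R_of_int[of 0] by simp

lemma R_uminus [intro]: "z \<in> R \<Longrightarrow> - z \<in> R"
  using R_diff[of 0 z] by simp

lemma R_sum [intro]: "(\<And>i. i \<in> A \<Longrightarrow> f i \<in> R) \<Longrightarrow> sum f A \<in> R"
  by (induction A rule: infinite_finite_induct) auto

lemma of_int_mult_mult: "(of_int i * a) * (of_int j * b) = of_int (i * j) * (a * b :: complex)"
  by simp

lemma R_mult [intro]: assumes "z \<in> R" "w \<in> R" shows "z * w \<in> R"
proof -
  have BB: "a * b \<in> R" if "a \<in> B" "b \<in> B" for a b
    using mult_B[OF that] by (auto simp: R_def comb_def)
  have "comb (coord z) * comb (coord w) 
      = (\<Sum>a\<in>B. \<Sum>b\<in>B. of_int (coord z a * coord w b) * (a * b))"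
    by (simp only: comb_def sum_product of_int_mult_mult)
  also have "\<dots> \<in> R" using BB by (intro R_sum R_scale) auto
  finally show ?thesis using assms by (simp add: comb_coord)
qed

lemma R_prod [intro]: "(\<And>i. i \<in> A \<Longrightarrow> f i \<in> R) \<Longrightarrow> prod f A \<in> R"
  by (induction A rule: infinite_finite_induct) auto

lemma R_power [intro]: "z \<in> R \<Longrightarrow> z ^ k \<in> R"
  by (induction k) auto

lemma coord_add: "z \<in> R \<Longrightarrow> w \<in> R \<Longrightarrow> b \<in> B \<Longrightarrow> coord (z + w) b = coord z b + coord w b"
  using coord_comb[of b "\<lambda>b. coord z b + coord w b"] by (simp only: comb_add [symmetric] comb_coord)

lemma coord_diff: "z \<in> R \<Longrightarrow> w \<in> R \<Longrightarrow> b \<in> B \<Longrightarrow> coord (z - w) b = coord z b - coord w b"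
  using coord_comb[of b "\<lambda>b. coord z b - coord w b"] by (simp only: comb_diff [symmetric] comb_coord)

lemma coord_scale: "z \<in> R \<Longrightarrow> b \<in> B \<Longrightarrow> coord (of_int k * z) b = k * coord z b"
  using coord_comb[of b "\<lambda>b. k * coord z b"] by (simp only: comb_scale [symmetric] comb_coord)

lemma coord_basis: "a \<in> B \<Longrightarrow> b \<in> B \<Longrightarrow> coord a b = (if b = a then 1 else 0)"
  using coord_comb[of b "\<lambda>b. if b = a then 1 else 0"] by (simp only: comb_unit)

lemma coord_of_int: "b \<in> B \<Longrightarrow> coord (of_int k) b = (if b = 1 then k else 0)"
  using coord_scale[of 1 b k] coord_basis[OF one_in_B, of b] by simp

lemma coord_sum: "(\<And>i. i \<in> A \<Longrightarrow> f i \<in> R) \<Longrightarrow> b \<in> B \<Longrightarrow> coord (sum f A) b = (\<Sum>i\<in>A. coord (f i) b)"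
proof (induction A rule: infinite_finite_induct)
  case (insert x A)
  have "sum f A \<in> R" "f x \<in> R" using insert.prems(1) by (blast intro: R_sum)+
  moreover have "coord (sum f A) b = (\<Sum>i\<in>A. coord (f i) b)" using insert.IH insert.prems by blast
  ultimately show ?case using insert.hyps insert.prems(2) by (simp add: coord_add)
qed (use coord_of_int[of b 0] in auto)

lemma coord_mult:
  assumes "z \<in> R" "w \<in> R" "d \<in> B"
  shows "coord (z * w) d = (\<Sum>a\<in>B. \<Sum>b\<in>B. coord z a * coord w b * coord (a * b) d)"
proof -
  have "z * w = comb (coord z) * comb (coord w)" by (simp only: comb_coord assms)
  also have "\<dots> = (\<Sum>a\<in>B. \<Sum>b\<in>B. of_int (coord z a * coord w b) * (a * b))"
    by (simp only: comb_def sum_product of_int_mult_mult)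
  also have "coord \<dots> d = (\<Sum>a\<in>B. coord (\<Sum>b\<in>B. of_int (coord z a * coord w b) * (a * b)) d)"
    using assms(3) by (intro coord_sum R_sum R_scale R_mult) (auto intro: B_subset_R)
  also have "\<dots> = (\<Sum>a\<in>B. \<Sum>b\<in>B. coord (of_int (coord z a * coord w b) * (a * b)) d)"
    using assms(3) by (intro sum.cong refl coord_sum R_sum R_scale R_mult) (auto intro: B_subset_R)
  also have "\<dots> = (\<Sum>a\<in>B. \<Sum>b\<in>B. coord z a * coord w b * coord (a * b) d)"
    using assms(3) by (intro sum.cong refl coord_scale R_mult) (auto intro: B_subset_R)
  finally show ?thesis .
qed

text \<open>
  The structure constants of the ring bound the height of a product by \<open>K\<close> times the product of the
  heights (\<open>height_le_mult\<close>). The summand 1 makes \<open>K\<close> positive.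
\<close>
definition K :: nat where
  "K = nat (\<Sum>a\<in>B. \<Sum>b\<in>B. \<Sum>d\<in>B. \<bar>coord (a * b) d\<bar>) + 1"

text \<open>
  The height is used through upper bounds only, in natural numbers, so that numbers of lattice points
  can be written down directly.
\<close>
definition height_le :: "nat \<Rightarrow> complex \<Rightarrow> bool" where
  "height_le t z \<longleftrightarrow> z \<in> R \<and> (\<forall>b\<in>B. \<bar>coord z b\<bar> \<le> int t)"

lemma height_leD: "height_le t z \<Longrightarrow> z \<in> R" "height_le t z \<Longrightarrow> b \<in> B \<Longrightarrow> \<bar>coord z b\<bar> \<le> int t"
  by (auto simp: height_le_def)

lemma height_le_mono:
  assumes "height_le s z" "s \<le> t"
  shows "height_le t z"
  unfolding height_le_def
proof (intro conjI ballI)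
  show "z \<in> R" using assms(1) by (rule height_leD)
  show "\<bar>coord z b\<bar> \<le> int t" if "b \<in> B" for b
    using height_leD(2)[OF assms(1) that] assms(2) by linarith
qed

lemma height_le_exists: "z \<in> R \<Longrightarrow> \<exists>t. height_le t z"
proof -
  assume z: "z \<in> R"
  have "\<bar>coord z b\<bar> \<le> int (nat (\<Sum>a\<in>B. \<bar>coord z a\<bar>))" if "b \<in> B" for b
    using member_le_sum[of b B "\<lambda>a. \<bar>coord z a\<bar>"] finite_B that by (simp add: sum_nonneg)
  thus ?thesis using z unfolding height_le_def by blast
qed

lemma height_le_mult:
  assumes "height_le s z" "height_le t w" shows "height_le (K * s * t) (z * w)"
  unfolding height_le_def
proof (intro conjI ballI)
  have R: "z \<in> R" "w \<in> R" using assms by (auto simp: height_le_def)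
  show "z * w \<in> R" using R by auto
  fix d assume d: "d \<in> B"
  have "\<bar>coord (z * w) d\<bar> \<le> (\<Sum>a\<in>B. \<Sum>b\<in>B. \<bar>coord z a * coord w b * coord (a * b) d\<bar>)"
    unfolding coord_mult[OF R d]
    by (rule order_trans[OF sum_abs sum_mono]) (rule sum_abs)
  also have "\<dots> \<le> (\<Sum>a\<in>B. \<Sum>b\<in>B. int s * int t * (\<Sum>d\<in>B. \<bar>coord (a * b) d\<bar>))"
    unfolding abs_mult using height_leD(2)[OF assms(1)] height_leD(2)[OF assms(2)] d finite_B
    by (intro sum_mono mult_mono member_le_sum) (auto intro!: mult_nonneg_nonneg)
  also have "\<dots> = int s * int t * (\<Sum>a\<in>B. \<Sum>b\<in>B. \<Sum>d\<in>B. \<bar>coord (a * b) d\<bar>)"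
    by (simp add: sum_distrib_left)
  also have "\<dots> \<le> int s * int t * int K"
    by (intro mult_left_mono) (auto simp: K_def)
  finally show "\<bar>coord (z * w) d\<bar> \<le> int (K * s * t)" by (simp add: mult_ac)
qed

lemma height_le_sum:
  assumes "\<And>i. i \<in> A \<Longrightarrow> height_le (t i) (f i)"
  shows "height_le (sum t A) (sum f A)"
  unfolding height_le_def
proof (intro conjI ballI)
  show "sum f A \<in> R" using assms by (auto simp: height_le_def)
  fix b assume b: "b \<in> B"
  have "coord (sum f A) b = (\<Sum>i\<in>A. coord (f i) b)" using assms b by (intro coord_sum) (auto simp: height_le_def)
  also have "\<bar>\<dots>\<bar> \<le> (\<Sum>i\<in>A. int (t i))"
    using assms b by (intro order_trans[OF sum_abs sum_mono]) (auto simp: height_le_def)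
  finally show "\<bar>coord (sum f A) b\<bar> \<le> int (sum t A)" by simp
qed

lemma height_le_scale: "height_le t z \<Longrightarrow> \<bar>k\<bar> \<le> int s \<Longrightarrow> height_le (s * t) (of_int k * z)"
  unfolding height_le_def by (auto simp: coord_scale abs_mult intro!: mult_mono)

lemma height_le_of_nat: "height_le k (of_nat k)"
  unfolding height_le_def using coord_of_int[of _ "int k"] by auto

definition grid :: "int \<Rightarrow> nat \<Rightarrow> complex set" where
  "grid l H = {z \<in> R. \<forall>b\<in>B. l \<le> coord z b \<and> coord z b < l + int H}"

lemma bij_betw_grid: "bij_betw comb (B \<rightarrow>\<^sub>E {l..<l + int H}) (grid l H)"
proof (rule bij_betwI[where g = "\<lambda>z. restrict (coord z) B"])
  show "comb \<in> (B \<rightarrow>\<^sub>E {l..<l + int H}) \<rightarrow> grid l H"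
    by (auto simp: grid_def coord_comb dest: PiE_mem)
  show "(\<lambda>z. restrict (coord z) B) \<in> grid l H \<rightarrow> (B \<rightarrow>\<^sub>E {l..<l + int H})"
    by (auto simp: grid_def)
  show "restrict (coord (comb x)) B = x" if "x \<in> B \<rightarrow>\<^sub>E {l..<l + int H}" for x
    using that by (auto simp: coord_comb fun_eq_iff PiE_def extensional_def)
  show "comb (restrict (coord z) B) = z" if "z \<in> grid l H" for z
  proof -
    have "comb (restrict (coord z) B) = comb (coord z)" unfolding comb_def by (intro sum.cong) auto
    thus ?thesis using that by (simp add: grid_def comb_coord)
  qed
qed

lemma finite_grid: "finite (grid l H)"
  using bij_betw_finite[OF bij_betw_grid] finite_B by (simp add: finite_PiE)

lemma card_grid: "card (grid l H) = H ^ n"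
  using bij_betw_same_card[OF bij_betw_grid, of l H] finite_B by (simp add: card_PiE)

lemma height_le_grid: "height_le t z \<longleftrightarrow> z \<in> grid (- int t) (2 * t + 1)"
  by (auto simp: height_le_def grid_def abs_le_iff)

lemma finite_height_le: "finite {z. height_le t z}"
  unfolding height_le_grid using finite_grid by simp

lemma card_height_le: "card {z. height_le t z} = (2 * t + 1) ^ n"
  unfolding height_le_grid using card_grid by simp

end

section \<open>Reduction modulo an element, and maximal ideals\<close>

context complex_order
begin

text \<open>
  Pigeonhole: there are more small integer combinations of \<open>1, z, \<dots>, z ^ n\<close> than elements of
  the height that these combinations can reach.
\<close>
lemma dependent_powers:
  assumes "z \<in> R"
  shows "\<exists>c :: nat \<Rightarrow> int. (\<exists>j\<le>n. c j \<noteq> 0) \<and> (\<Sum>j\<le>n. of_int (c j) * z ^ j) = 0"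
proof -
  have "\<forall>j. \<exists>t. height_le t (z ^ j)" using assms by (auto intro: height_le_exists)
  then obtain t where t: "\<And>j. height_le (t j) (z ^ j)" by metis
  define T where "T = (\<Sum>j\<le>n. t j)"
  \<comment> \<open>The number of combinations is \<open>E ^ (n + 1)\<close>, that of possible values at most \<open>((2 * T + 1) * E) ^ n\<close>.\<close>
  define E where "E = (2 * T + 1) ^ n + 1"
  let ?F = "{..n} \<rightarrow>\<^sub>E {0..<int E}"
  let ?f = "\<lambda>e. \<Sum>j\<le>n. of_int (e j) * z ^ j"
  have "?f ` ?F \<subseteq> {w. height_le (E * T) w}"
  proof safe
    fix e assume e: "e \<in> ?F"
    have "height_le (\<Sum>j\<le>n. E * t j) (?f e)"
      using e by (intro height_le_sum height_le_scale t) (auto dest!: PiE_mem)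
    thus "height_le (E * T) (?f e)" by (simp add: T_def sum_distrib_left)
  qed
  from card_mono[OF finite_height_le this]
  have "card (?f ` ?F) \<le> (2 * (E * T) + 1) ^ n" by (simp only: card_height_le)
  also have "\<dots> \<le> ((2 * T + 1) * E) ^ n"
  proof (rule power_mono)
    have "E \<ge> 1" by (simp add: E_def)
    thus "2 * (E * T) + 1 \<le> (2 * T + 1) * E" by (simp add: algebra_simps)
  qed simp
  also have "\<dots> = (2 * T + 1) ^ n * E ^ n" by (rule power_mult_distrib)
  also have "\<dots> < E * E ^ n" by (intro mult_strict_right_mono) (simp_all add: E_def)
  also have "\<dots> = card ?F" by (simp add: card_PiE)
  finally have "\<not> inj_on ?f ?F" using card_image[of ?f ?F] by linarith
  then obtain e e' where e: "e \<in> ?F" "e' \<in> ?F" "e \<noteq> e'" "?f e = ?f e'"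
    by (auto simp: inj_on_def)
  have "\<exists>j\<le>n. e j - e' j \<noteq> 0"
  proof (rule ccontr)
    assume "\<not> ?thesis"
    hence "e = e'" using e(1,2) by (intro PiE_ext) auto
    with e(3) show False by contradiction
  qed
  moreover have "(\<Sum>j\<le>n. of_int (e j - e' j) * z ^ j) = 0"
    using e(4) by (simp add: ring_distribs sum_subtractf)
  ultimately show ?thesis by (intro exI[of _ "\<lambda>j. e j - e' j"]) auto
qed

text \<open>
  Cancel the lowest power of \<open>z\<close> in an integer relation between its powers. The multiplier
  \<open>u\<close> stands for \<open>N / z\<close>, so the field of fractions is reached by dividing by integers.
\<close>
lemma divides_integer:
  assumes "z \<in> R" "z \<noteq> 0"
  shows "\<exists>u\<in>R. \<exists>N>0. z * u = of_int N"
proof -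
  obtain c where c: "\<exists>j\<le>n. c j \<noteq> (0::int)" "(\<Sum>j\<le>n. of_int (c j) * z ^ j) = 0"
    using dependent_powers[OF assms(1)] by blast
  \<comment> \<open>The lowest power of \<open>z\<close> that occurs in the relation.\<close>
  define i where "i = (LEAST j. j \<le> n \<and> c j \<noteq> 0)"
  have i: "i \<le> n" "c i \<noteq> 0" using LeastI_ex[OF c(1)] by (auto simp: i_def)
  have less: "c j = 0" if "j < i" for j
    using not_less_Least[of j "\<lambda>j. j \<le> n \<and> c j \<noteq> 0"] that i(1) unfolding i_def[symmetric] by auto
  define u where "u = - (\<Sum>j=Suc i..n. of_int (c j) * z ^ (j - Suc i))"
  have u: "u \<in> R" unfolding u_def using assms by (intro R_uminus R_sum R_scale R_power) auto
  have "0 = (\<Sum>j=i..n. of_int (c j) * z ^ j)"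
    unfolding c(2)[symmetric] using less by (intro sum.mono_neutral_right) auto
  also have "\<dots> = (\<Sum>j=i..n. z ^ i * (of_int (c j) * z ^ (j - i)))"
    by (intro sum.cong refl) (simp flip: power_add add: mult.left_commute)
  also have "\<dots> = z ^ i * (\<Sum>j=i..n. of_int (c j) * z ^ (j - i))"
    by (rule sum_distrib_left [symmetric])
  finally have "(\<Sum>j=i..n. of_int (c j) * z ^ (j - i)) = 0" using assms(2) by simp
  also have "(\<Sum>j=i..n. of_int (c j) * z ^ (j - i)) = of_int (c i) + (\<Sum>j=Suc i..n. of_int (c j) * z ^ (j - i))"
    using i(1) by (simp add: sum.atLeast_Suc_atMost)
  also have "(\<Sum>j=Suc i..n. of_int (c j) * z ^ (j - i)) = (\<Sum>j=Suc i..n. z * (of_int (c j) * z ^ (j - Suc i)))"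
    by (intro sum.cong refl) (auto simp: Suc_diff_Suc mult_ac simp flip: power_Suc)
  also have "\<dots> = - (z * u)" by (simp add: u_def sum_distrib_left)
  finally have zu: "z * u = of_int (c i)" by simp
  show ?thesis
  proof (cases "c i > 0")
    case True thus ?thesis using u zu by blast
  next
    case False
    have "z * (- u) = of_int (- c i)" using zu by simp
    moreover have "- u \<in> R" using u by auto
    ultimately show ?thesis using False i(2) by (metis neg_0_less_iff_less linorder_neqE)
  qed
qed

text \<open>
  The quotient \<open>w / z\<close> has rational coordinates. Rounding them down gives \<open>v\<close>, and
  \<open>w - z * v\<close> is \<open>z\<close> times an element with coordinates in the unit interval. The bound does not involve
  \<open>w\<close>, and it is linear in the height of \<open>z\<close>.
\<close>
lemma reduce_mod_multiple:
  assumes "height_le t z" "z \<noteq> 0" "w \<in> R"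
  shows "\<exists>v\<in>R. height_le (K * t) (w - z * v)"
proof -
  have zR: "z \<in> R" using assms by (auto simp: height_le_def)
  obtain u N where uN: "u \<in> R" "N > 0" "z * u = of_int N" using divides_integer[OF zR assms(2)] by blast
  define v where "v = comb (\<lambda>b. coord (w * u) b div N)"
  define r where "r = comb (\<lambda>b. coord (w * u) b mod N)"
  have "of_int N * v + r = comb (coord (w * u))"
    by (simp add: v_def r_def comb_scale comb_add)
  also have "\<dots> = w * u" using assms uN by (intro comb_coord) auto
  finally have wu: "w * u = of_int N * v + r" by simp
  have vr: "v \<in> R" "r \<in> R" by (auto simp: v_def r_def)
  have wr: "height_le (nat N) r" unfolding height_le_def r_def
    using uN(2) by (auto simp: coord_comb pos_mod_bound less_imp_le)
  have "of_int N * (w - z * v) = z * r"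
  proof -
    have "of_int N * (w - z * v) = z * (w * u) - z * (of_int N * v)"
      unfolding uN(3)[symmetric] by (simp add: algebra_simps)
    also have "\<dots> = z * r" unfolding wu by (simp add: algebra_simps)
    finally show ?thesis .
  qed
  moreover have "height_le (K * t * nat N) (z * r)" by (rule height_le_mult[OF assms(1) wr])
  ultimately have Nw: "height_le (K * t * nat N) (of_int N * (w - z * v))" by simp
  have "height_le (K * t) (w - z * v)"
    unfolding height_le_def
  proof (intro conjI ballI)
    show R: "w - z * v \<in> R" using assms vr zR by auto
    fix b assume b: "b \<in> B"
    have "N * \<bar>coord (w - z * v) b\<bar> = \<bar>coord (of_int N * (w - z * v)) b\<bar>"
      using uN(2) by (simp only: coord_scale[OF R b] abs_mult abs_of_pos)
    also have "\<dots> \<le> int (K * t * nat N)" by (rule height_leD(2)[OF Nw b])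
    also have "\<dots> = N * int (K * t)" using uN(2) by simp
    finally show "\<bar>coord (w - z * v) b\<bar> \<le> int (K * t)"
      using uN(2) by (rule mult_left_le_imp_le)
  qed
  thus ?thesis using vr by blast
qed

definition is_ideal :: "complex set \<Rightarrow> bool" where
  "is_ideal I \<longleftrightarrow> I \<subseteq> R \<and> 0 \<in> I \<and> (\<forall>x\<in>I. \<forall>y\<in>I. x + y \<in> I) \<and> (\<forall>x\<in>I. \<forall>r\<in>R. r * x \<in> I)"

lemma idealD:
  assumes "is_ideal I"
  shows "x \<in> I \<Longrightarrow> x \<in> R" "0 \<in> I" "x \<in> I \<Longrightarrow> y \<in> I \<Longrightarrow> x + y \<in> I"
    "x \<in> I \<Longrightarrow> r \<in> R \<Longrightarrow> r * x \<in> I" "x \<in> I \<Longrightarrow> r \<in> R \<Longrightarrow> x * r \<in> I"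
  using assms by (auto simp: is_ideal_def mult.commute)

lemma ideal_diff: assumes "is_ideal I" "x \<in> I" "y \<in> I" shows "x - y \<in> I"
proof -
  have "of_int (-1) * y \<in> I" by (rule idealD(4)[OF assms(1,3)]) (rule R_of_int)
  from idealD(3)[OF assms(1,2) this] show ?thesis by simp
qed

lemma ideal_sum: "is_ideal I \<Longrightarrow> (\<And>i. i \<in> A \<Longrightarrow> f i \<in> I) \<Longrightarrow> sum f A \<in> I"
  by (induction A rule: infinite_finite_induct) (auto intro: idealD)

text \<open>
  Reduction modulo \<open>z\<close> maps incongruent elements to distinct elements of height \<open>K * t\<close>. So the
  index of an ideal is bounded by the size of its smallest nonzero element; equivalently, an ideal of
  large index has no small nonzero elements.
\<close>
lemma card_incongruent_le:
  assumes I: "is_ideal I" and z: "z \<in> I" "z \<noteq> 0" "height_le t z"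
    and T: "T \<subseteq> R" "\<And>x y. x \<in> T \<Longrightarrow> y \<in> T \<Longrightarrow> x - y \<in> I \<Longrightarrow> x = y"
  shows "finite T \<and> card T \<le> (2 * (K * t) + 1) ^ n"
proof -
  have "\<forall>x\<in>T. \<exists>v\<in>R. height_le (K * t) (x - z * v)"
    using reduce_mod_multiple[OF z(3,2)] T(1) by blast
  then obtain v where v: "\<And>x. x \<in> T \<Longrightarrow> v x \<in> R" "\<And>x. x \<in> T \<Longrightarrow> height_le (K * t) (x - z * v x)"
    by metis
  have inj: "inj_on (\<lambda>x. x - z * v x) T"
  proof (rule inj_onI)
    fix x y assume xy: "x \<in> T" "y \<in> T" "x - z * v x = y - z * v y"
    have "x - y = z * (v x - v y)" using xy(3) by (simp add: algebra_simps)
    also have "\<dots> \<in> I" using I z v xy by (intro idealD(5)) auto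
    finally show "x = y" using T(2) xy by blast
  qed
  have sub: "(\<lambda>x. x - z * v x) ` T \<subseteq> {w. height_le (K * t) w}" using v by auto
  have "finite T" using finite_imageD[OF finite_subset[OF sub finite_height_le] inj] .
  moreover have "card T \<le> card {w. height_le (K * t) w}"
    using card_inj_on_le[OF inj sub finite_height_le] .
  ultimately show ?thesis using card_height_le by simp
qed

text \<open>
  Maximality is stated as invertibility modulo \<open>m\<close>, the form in which it is used.
\<close>
definition max_ideal :: "complex set \<Rightarrow> bool" where
  "max_ideal m \<longleftrightarrow> is_ideal m \<and> 1 \<notin> m \<and> (\<forall>z\<in>R - m. \<exists>v\<in>R. 1 - z * v \<in> m)"

lemma max_ideal_imp_ideal: "max_ideal m \<Longrightarrow> is_ideal m" by (simp add: max_ideal_def)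

lemma max_ideal_prime:
  assumes "max_ideal m" "z \<in> R" "w \<in> R" "z * w \<in> m" "z \<notin> m"
  shows "w \<in> m"
proof -
  have I: "is_ideal m" using assms by (simp add: max_ideal_def)
  obtain v where v: "v \<in> R" "1 - z * v \<in> m" using assms by (auto simp: max_ideal_def)
  have "w * (1 - z * v) + v * (z * w) \<in> m"
    by (rule idealD(3)[OF I idealD(4)[OF I v(2) assms(3)] idealD(4)[OF I assms(4) v(1)]])
  also have "w * (1 - z * v) + v * (z * w) = w" by (simp add: algebra_simps)
  finally show ?thesis .
qed

text \<open>
  Zorn's lemma for the ideals that contain \<open>x\<close> and not 1.
\<close>
lemma exists_max_ideal:
  assumes x: "x \<in> R" "\<And>u. u \<in> R \<Longrightarrow> x * u \<noteq> 1"
  shows "\<exists>m. max_ideal m \<and> x \<in> m"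
proof -
  define \<A> where "\<A> = {I. is_ideal I \<and> 1 \<notin> I \<and> x \<in> I}"
  have ne: "(*) x ` R \<in> \<A>"
    unfolding \<A>_def is_ideal_def
  proof (intro CollectI conjI ballI)
    show "0 \<in> (*) x ` R" by (rule image_eqI[of _ _ 0]) auto
    show "x \<in> (*) x ` R" by (rule image_eqI[of _ _ 1]) auto
    show "1 \<notin> (*) x ` R" using x by (metis imageE)
    show "a + b \<in> (*) x ` R" if "a \<in> (*) x ` R" "b \<in> (*) x ` R" for a b
      using that by (auto simp flip: distrib_left)
    show "r * a \<in> (*) x ` R" if "a \<in> (*) x ` R" "r \<in> R" for a r
      using that by (auto simp: mult.left_commute)
  qed (use x in auto)
  have "\<exists>m\<in>\<A>. \<forall>X\<in>\<A>. m \<subseteq> X \<longrightarrow> X = m"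
  proof (rule subset_Zorn_nonempty)
    show "\<A> \<noteq> {}" using ne by blast
    fix C assume C: "C \<noteq> {}" "subset.chain \<A> C"
    have CA: "I \<in> \<A>" if "I \<in> C" for I using C that by (auto simp: subset.chain_def)
    show "\<Union> C \<in> \<A>"
      unfolding \<A>_def is_ideal_def
    proof (intro CollectI conjI ballI)
      show "a + b \<in> \<Union> C" if ab: "a \<in> \<Union> C" "b \<in> \<Union> C" for a b
      proof -
        obtain I J where IJ: "I \<in> C" "a \<in> I" "J \<in> C" "b \<in> J" using ab by auto
        have "I \<subseteq> J \<or> J \<subseteq> I" using C(2) IJ by (auto simp: subset.chain_def)
        then obtain L where "L \<in> C" "a \<in> L" "b \<in> L" using IJ by blast
        thus ?thesis using CA[of L] by (auto simp: \<A>_def intro: idealD)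
      qed
      show "r * a \<in> \<Union> C" if ar: "a \<in> \<Union> C" "r \<in> R" for a r
      proof -
        obtain I where I: "I \<in> C" "a \<in> I" using ar by auto
        have "is_ideal I" using CA[OF I(1)] by (simp add: \<A>_def)
        from idealD(4)[OF this I(2) ar(2)] show ?thesis using I by blast
      qed
      show "\<Union> C \<subseteq> R" using CA unfolding \<A>_def is_ideal_def by blast
      show "0 \<in> \<Union> C" using C(1) CA by (auto simp: \<A>_def is_ideal_def)
      show "1 \<notin> \<Union> C" using CA by (auto simp: \<A>_def)
      show "x \<in> \<Union> C" using C(1) CA by (auto simp: \<A>_def)
    qed
  qed
  then obtain m where m: "m \<in> \<A>" "\<And>X. X \<in> \<A> \<Longrightarrow> m \<subseteq> X \<Longrightarrow> X = m" by blast
  have I: "is_ideal m" and xm: "x \<in> m" and m1: "1 \<notin> m" using m(1) by (auto simp: \<A>_def)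
  have "\<exists>v\<in>R. 1 - z * v \<in> m" if z: "z \<in> R" "z \<notin> m" for z
  proof -
    define J where "J = {a + z * v | a v. a \<in> m \<and> v \<in> R}"
    have JI: "is_ideal J"
      unfolding is_ideal_def
    proof (intro conjI ballI)
      show "J \<subseteq> R" using I z by (auto simp: J_def dest: idealD)
      show "0 \<in> J" unfolding J_def using idealD(2)[OF I] R_0 by (intro CollectI exI[of _ 0]) auto
      show "a + b \<in> J" if ab: "a \<in> J" "b \<in> J" for a b
      proof -
        obtain a' v b' v' where *: "a = a' + z * v" "b = b' + z * v'" "a' \<in> m" "b' \<in> m" "v \<in> R" "v' \<in> R"
          using ab by (auto simp: J_def)
        have "a + b = (a' + b') + z * (v + v')" by (simp add: * algebra_simps)
        thus ?thesis using * I unfolding J_def by (blast intro: idealD R_add)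
      qed
      show "r * a \<in> J" if ar: "a \<in> J" "r \<in> R" for a r
      proof -
        obtain a' v where *: "a = a' + z * v" "a' \<in> m" "v \<in> R"
          using ar by (auto simp: J_def)
        have "r * a = r * a' + z * (r * v)" by (simp add: * algebra_simps)
        thus ?thesis using * I ar unfolding J_def by (blast intro: idealD R_mult)
      qed
    qed
    have mJ: "m \<subseteq> J"
    proof
      fix a assume "a \<in> m"
      thus "a \<in> J" unfolding J_def using R_0 by (intro CollectI exI[of _ a] exI[of _ 0]) auto
    qed
    have "z \<in> J" unfolding J_def using idealD(2)[OF I] R_1 by (intro CollectI exI[of _ 0] exI[of _ 1]) auto
    hence "J \<noteq> m" using z by auto
    hence "J \<notin> \<A>" using m(2) mJ by blast
    hence "1 \<in> J" using JI mJ xm by (auto simp: \<A>_def)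
    then obtain a v where av: "1 = a + z * v" "a \<in> m" "v \<in> R" by (auto simp: J_def)
    have "1 - z * v = a" by (simp only: av(1)) simp
    thus ?thesis using av by blast
  qed
  hence "max_ideal m" using I m1 by (auto simp: max_ideal_def)
  thus ?thesis using xm by blast
qed

lemma of_int_in_max_ideal_iff:
  assumes "max_ideal m" "prime p" "of_nat p \<in> m"
  shows "of_int k \<in> m \<longleftrightarrow> int p dvd k"
proof
  have I: "is_ideal m" using assms by (simp add: max_ideal_def)
  show "of_int k \<in> m" if "int p dvd k"
  proof -
    from that obtain j where "k = int p * j" by (auto simp: dvd_def)
    thus ?thesis using idealD(5)[OF I assms(3), of "of_int j"] by auto
  qed
  show "int p dvd k" if k: "of_int k \<in> m"
  proof (rule ccontr)
    assume "\<not> int p dvd k"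
    hence "coprime (int p) k" using assms(2) by (intro prime_imp_coprime) auto
    then obtain a b where ab: "a * int p + b * k = 1" by (metis bezout_int coprime_imp_gcd_eq_1)
    have "of_int a * of_nat p + of_int b * of_int k \<in> m"
      using I k assms(3) by (intro idealD(3)[OF I] idealD(4)[OF I]) auto
    also have "of_int a * of_nat p + of_int b * of_int k = (of_int (a * int p + b * k) :: complex)" by simp
    also have "\<dots> = 1" by (simp only: ab of_int_1)
    finally show False using assms(1) by (simp add: max_ideal_def)
  qed
qed

lemma max_ideal_contains_prime:
  assumes m: "max_ideal m" and x: "x \<in> m" "x \<noteq> 0"
  shows "\<exists>p. prime p \<and> of_nat p \<in> m"
proof -
  have I: "is_ideal m" using m by (simp add: max_ideal_def)
  obtain u N where uN: "u \<in> R" "N > 0" "x * u = of_int N"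
    using divides_integer x idealD(1)[OF I] by blast
  have "of_nat (nat N) \<in> m" using idealD(5)[OF I x(1) uN(1)] uN by simp
  moreover have "nat N > 0" using uN by simp
  ultimately have "\<exists>k>0. of_nat k \<in> m" by blast
  moreover have "\<exists>p. prime p \<and> of_nat p \<in> m" if "k > 0" "of_nat k \<in> m" for k
    using that
  proof (induction k rule: less_induct)
    case (less k)
    have "k \<noteq> 1" using less.prems m by (auto simp: max_ideal_def)
    then obtain p where p: "prime p" "p dvd k" using prime_factor_nat by blast
    then obtain j where j: "k = p * j" by auto
    show ?case
    proof (cases "of_nat p \<in> m")
      case False
      hence "of_nat j \<in> m" using max_ideal_prime[OF m, of "of_nat p" "of_nat j"] less.prems j by auto
      moreover have "j < k" "j > 0" using j less.prems p(1) prime_gt_1_nat[OF p(1)] by auto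
      ultimately show ?thesis using less.IH by blast
    qed (use p in auto)
  qed
  ultimately show ?thesis by blast
qed

lemma distinct_max_ideals:
  assumes "max_ideal m" "max_ideal m'" "m \<noteq> m'"
  shows "\<exists>e\<in>m'. e \<notin> m"
proof (rule ccontr)
  assume "\<not> ?thesis"
  hence sub: "m' \<subseteq> m" by auto
  have I: "is_ideal m" "is_ideal m'" using assms by (auto simp: max_ideal_def)
  from sub assms(3) obtain z where z: "z \<in> m" "z \<notin> m'" by blast
  hence zR: "z \<in> R" using I by (auto dest: idealD)
  then obtain v where v: "v \<in> R" "1 - z * v \<in> m'" using assms(2) z by (auto simp: max_ideal_def)
  have "(1 - z * v) + z * v \<in> m" using v z sub I by (intro idealD(3)[OF I(1)] idealD(5)[OF I(1)]) auto
  thus False using assms(1) by (simp add: max_ideal_def)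
qed

text \<open>
  Chinese remainders: choose \<open>e m\<close> outside \<open>m\<close> and inside all other ideals of \<open>F\<close>. The combinations
  \<open>\<Sum> c m * e m\<close> with \<open>0 \<le> c m < p m\<close> are incongruent modulo the intersection of \<open>F\<close>, which contains
  \<open>x\<close>. For ideals of degree one this replaces the fact that the product of the norms divides the norm
  of \<open>x\<close>.
\<close>
lemma prod_norms_le:
  assumes F: "finite F" "\<And>m. m \<in> F \<Longrightarrow> max_ideal m \<and> prime (p m) \<and> of_nat (p m) \<in> m"
    and x: "x \<noteq> 0" "height_le t x" "\<And>m. m \<in> F \<Longrightarrow> x \<in> m"
  shows "(\<Prod>m\<in>F. p m) \<le> (2 * (K * t) + 1) ^ n"
proof -
  have I: "is_ideal m" if "m \<in> F" for m using F that by (auto simp: max_ideal_def)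
  have "\<forall>m\<in>F. \<forall>m'\<in>F. \<exists>e. m \<noteq> m' \<longrightarrow> e \<in> m' \<and> e \<notin> m"
    using distinct_max_ideals F(2) by metis
  then obtain d where d: "\<And>m m'. m \<in> F \<Longrightarrow> m' \<in> F \<Longrightarrow> m \<noteq> m' \<Longrightarrow> d m m' \<in> m' \<and> d m m' \<notin> m"
    by metis
  define e where "e = (\<lambda>m. \<Prod>m'\<in>F - {m}. d m m')"
  have dR: "d m m' \<in> R" if "m \<in> F" "m' \<in> F" "m \<noteq> m'" for m m'
    using d[OF that] I[of m'] that by (auto dest: idealD)
  have eR: "e m \<in> R" if "m \<in> F" for m unfolding e_def using that dR by (intro R_prod) auto
  have e1: "e m \<in> m'" if mm: "m \<in> F" "m' \<in> F" "m \<noteq> m'" for m m'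
  proof -
    have "e m = d m m' * (\<Prod>m''\<in>F - {m} - {m'}. d m m'')"
      unfolding e_def using mm F(1) by (intro prod.remove) auto
    also have "\<dots> \<in> m'" using mm d dR by (intro idealD(5)[OF I] R_prod) auto
    finally show ?thesis .
  qed
  have e2: "e m \<notin> m" if m: "m \<in> F" for m
  proof -
    have "(\<Prod>m'\<in>G. d m m') \<notin> m" if "G \<subseteq> F - {m}" for G
      using finite_subset[OF that] F(1) that
    proof (induction G rule: infinite_finite_induct)
      case (insert m' G)
      have "(\<Prod>m'\<in>G. d m m') \<in> R" using insert m dR by (intro R_prod) auto
      thus ?case using insert m dR[of m m'] d[of m m'] F(2)[OF m]
        using max_ideal_prime[of m "d m m'" "\<Prod>m'\<in>G. d m m'"] by auto
    qed (use F(2)[OF m] in \<open>auto simp: max_ideal_def\<close>)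
    thus ?thesis unfolding e_def by blast
  qed
  define g where "g = (\<lambda>c. \<Sum>m\<in>F. of_nat (c m) * e m)"
  let ?P = "PiE F (\<lambda>m. {..<p m})"
  define J where "J = {y\<in>R. \<forall>m\<in>F. y \<in> m}"
  have J: "is_ideal J" unfolding is_ideal_def J_def using I by (auto dest: idealD)
  have key: "c = c'" if c: "c \<in> ?P" "c' \<in> ?P" "g c - g c' \<in> J" for c c'
  proof (rule PiE_ext[OF c(1,2)])
    fix m assume m: "m \<in> F"
    have "g c - g c' = (\<Sum>m\<in>F. of_int (int (c m) - int (c' m)) * e m)"
      by (simp add: g_def algebra_simps sum_subtractf)
    also have "\<dots> = of_int (int (c m) - int (c' m)) * e m + (\<Sum>m'\<in>F-{m}. of_int (int (c m') - int (c' m')) * e m')"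
      using F(1) m by (rule sum.remove)
    finally have "of_int (int (c m) - int (c' m)) * e m = (g c - g c') - (\<Sum>m'\<in>F-{m}. of_int (int (c m') - int (c' m')) * e m')"
      by simp
    also have "\<dots> \<in> m"
    proof (rule ideal_diff[OF I[OF m]])
      show "g c - g c' \<in> m" using c(3) m by (simp add: J_def)
      show "(\<Sum>m'\<in>F-{m}. of_int (int (c m') - int (c' m')) * e m') \<in> m"
        using m e1 by (intro ideal_sum[OF I] idealD(4)[OF I]) auto
    qed
    finally have "of_int (int (c m) - int (c' m)) \<in> m"
      using max_ideal_prime[of m "e m" "of_int (int (c m) - int (c' m))"] F(2)[OF m] e2[OF m] eR[OF m]
      by (simp add: mult.commute del: of_int_diff)
    hence "int (p m) dvd int (c m) - int (c' m)"
      using of_int_in_max_ideal_iff[of m "p m"] F(2)[OF m] by blast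
    moreover have "c m < p m" "c' m < p m" using c m by (auto dest: PiE_mem)
    ultimately show "c m = c' m" 
      by (metis cong_iff_dvd_diff cong_int_iff cong_less_modulus_unique_nat)
  qed
  have "card (g ` ?P) = card ?P"
  proof (rule card_image, rule inj_onI)
    fix c c' assume "c \<in> ?P" "c' \<in> ?P" "g c = g c'"
    thus "c = c'" using key[of c c'] idealD(2)[OF J] by simp
  qed
  also have "card ?P = (\<Prod>m\<in>F. p m)" using F(1) by (simp add: card_PiE)
  finally have "(\<Prod>m\<in>F. p m) = card (g ` ?P)" ..
  also have "\<dots> \<le> (2 * (K * t) + 1) ^ n"
  proof (rule conjunct2[OF card_incongruent_le[OF J _ x(1,2)]])
    show "x \<in> J" using x by (auto simp: J_def height_le_def)
    show "g ` ?P \<subseteq> R" using eR by (auto simp: g_def)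
    show "y = y'" if "y \<in> g ` ?P" "y' \<in> g ` ?P" "y - y' \<in> J" for y y'
      using key that by blast
  qed
  finally show ?thesis .
qed

end

section \<open>Counting ideals of degree one from above\<close>

context complex_order
begin

text \<open>
  These are the kernels of the ring homomorphisms from \<open>R\<close> onto the field with \<open>p\<close> elements.
\<close>
definition deg_one :: "nat \<Rightarrow> complex set \<Rightarrow> bool" where
  "deg_one p m \<longleftrightarrow> max_ideal m \<and> prime p \<and> of_nat p \<in> m \<and> (\<forall>z\<in>R. \<exists>c :: int. z - of_int c \<in> m)"

lemma deg_oneD:
  assumes "deg_one p m"
  shows "max_ideal m" "prime p" "of_nat p \<in> m" "is_ideal m"
  using assms by (auto simp: deg_one_def max_ideal_def)

text \<open>
  Maximality comes for free: an integer outside \<open>m\<close> is prime to \<open>p\<close>, hence invertible modulo \<open>p\<close>.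
\<close>
lemma deg_oneI:
  assumes I: "is_ideal m" "1 \<notin> m" and p: "prime p" "of_nat p \<in> m"
    and res: "\<And>z. z \<in> R \<Longrightarrow> \<exists>c :: int. z - of_int c \<in> m"
  shows "deg_one p m"
proof -
  have "\<exists>v\<in>R. 1 - z * v \<in> m" if z: "z \<in> R" "z \<notin> m" for z
  proof -
    obtain c :: int where c: "z - of_int c \<in> m" using res z by blast
    have "\<not> int p dvd c"
    proof
      assume "int p dvd c"
      then obtain d where d: "c = int p * d" by (auto simp: dvd_def)
      have "of_int c = of_nat p * (of_int d :: complex)" by (simp add: d)
      also have "\<dots> \<in> m" by (rule idealD(5)[OF I(1) p(2) R_of_int])
      finally have "of_int c \<in> m" .
      from idealD(3)[OF I(1) c this] show False using z(2) by simp
    qed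
    hence "coprime (int p) c" using p(1) by (intro prime_imp_coprime) auto
    then obtain s t where st: "s * int p + t * c = 1" by (metis bezout_int coprime_imp_gcd_eq_1)
    have "of_int s * of_nat p - of_int t * (z - of_int c) \<in> m"
      by (rule ideal_diff[OF I(1) idealD(4)[OF I(1) p(2) R_of_int] idealD(4)[OF I(1) c R_of_int]])
    also have "of_int s * of_nat p - of_int t * (z - of_int c) = of_int (s * int p + t * c) - z * of_int t"
      by (simp add: algebra_simps)
    also have "\<dots> = 1 - z * of_int t" by (simp only: st of_int_1)
    finally show ?thesis using R_of_int by blast
  qed
  thus ?thesis using assms by (auto simp: deg_one_def max_ideal_def)
qed

lemma deg_one_residue:
  assumes "deg_one p m" "z \<in> R"
  shows "\<exists>c<p. z - of_nat c \<in> m"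
proof -
  note D = deg_oneD[OF assms(1)]
  obtain c :: int where c: "z - of_int c \<in> m" using assms by (auto simp: deg_one_def)
  have p0: "p > 0" using D(2) by (rule prime_gt_0_nat)
  have "of_int (c - c mod int p) \<in> m"
    by (subst of_int_in_max_ideal_iff[OF D(1-3)]) (rule dvd_minus_mod)
  from idealD(3)[OF D(4) c this] have "z - of_int (c mod int p) \<in> m" by simp
  moreover have "of_int (c mod int p) = (of_nat (nat (c mod int p)) :: complex)" using p0 by simp
  moreover have "nat (c mod int p) < p" using p0 by (simp add: nat_less_iff)
  ultimately show ?thesis by metis
qed

text \<open>
  Pigeonhole: a box with more than \<open>p\<close> points contains two congruent ones.
\<close>
lemma deg_one_small_element:
  assumes "deg_one p m" "p < (s + 1) ^ n"
  shows "\<exists>z\<in>m. z \<noteq> 0 \<and> height_le s z"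
proof -
  note D = deg_oneD[OF assms(1)]
  have "\<forall>z\<in>R. \<exists>c. c < p \<and> z - of_nat c \<in> m" using deg_one_residue[OF assms(1)] by blast
  then obtain c where c: "\<And>z. z \<in> R \<Longrightarrow> c z < p" "\<And>z. z \<in> R \<Longrightarrow> z - of_nat (c z) \<in> m" by metis
  have gR: "z \<in> R" if "z \<in> grid 0 (s + 1)" for z using that by (simp add: grid_def)
  have "c ` grid 0 (s + 1) \<subseteq> {..<p}" using c(1) gR by blast
  hence "card (c ` grid 0 (s + 1)) \<le> p" using card_mono[of "{..<p}"] by simp
  hence "\<not> inj_on c (grid 0 (s + 1))" using assms(2) card_image[of c "grid 0 (s + 1)"] by (auto simp only: card_grid)
  then obtain z w where zw: "z \<in> grid 0 (s + 1)" "w \<in> grid 0 (s + 1)" "z \<noteq> w" "c z = c w"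
    by (auto simp: inj_on_def)
  have "(z - of_nat (c z)) - (w - of_nat (c w)) \<in> m"
    using c(2)[OF gR[OF zw(1)]] c(2)[OF gR[OF zw(2)]] by (rule ideal_diff[OF D(4)])
  hence "z - w \<in> m" using zw(4) by simp
  moreover have "height_le s (z - w)"
    unfolding height_le_def
  proof (intro conjI ballI)
    show "z - w \<in> R" using gR zw by (intro R_diff)
    show "\<bar>coord (z - w) b\<bar> \<le> int s" if b: "b \<in> B" for b
    proof -
      have "0 \<le> coord z b" "coord z b < 0 + int (s + 1)" "0 \<le> coord w b" "coord w b < 0 + int (s + 1)"
        using zw(1,2) b by (auto simp: grid_def)
      thus ?thesis using coord_diff[OF gR[OF zw(1)] gR[OF zw(2)] b] by simp
    qed
  qed
  ultimately show ?thesis using zw(3) by (intro bexI[of _ "z - w"]) auto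
qed

text \<open>
  Reduce modulo a small element of the ideal. With \<open>s\<close> close to \<open>p powr (1 / n)\<close>, this says that the
  lattice \<open>m\<close> is not distorted, and it makes the boundary error below summable over \<open>p\<close> up to
  \<open>H ^ n\<close>.
\<close>
lemma deg_one_covering:
  assumes "deg_one p m" "p < (s + 1) ^ n" "w \<in> R"
  shows "\<exists>w'. height_le (K * s) w' \<and> w - w' \<in> m"
proof -
  note D = deg_oneD[OF assms(1)]
  obtain z where z: "z \<in> m" "z \<noteq> 0" "height_le s z" using deg_one_small_element[OF assms(1,2)] by blast
  obtain v where v: "v \<in> R" "height_le (K * s) (w - z * v)"
    using reduce_mod_multiple[OF z(3,2) assms(3)] by blast
  have "w - (w - z * v) = z * v" by simp
  also have "\<dots> \<in> m" by (rule idealD(5)[OF D(4) z(1) v(1)])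
  finally show ?thesis using v(2) by blast
qed

text \<open>
  Tiling: fix for each residue class a representative of height \<open>K * s\<close>. Subtracting it moves every
  point of the shrunken box to a point of the ideal in the full box, and at most \<open>p\<close> points go to the
  same place.
\<close>
lemma card_grid_deg_one_ge:
  assumes "deg_one p m" "p < (s + 1) ^ n"
  shows "(H - 2 * (K * s)) ^ n \<le> p * card {x \<in> grid 1 H. x \<in> m}"
proof (cases "2 * (K * s) \<le> H")
  case True
  note D = deg_oneD[OF assms(1)]
  define r where "r = K * s"
  define Q where "Q = grid (1 + int r) (H - 2 * r)"
  have QR: "y \<in> R" if "y \<in> Q" for y using that by (simp add: Q_def grid_def)
  have "\<forall>z\<in>R. \<exists>c. c < p \<and> z - of_nat c \<in> m" using deg_one_residue[OF assms(1)] by blast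
  then obtain c where c: "\<And>z. z \<in> R \<Longrightarrow> c z < p" "\<And>z. z \<in> R \<Longrightarrow> z - of_nat (c z) \<in> m" by metis
  have "\<forall>k. \<exists>w'. height_le r w' \<and> of_nat k - w' \<in> m"
    using deg_one_covering[OF assms] unfolding r_def by blast
  then obtain w :: "nat \<Rightarrow> complex" where w: "\<And>k. height_le r (w k)" "\<And>k. of_nat k - w k \<in> m"
    by metis
  have wR: "w k \<in> R" for k using w(1) by (rule height_leD)
  have "inj_on (\<lambda>y. (c y, y - w (c y))) Q" by (rule inj_onI) auto
  moreover have "(\<lambda>y. (c y, y - w (c y))) ` Q \<subseteq> {..<p} \<times> {x \<in> grid 1 H. x \<in> m}"
  proof (rule image_subsetI, intro SigmaI CollectI conjI)
    fix y assume y: "y \<in> Q"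
    show "c y \<in> {..<p}" using c(1) QR[OF y] by simp
    have "(y - of_nat (c y)) + (of_nat (c y) - w (c y)) \<in> m"
      using c(2)[OF QR[OF y]] w(2) by (rule idealD(3)[OF D(4)])
    thus "y - w (c y) \<in> m" by simp
    show "y - w (c y) \<in> grid 1 H"
      unfolding grid_def
    proof (intro CollectI conjI ballI)
      show "y - w (c y) \<in> R" using QR[OF y] wR by (rule R_diff)
      fix b assume b: "b \<in> B"
      have "1 + int r \<le> coord y b" "coord y b < 1 + int r + int (H - 2 * r)"
        using y b by (auto simp: Q_def grid_def)
      moreover have "\<bar>coord (w (c y)) b\<bar> \<le> int r" using w(1) b by (rule height_leD)
      moreover have "coord (y - w (c y)) b = coord y b - coord (w (c y)) b" by (rule coord_diff[OF QR[OF y] wR b])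
      ultimately show "1 \<le> coord (y - w (c y)) b" "coord (y - w (c y)) b < 1 + int H"
        using True unfolding r_def by linarith+
    qed
  qed
  moreover have "finite ({..<p} \<times> {x \<in> grid 1 H. x \<in> m})" using finite_grid by auto
  ultimately have "card Q \<le> card ({..<p} \<times> {x \<in> grid 1 H. x \<in> m})" by (rule card_inj_on_le)
  thus ?thesis by (simp add: card_cartesian_product Q_def card_grid r_def)
next
  case False
  thus ?thesis using n_pos by (simp add: zero_power)
qed

lemma card_grid_deg_one_ge_real:
  assumes "deg_one p m" "H > 0"
  shows "real H ^ n * (1 / p - 2 * n * K * (p powr (1 / n) / p) / H) \<le> card {x \<in> grid 1 H. x \<in> m}"
proof -
  have p0: "p > 0" using deg_oneD(2)[OF assms(1)] by (rule prime_gt_0_nat)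
  define s where "s = nat \<lfloor>p powr (1 / n)\<rfloor>"
  have s1: "real s \<le> p powr (1 / n)" unfolding s_def by simp
  have "p powr (1 / n) < real (s + 1)" unfolding s_def by linarith
  hence "(p powr (1 / n)) ^ n < real (s + 1) ^ n" using n_pos by (intro power_strict_mono) auto
  moreover have "(p powr (1 / n)) ^ n = p" using n_pos p0 by (simp add: powr_realpow[symmetric] powr_powr)
  ultimately have "real p < real ((s + 1) ^ n)" by simp
  hence s2: "p < (s + 1) ^ n" by linarith
  have H: "real H > 0" using assms by simp
  have "real H ^ n * (1 - 2 * n * K * s / H) \<le> real ((H - 2 * (K * s)) ^ n)"
  proof (cases "2 * (K * s) \<le> H")
    case True
    \<comment> \<open>Bernoulli for the shrinking factor \<open>1 - t\<close> of the box.\<close>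
    define t where "t = 2 * real (K * s) / H"
    have "t \<le> 1" using True H unfolding t_def by (simp add: divide_le_eq flip: of_nat_mult)
    hence "1 + real n * (- t) \<le> (1 + (- t)) ^ n" by (intro Bernoulli_inequality) simp
    hence "real H ^ n * (1 - n * t) \<le> real H ^ n * (1 - t) ^ n" using H by simp
    also have "\<dots> = (real H * (1 - t)) ^ n" by (simp add: power_mult_distrib)
    also have "real H * (1 - t) = real (H - 2 * (K * s))"
      using H True by (subst of_nat_diff) (auto simp: t_def field_simps)
    finally show ?thesis by (simp add: t_def mult_ac)
  next
    case False
    hence "real H < 2 * real (K * s)" by linarith
    also have "2 * real (K * s) \<le> real n * (2 * real (K * s))"
      using mult_right_mono[of 1 "real n" "2 * real (K * s)"] n_pos by simp
    finally have "1 - 2 * n * K * s / H \<le> 0" using H by (simp add: mult_ac)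
    hence "real H ^ n * (1 - 2 * n * K * s / H) \<le> 0" using H by (intro mult_nonneg_nonpos) auto
    thus ?thesis by linarith
  qed
  also have "\<dots> \<le> real (p * card {x \<in> grid 1 H. x \<in> m})"
    using card_grid_deg_one_ge[OF assms(1) s2] by (rule of_nat_mono)
  finally have main: "real H ^ n * (1 - 2 * n * K * s / H) \<le> p * card {x \<in> grid 1 H. x \<in> m}" by simp
  have "real p * (real H ^ n * (1 / p - 2 * n * K * (p powr (1 / n) / p) / H)) = real H ^ n * (1 - 2 * n * K * (p powr (1 / n)) / H)"
    using p0 by (simp add: right_diff_distrib)
  also have "\<dots> \<le> real H ^ n * (1 - 2 * n * K * s / H)"
    using s1 H by (intro mult_left_mono diff_left_mono divide_right_mono) (auto intro!: mult_left_mono)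
  also note main
  finally show ?thesis using p0 by simp
qed

definition prime_of :: "complex set \<Rightarrow> nat" where
  "prime_of m = (THE p. prime p \<and> of_nat p \<in> m)"

lemma prime_of_eq:
  assumes "max_ideal m" "prime p" "of_nat p \<in> m"
  shows "prime_of m = p"
  unfolding prime_of_def
proof (rule the_equality)
  fix p' assume p': "prime p' \<and> of_nat p' \<in> m"
  have "int p dvd int p'" using of_int_in_max_ideal_iff[OF assms, of "int p'"] p' by simp
  thus "p' = p" using p' assms(2) using primes_dvd_imp_eq[of p p'] by auto
qed (use assms in simp)

text \<open>
  The logarithm of \<open>prod_norms_le\<close>: the counterpart of \<open>ln (n!) = \<Sum> ln m\<close> in Chebyshev's
  argument, with a single element in place of the integer \<open>m\<close>.
\<close>
lemma sum_ln_primes_of_element_le: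
  assumes P: "finite P" "\<And>p. p \<in> P \<Longrightarrow> prime p" "\<And>p. p \<in> P \<Longrightarrow> finite (M p)"
    "\<And>p m. p \<in> P \<Longrightarrow> m \<in> M p \<Longrightarrow> max_ideal m \<and> of_nat p \<in> m"
    and x: "x \<noteq> 0" "height_le t x" "t \<ge> 1"
  shows "(\<Sum>p\<in>P. \<Sum>m\<in>M p. if x \<in> m then ln (real p) else 0) \<le> n * ln (3 * K * t)"
proof -
  define F where "F = (\<Union>p\<in>P. {m \<in> M p. x \<in> m})"
  have pr: "prime_of m = p" if "p \<in> P" "m \<in> M p" for p m
    using P(2,4) that by (intro prime_of_eq) auto
  have F: "finite F" "\<And>m. m \<in> F \<Longrightarrow> max_ideal m \<and> prime (prime_of m) \<and> of_nat (prime_of m) \<in> m \<and> x \<in> m"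
    using P pr by (auto simp: F_def)
  have "(\<Sum>p\<in>P. \<Sum>m\<in>M p. if x \<in> m then ln (real p) else 0) = (\<Sum>p\<in>P. \<Sum>m\<in>{m \<in> M p. x \<in> m}. ln (real (prime_of m)))"
  proof (rule sum.cong[OF refl])
    fix p assume p: "p \<in> P"
    have "(\<Sum>m\<in>M p. if x \<in> m then ln (real p) else 0) = (\<Sum>m\<in>{m \<in> M p. x \<in> m}. ln (real p))"
      using P(3)[OF p] by (rule sum.inter_filter [symmetric])
    also have "\<dots> = (\<Sum>m\<in>{m \<in> M p. x \<in> m}. ln (real (prime_of m)))"
      using pr[OF p] by (intro sum.cong) auto
    finally show "(\<Sum>m\<in>M p. if x \<in> m then ln (real p) else 0)
        = (\<Sum>m\<in>{m \<in> M p. x \<in> m}. ln (real (prime_of m)))" .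
  qed
  also have "\<dots> = (\<Sum>m\<in>F. ln (real (prime_of m)))"
    unfolding F_def
  proof (rule sum.UNION_disjoint [symmetric])
    show "\<forall>p\<in>P. \<forall>p'\<in>P. p \<noteq> p' \<longrightarrow> {m \<in> M p. x \<in> m} \<inter> {m \<in> M p'. x \<in> m} = {}"
    proof (intro ballI impI equals0I)
      fix p p' m assume "p \<in> P" "p' \<in> P" "p \<noteq> p'" "m \<in> {m \<in> M p. x \<in> m} \<inter> {m \<in> M p'. x \<in> m}"
      thus False using pr[of p m] pr[of p' m] by simp
    qed
  qed (use P in auto)
  also have "\<dots> = ln (\<Prod>m\<in>F. real (prime_of m))"
    using F by (subst ln_prod) (auto simp: prime_gt_0_nat)
  also have "\<dots> \<le> ln ((3 * real K * t) ^ n)"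
  proof (subst ln_le_cancel_iff)
    show "(\<Prod>m\<in>F. real (prime_of m)) > 0" using F by (intro prod_pos) (auto simp: prime_gt_0_nat)
    have K1: "K * t \<ge> 1" using x(3) by (simp add: K_def)
    thus "(3 * real K * t) ^ n > 0" by simp
    have "(\<Prod>m\<in>F. prime_of m) \<le> (2 * (K * t) + 1) ^ n"
      using F x by (intro prod_norms_le) auto
    also have "\<dots> \<le> (3 * (K * t)) ^ n" using K1 by (intro power_mono) auto
    finally have "real (\<Prod>m\<in>F. prime_of m) \<le> real ((3 * (K * t)) ^ n)" by (rule of_nat_mono)
    thus "(\<Prod>m\<in>F. real (prime_of m)) \<le> (3 * real K * t) ^ n" by (simp add: mult.assoc)
  qed
  also have "\<dots> = n * ln (3 * K * t)" using x(3) by (subst ln_realpow) (auto simp: K_def)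
  finally show ?thesis .
qed

text \<open>
  Count the pairs of a point \<open>x\<close> in a box with side \<open>H = 2 ^ j\<close> and an ideal \<open>m\<close> over \<open>p \<le> H ^ n\<close> that
  contains it, with weight \<open>ln p\<close>. By points, the total is at most \<open>H ^ n * (ln (H ^ n) + O(1))\<close>; by
  ideals, it is at least \<open>H ^ n\<close> times the sum in question, up to \<open>O(H ^ n)\<close>.
\<close>
theorem sum_deg_one_le:
  assumes M: "\<And>p. prime p \<Longrightarrow> finite (M p) \<and> card (M p) \<le> D"
    "\<And>p m. prime p \<Longrightarrow> m \<in> M p \<Longrightarrow> deg_one p m"
  shows "\<exists>C. \<forall>j. (\<Sum>p | prime p \<and> p \<le> 2 ^ (j * n). card (M p) * (ln (real p) / p)) \<le> j * n * ln 2 + C"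
proof (rule exI, rule allI)
  fix j :: nat
  define H :: nat where "H = 2 ^ j"
  have H: "H \<ge> 1" by (simp add: H_def)
  define P where "P = {p::nat. prime p \<and> p \<le> 2 ^ (j * n)}"
  have finP: "finite P" unfolding P_def by (rule finite_subset[of _ "{..2 ^ (j * n)}"]) auto
  have Pp: "prime p" if "p \<in> P" for p using that by (simp add: P_def)
  define A where "A = grid 1 H"
  define c where "c = ln 4 / (2 powr (1 / real n) - 1)"
  have lnp: "ln (real p) \<ge> 0" if "p \<in> P" for p using prime_ge_1_nat[OF Pp[OF that]] by simp
  have Ax: "x \<noteq> 0 \<and> height_le H x" if "x \<in> A" for x
  proof
    have b: "1 \<le> coord x b \<and> coord x b < 1 + int H" if "b \<in> B" for b
      using \<open>x \<in> A\<close> that by (auto simp: A_def grid_def)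
    show "x \<noteq> 0" using b[OF one_in_B] coord_of_int[OF one_in_B, of 0] by auto
    show "height_le H x" using b \<open>x \<in> A\<close> by (force simp: height_le_def A_def grid_def)
  qed
  have "real H ^ n * ((\<Sum>p\<in>P. card (M p) * (ln (real p) / p)) - 2 * n * K * D * c)
     \<le> (\<Sum>p\<in>P. \<Sum>m\<in>M p. ln (real p) * card {x \<in> A. x \<in> m})"
  proof -
    have "(\<Sum>p\<in>P. ln (real p) / p * p powr (1 / n)) \<le> c * 2 powr (real (j * n) / n)"
      using sum_ln_powr_primes_le[of n "j * n"] n_pos unfolding P_def c_def by simp
    also have "2 powr (real (j * n) / n) = real H" using n_pos by (simp add: H_def powr_realpow)
    finally have S: "(\<Sum>p\<in>P. ln (real p) / p * p powr (1 / n)) \<le> c * H" .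
    have "(\<Sum>p\<in>P. card (M p) * (ln (real p) / p)) - 2 * n * K * D * c
        \<le> (\<Sum>p\<in>P. card (M p) * (ln (real p) / p)) - 2 * n * K * D / H * (\<Sum>p\<in>P. ln (real p) / p * p powr (1 / n))"
      using mult_left_mono[OF S, of "2 * n * K * D / H"] H by simp
    also have "\<dots> = (\<Sum>p\<in>P. card (M p) * (ln (real p) / p) - D * (2 * n * K / H * (ln (real p) / p * p powr (1 / n))))"
      by (simp add: sum_subtractf sum_distrib_left mult_ac)
    also have "\<dots> \<le> (\<Sum>p\<in>P. card (M p) * (ln (real p) / p) - card (M p) * (2 * n * K / H * (ln (real p) / p * p powr (1 / n))))"
      using M(1) Pp lnp by (intro sum_mono diff_left_mono mult_right_mono mult_nonneg_nonneg) auto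
    also have "\<dots> = (\<Sum>p\<in>P. \<Sum>m\<in>M p. ln (real p) * (1 / p - 2 * n * K * (p powr (1 / n) / p) / H))"
      by (intro sum.cong refl) (simp add: algebra_simps)
    finally have "real H ^ n * ((\<Sum>p\<in>P. card (M p) * (ln (real p) / p)) - 2 * n * K * D * c)
       \<le> real H ^ n * (\<Sum>p\<in>P. \<Sum>m\<in>M p. ln (real p) * (1 / p - 2 * n * K * (p powr (1 / n) / p) / H))"
      by (rule mult_left_mono) simp
    also have "\<dots> = (\<Sum>p\<in>P. \<Sum>m\<in>M p. ln (real p) * (real H ^ n * (1 / p - 2 * n * K * (p powr (1 / n) / p) / H)))"
      by (simp only: sum_distrib_left mult.left_commute)
    also have "\<dots> \<le> (\<Sum>p\<in>P. \<Sum>m\<in>M p. ln (real p) * card {x \<in> A. x \<in> m})"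
      unfolding A_def using M(2) Pp lnp H
      by (intro sum_mono mult_left_mono card_grid_deg_one_ge_real) auto
    finally show ?thesis .
  qed
  also have "\<dots> = (\<Sum>p\<in>P. \<Sum>m\<in>M p. \<Sum>x\<in>A. if x \<in> m then ln (real p) else 0)"
    using finite_grid by (intro sum.cong refl) (simp add: A_def sum.inter_filter[symmetric])
  also have "\<dots> = (\<Sum>p\<in>P. \<Sum>x\<in>A. \<Sum>m\<in>M p. if x \<in> m then ln (real p) else 0)"
    by (rule sum.cong[OF refl], rule sum.swap)
  also have "\<dots> = (\<Sum>x\<in>A. \<Sum>p\<in>P. \<Sum>m\<in>M p. if x \<in> m then ln (real p) else 0)" by (rule sum.swap)
  also have "\<dots> \<le> (\<Sum>x\<in>A. n * ln (3 * K * H))"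
  proof (rule sum_mono, rule sum_ln_primes_of_element_le)
    show "max_ideal m \<and> of_nat p \<in> m" if "p \<in> P" "m \<in> M p" for p m
      using deg_oneD(1,3)[OF M(2)[OF Pp[OF that(1)] that(2)]] by blast
  qed (use finP Pp M(1) Ax H in auto)
  also have "\<dots> = real H ^ n * (n * ln (3 * K * H))" by (simp add: A_def card_grid)
  finally have "(\<Sum>p\<in>P. card (M p) * (ln (real p) / p)) - 2 * n * K * D * c \<le> n * ln (3 * K * H)"
    using H by (subst (asm) mult_le_cancel_left_pos) auto
  also have "ln (3 * K * H) = ln (3 * K) + j * ln 2"
    unfolding of_nat_mult[of "3 * K" H] by (subst ln_mult) (auto simp: K_def H_def ln_realpow)
  finally show "(\<Sum>p | prime p \<and> p \<le> 2 ^ (j * n). card (M p) * (ln (real p) / p))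
      \<le> j * n * ln 2 + (n * ln (3 * K) + 2 * n * K * D * c)"
    unfolding P_def by (simp add: algebra_simps)
qed

end

section \<open>Divergence over the primes with an ideal of degree one\<close>

lemma summable_tail_small:
  fixes a :: "nat \<Rightarrow> real"
  assumes "summable a" "\<And>i. a i \<ge> 0" "e > 0"
  shows "\<exists>N. \<forall>F. finite F \<longrightarrow> F \<subseteq> {N..} \<longrightarrow> sum a F < e"
proof -
  have "(\<lambda>N. \<Sum>i<N. a i) \<longlonglongrightarrow> suminf a" using assms(1) by (rule summable_LIMSEQ)
  hence "\<forall>\<^sub>F N in sequentially. (\<Sum>i<N. a i) > suminf a - e"
    by (rule order_tendstoD) (use assms(3) in simp)
  then obtain N where N: "(\<Sum>i<N. a i) > suminf a - e" by (auto simp: eventually_sequentially)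
  have "sum a F < e" if F: "finite F" "F \<subseteq> {N..}" for F
  proof -
    have "sum a F + (\<Sum>i<N. a i) = sum a (F \<union> {..<N})"
      using F by (intro sum.union_disjoint [symmetric]) auto
    also have "\<dots> \<le> suminf a" using F assms by (intro sum_le_suminf) auto
    finally show ?thesis using N by linarith
  qed
  thus ?thesis by blast
qed

lemma eq_if_dvd_diff:
  fixes x y p :: nat
  assumes "x < p" "y < p" "int p dvd int x - int y"
  shows "x = y"
proof (rule ccontr)
  assume "x \<noteq> y"
  hence "\<bar>int p\<bar> \<le> \<bar>int x - int y\<bar>" using assms(3) by (intro dvd_imp_le_int) auto
  thus False using assms(1,2) by linarith
qed

context complex_order
begin

text \<open>
  A lower bound for the index of every maximal ideal over \<open>p\<close>: if there is no ideal of degree one,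
  the degrees are at least 2.
\<close>
definition min_norm :: "nat \<Rightarrow> nat" where
  "min_norm p = (if \<exists>m. deg_one p m then p else p ^ 2)"

lemma min_norm_ge: "prime p \<Longrightarrow> p \<le> min_norm p"
  using prime_ge_1_nat[of p] by (auto simp: min_norm_def power2_eq_square)

lemma min_norm_le_square: "prime p \<Longrightarrow> min_norm p \<le> p ^ 2"
  using prime_ge_1_nat[of p] by (auto simp: min_norm_def power2_eq_square)

text \<open>
  If no ideal over \<open>p\<close> has degree one, then some \<open>e\<close> is not congruent to an integer modulo
  \<open>m\<close>, and the \<open>p ^ 2\<close> elements \<open>i + j * e\<close> are incongruent; otherwise \<open>0, \<dots>, p - 1\<close> suffice.
\<close>
lemma min_norm_le:
  assumes m: "max_ideal m" "prime p" "of_nat p \<in> m" and z: "z \<in> m" "z \<noteq> 0" "height_le t z"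
  shows "min_norm p \<le> (2 * (K * t) + 1) ^ n"
proof (cases "\<exists>m. deg_one p m")
  case True
  have inj: "x = y" if "x < p" "y < p" "of_nat x - of_nat y \<in> m" for x y
  proof -
    have "of_int (int x - int y) \<in> m" using that(3) by simp
    hence "int p dvd int x - int y" by (subst (asm) of_int_in_max_ideal_iff[OF m])
    with that(1,2) show "x = y" by (rule eq_if_dvd_diff)
  qed
  have "card (of_nat ` {..<p} :: complex set) = p" by (subst card_image) (auto simp: inj_on_def)
  moreover have "card (of_nat ` {..<p} :: complex set) \<le> (2 * (K * t) + 1) ^ n"
  proof (rule conjunct2[OF card_incongruent_le[OF max_ideal_imp_ideal[OF m(1)] z]])
    fix x y :: complex assume "x \<in> of_nat ` {..<p}" "y \<in> of_nat ` {..<p}" "x - y \<in> m"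
    thus "x = y" using inj by blast
  qed auto
  ultimately show ?thesis using True by (simp add: min_norm_def)
next
  case False
  note I = max_ideal_imp_ideal[OF m(1)]
  obtain e where e: "e \<in> R" "\<And>c :: int. e - of_int c \<notin> m"
  proof -
    have "\<not> deg_one p m" using False by blast
    hence "\<exists>e\<in>R. \<forall>c :: int. e - of_int c \<notin> m" using m by (simp add: deg_one_def)
    thus ?thesis using that by blast
  qed
  define f where "f = (\<lambda>(i, j). of_nat i + of_nat j * e :: complex)"
  let ?S = "{..<p} \<times> {..<p}"
  have inj: "u = v" if uv: "u \<in> ?S" "v \<in> ?S" "f u - f v \<in> m" for u v
  proof -
    obtain i j where i: "u = (i, j)" by (cases u)
    obtain i' j' where i': "v = (i', j')" by (cases v)
    note ij = i i'
    have b: "i < p" "j < p" "i' < p" "j' < p" using uv(1,2) unfolding ij by auto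
    have "f u - f v = of_int (int i - int i') + of_int (int j - int j') * e"
      by (simp add: f_def ij algebra_simps)
    hence d: "of_int (int i - int i') + of_int (int j - int j') * e \<in> m" using uv(3) by simp
    have j: "j = j'"
    proof (rule ccontr)
      assume "j \<noteq> j'"
      hence "\<not> int p dvd int j - int j'"
        using eq_if_dvd_diff[OF b(2,4)] by blast
      hence "coprime (int p) (int j - int j')" using m(2) by (intro prime_imp_coprime) auto
      then obtain a a' where aa: "a * int p + a' * (int j - int j') = 1"
        by (metis bezout_int coprime_imp_gcd_eq_1)
      define I' J' where "I' = int i - int i'" and "J' = int j - int j'"
      have aJ: "a * int p + a' * J' = 1" using aa by (simp only: J'_def)
      have "of_int a' * (of_int I' + of_int J' * e) + (of_int a * e) * of_nat p \<in> m"
        unfolding I'_def J'_def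
        by (rule idealD(3)[OF I idealD(4)[OF I d R_of_int] idealD(4)[OF I m(3) R_mult[OF R_of_int e(1)]]])
      also have "of_int a' * (of_int I' + of_int J' * e) + (of_int a * e) * of_nat p
          = of_int (a * int p + a' * J') * e - of_int (- (a' * I'))"
        by (simp add: algebra_simps)
      also have "\<dots> = e - of_int (- (a' * I'))" by (simp only: aJ of_int_1 mult_1)
      finally show False using e(2) by blast
    qed
    have "of_int (int i - int i') \<in> m" using d j by simp
    hence "int p dvd int i - int i'" by (subst (asm) of_int_in_max_ideal_iff[OF m])
    with b(1,3) have "i = i'" by (rule eq_if_dvd_diff)
    thus ?thesis using j ij by simp
  qed
  have "card (f ` ?S) = card ?S"
  proof (rule card_image, rule inj_onI)
    fix u v assume "u \<in> ?S" "v \<in> ?S" "f u = f v"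
    thus "u = v" using inj[of u v] idealD(2)[OF I] by simp
  qed
  also have "\<dots> = p ^ 2" by (simp add: card_cartesian_product power2_eq_square)
  finally have "card (f ` ?S) = p ^ 2" .
  moreover have "card (f ` ?S) \<le> (2 * (K * t) + 1) ^ n"
  proof (rule conjunct2[OF card_incongruent_le[OF I z]])
    show "f ` ?S \<subseteq> R" using e(1) by (auto simp: f_def)
    fix x y assume "x \<in> f ` ?S" "y \<in> f ` ?S" "x - y \<in> m"
    thus "x = y" using inj by blast
  qed
  ultimately show ?thesis using False by (simp add: min_norm_def)
qed

lemma K_ge_1: "K \<ge> 1" by (simp add: K_def)

definition ideals_over :: "nat \<Rightarrow> complex set set" where
  "ideals_over p = {m. max_ideal m \<and> of_nat p \<in> m}"

text \<open>
  The ideals over \<open>p\<close> share the element \<open>p\<close> of height \<open>p\<close>, so \<open>prod_norms_le\<close> gives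
  \<open>p ^ card \<le> (3 * K * p) ^ n\<close>. For \<open>p \<ge> 3 * K\<close> the constant is absorbed by another factor \<open>p ^ n\<close>.
\<close>
lemma card_ideals_over:
  assumes "prime p" "p \<ge> 3 * K"
  shows "finite (ideals_over p) \<and> card (ideals_over p) \<le> 2 * n"
proof (rule finite_if_finite_subsets_card_bdd)
  fix G assume G: "G \<subseteq> ideals_over p" "finite G"
  have p2: "p \<ge> 2" using assms(1) by (rule prime_ge_2_nat)
  have "p ^ card G = (\<Prod>m\<in>G. p)" by simp
  also have "\<dots> \<le> (2 * (K * p) + 1) ^ n"
  proof (rule prod_norms_le[OF G(2)])
    show "(of_nat p :: complex) \<noteq> 0" using p2 by simp
    show "height_le p (of_nat p)" by (rule height_le_of_nat)
  qed (use G assms in \<open>auto simp: ideals_over_def\<close>)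
  also have "\<dots> \<le> (p ^ 2) ^ n"
  proof (rule power_mono)
    have "K * p \<ge> 1" using K_ge_1 p2 by simp
    hence "2 * (K * p) + 1 \<le> (3 * K) * p" by simp
    also have "\<dots> \<le> p * p" using assms(2) by (rule mult_right_mono) simp
    finally show "2 * (K * p) + 1 \<le> p ^ 2" by (simp add: power2_eq_square)
  qed simp
  also have "\<dots> = p ^ (2 * n)" by (simp add: power_mult)
  finally show "card G \<le> 2 * n" using p2 by (simp add: power_increasing_iff)
qed

text \<open>
  Two points in the same cell of side \<open>L\<close> would differ by an element of \<open>m\<close> that is too small for the
  index of \<open>m\<close>, so every cell holds at most one point.
\<close>
lemma card_packed_le:
  assumes m: "max_ideal m" "prime p" "of_nat p \<in> m"
    and X: "X \<subseteq> grid 0 H" "\<And>x y. x \<in> X \<Longrightarrow> y \<in> X \<Longrightarrow> x - y \<in> m"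
    and L: "L \<ge> 1" "(3 * K * L) ^ n \<le> min_norm p"
  shows "card X \<le> (H div L + 1) ^ n"
proof -
  have XR: "x \<in> R" if "x \<in> X" for x using that X(1) by (auto simp: grid_def)
  have Xb: "0 \<le> coord x b \<and> coord x b < int H" if "x \<in> X" "b \<in> B" for x b using that X(1) by (auto simp: grid_def)
  let ?f = "\<lambda>x. restrict (\<lambda>b. nat (coord x b) div L) B"
  have "inj_on ?f X"
  proof (rule inj_onI, rule ccontr)
    fix x y assume xy: "x \<in> X" "y \<in> X" "?f x = ?f y" "x \<noteq> y"
    have "height_le (L - 1) (x - y)"
      unfolding height_le_def
    proof (intro conjI ballI)
      show "x - y \<in> R" using XR xy by blast
      fix b assume b: "b \<in> B"
      have eq: "nat (coord x b) div L = nat (coord y b) div L" using fun_cong[OF xy(3), of b] b by simp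
      define q r s where "q = nat (coord y b) div L" and "r = nat (coord x b) mod L" and "s = nat (coord y b) mod L"
      have "nat (coord x b) = q * L + r" "nat (coord y b) = q * L + s"
        unfolding q_def r_def s_def eq[symmetric] by simp (simp add: eq)
      moreover have "r < L" "s < L" using L(1) by (auto simp: r_def s_def)
      moreover have "coord (x - y) b = coord x b - coord y b" using XR xy b by (intro coord_diff)
      ultimately show "\<bar>coord (x - y) b\<bar> \<le> int (L - 1)" using Xb[OF xy(1) b] Xb[OF xy(2) b] by linarith
    qed
    hence "min_norm p \<le> (2 * (K * (L - 1)) + 1) ^ n"
      using X(2)[OF xy(1,2)] xy(4) by (intro min_norm_le[OF m]) auto
    also have "\<dots> < (3 * K * L) ^ n"
    proof (rule power_strict_mono)
      have "K * (L - 1) + K = K * L" using L(1) by (cases L) auto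
      moreover have "K * L \<ge> 1" using K_ge_1 L(1) by simp
      ultimately show "2 * (K * (L - 1)) + 1 < 3 * K * L" using K_ge_1 by linarith
    qed (use n_pos in auto)
    finally show False using L(2) by simp
  qed
  moreover have "?f ` X \<subseteq> B \<rightarrow>\<^sub>E {..<H div L + 1}"
  proof (intro image_subsetI PiE_I)
    fix x b assume "x \<in> X" "b \<in> B"
    hence "nat (coord x b) \<le> H" using Xb[of x b] by linarith
    hence "nat (coord x b) div L \<le> H div L" by (rule div_le_mono)
    thus "?f x b \<in> {..<H div L + 1}" using \<open>b \<in> B\<close> by simp
  qed simp
  moreover have "finite (B \<rightarrow>\<^sub>E {..<H div L + 1})" using finite_B by (simp add: finite_PiE)
  ultimately have "card X \<le> card (B \<rightarrow>\<^sub>E {..<H div L + 1})" by (rule card_inj_on_le)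
  thus ?thesis using finite_B by (simp add: card_PiE)
qed

text \<open>
  Packing with the largest admissible cells. The first alternative has the expected order
  \<open>H ^ n / min_norm p\<close> with a constant that depends on the order alone. The second one occurs if the
  cells are larger than the box.
\<close>
lemma card_ideal_grid_le:
  assumes m: "max_ideal m" "prime p" "of_nat p \<in> m"
    and X: "X \<subseteq> grid 0 H" "\<And>x y. x \<in> X \<Longrightarrow> y \<in> X \<Longrightarrow> x - y \<in> m"
  shows "card X * min_norm p \<le> (12 * K * H) ^ n \<or> card X \<le> 1 \<and> H ^ n \<le> min_norm p"
proof -
  define Q where "Q = min_norm p"
  \<comment> \<open>The largest cell that satisfies the hypothesis of \<open>card_packed_le\<close>.\<close>
  define L where "L = (GREATEST L. (3 * K * L) ^ n \<le> Q)"
  have bound: "L \<le> Q" if "(3 * K * L) ^ n \<le> Q" for L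
  proof (cases "L = 0")
    case False
    have "1 * L \<le> 3 * K * L" using K_ge_1 by (intro mult_right_mono) auto
    moreover have "3 * K * L \<le> (3 * K * L) ^ n"
      using n_pos calculation False by (intro self_le_power) auto
    ultimately have "L \<le> (3 * K * L) ^ n" by linarith
    also have "\<dots> \<le> Q" by fact
    finally show ?thesis .
  qed simp
  have "(3 * K * 0) ^ n \<le> Q" using n_pos by (simp add: zero_power)
  hence L1: "(3 * K * L) ^ n \<le> Q" unfolding L_def by (rule GreatestI_nat) (rule bound)
  have "\<not> (3 * K * (L + 1)) ^ n \<le> Q"
  proof
    assume "(3 * K * (L + 1)) ^ n \<le> Q"
    hence "L + 1 \<le> L" unfolding L_def by (rule Greatest_le_nat) (rule bound)
    thus False by simp
  qed
  hence L2: "Q \<le> (3 * K * (L + 1)) ^ n" by simp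
  consider "L = 0" | "L \<ge> 1" "L \<le> H" | "L > H" by linarith
  thus ?thesis
  proof cases
    case 1
    have "card X \<le> H ^ n" using card_mono[OF finite_grid X(1)] by (simp add: card_grid)
    hence "card X * Q \<le> H ^ n * (3 * K) ^ n" using L2 1 by (intro mult_mono) auto
    also have "\<dots> = (3 * K * H) ^ n" by (simp add: power_mult_distrib mult_ac)
    also have "\<dots> \<le> (12 * K * H) ^ n" by (intro power_mono) auto
    finally show ?thesis by (simp add: Q_def)
  next
    case 2
    have "card X \<le> (H div L + 1) ^ n"
      using 2 L1 by (intro card_packed_le[OF m X]) (auto simp: Q_def)
    hence "card X * Q \<le> (H div L + 1) ^ n * (3 * K * (L + 1)) ^ n" using L2 by (intro mult_mono) auto
    also have "\<dots> = (3 * K * ((H div L + 1) * (L + 1))) ^ n" by (simp only: power_mult_distrib mult_ac)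
    also have "\<dots> \<le> (12 * K * H) ^ n"
    proof (rule power_mono)
      have "(H div L + 1) * (L + 1) \<le> (H div L + 1) * (2 * L)" using 2 by (intro mult_left_mono) auto
      also have "\<dots> = 2 * (H div L * L) + 2 * L" by (simp add: algebra_simps)
      also have "\<dots> \<le> 2 * H + 2 * H" using 2 by (intro add_mono mult_left_mono) auto
      finally have "(H div L + 1) * (L + 1) \<le> 4 * H" by simp
      hence "3 * K * ((H div L + 1) * (L + 1)) \<le> 3 * K * (4 * H)" by (rule mult_left_mono) simp
      thus "3 * K * ((H div L + 1) * (L + 1)) \<le> 12 * K * H" by simp
    qed simp
    finally show ?thesis by (simp add: Q_def)
  next
    case 3
    have "card X \<le> (H div L + 1) ^ n"
      using 3 L1 by (intro card_packed_le[OF m X]) (auto simp: Q_def)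
    moreover have "H div L = 0" using 3 by simp
    moreover have "H ^ n \<le> (3 * K * L) ^ n"
    proof (rule power_mono)
      have "1 * L \<le> 3 * K * L" using K_ge_1 by (intro mult_right_mono) auto
      thus "H \<le> 3 * K * L" using 3 by linarith
    qed simp
    ultimately show ?thesis using L1 by (simp add: Q_def)
  qed
qed

text \<open>
  Multiplication by the integer \<open>1 + M * (K + 1) * H\<close> dominates multiplication by \<open>M * y\<close>, which
  scales heights by at most \<open>M * K * H\<close>: the largest coordinate of \<open>u\<close> shows that the product is not 1.
\<close>
lemma large_element_not_unit:
  assumes y: "y \<in> grid 0 H" and u: "u \<in> R" and pos: "M * H \<ge> 1"
  shows "(1 + of_nat M * (of_nat ((K + 1) * H) + y)) * u \<noteq> 1"
proof
  assume eq: "(1 + of_nat M * (of_nat ((K + 1) * H) + y)) * u = 1"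
  define t where "t = nat (Max ((\<lambda>b. \<bar>coord u b\<bar>) ` B))"
  have fin: "finite ((\<lambda>b. \<bar>coord u b\<bar>) ` B)" using finite_B by simp
  have ne: "(\<lambda>b. \<bar>coord u b\<bar>) ` B \<noteq> {}" using one_in_B by blast
  obtain b where b: "b \<in> B" "Max ((\<lambda>b. \<bar>coord u b\<bar>) ` B) = \<bar>coord u b\<bar>" using Max_in[OF fin ne] by auto
  have tb: "int t = \<bar>coord u b\<bar>" by (simp add: t_def b(2))
  have ut: "height_le t u"
    unfolding height_le_def tb b(2)[symmetric] using u fin by auto
  have yR: "y \<in> R" using y by (simp add: grid_def)
  have yH: "height_le H y"
    unfolding height_le_def
  proof (intro conjI ballI yR)
    show "\<bar>coord y b\<bar> \<le> int H" if "b \<in> B" for b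
    proof -
      have "0 \<le> coord y b \<and> coord y b < 0 + int H" using y that by (auto simp: grid_def)
      thus ?thesis by simp
    qed
  qed
  have t1: "t \<ge> 1"
  proof (rule ccontr)
    assume "\<not> t \<ge> 1"
    hence "height_le 0 u" using ut by (auto intro: height_le_mono)
    hence "coord u b = 0" if "b \<in> B" for b using that by (auto simp: height_le_def)
    hence "comb (coord u) = 0" by (simp add: comb_def)
    hence "u = 0" using comb_coord[OF u] by simp
    thus False using eq by simp
  qed
  define c :: int where "c = 1 + int M * (int (K + 1) * int H)"
  have "of_int c * u = 1 - of_int (int M) * (y * u)"
    using eq unfolding c_def by (simp add: algebra_simps)
  hence "coord (of_int c * u) b = coord (1 - of_int (int M) * (y * u)) b" by (rule arg_cong)
  also have "\<dots> = coord 1 b - int M * coord (y * u) b"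
    using u yR b(1) by (subst coord_diff) (auto simp del: of_int_of_nat_eq simp: coord_scale[OF R_mult])
  finally have "c * coord u b = coord 1 b - int M * coord (y * u) b" by (simp only: coord_scale[OF u b(1)])
  hence "\<bar>c * coord u b\<bar> = \<bar>coord 1 b - int M * coord (y * u) b\<bar>" by (rule arg_cong)
  also have "\<dots> \<le> \<bar>coord 1 b\<bar> + \<bar>int M * coord (y * u) b\<bar>" by (rule abs_triangle_ineq4)
  also have "\<dots> \<le> 1 + int M * int (K * H * t)"
  proof (rule add_mono)
    show "\<bar>coord 1 b\<bar> \<le> 1" using coord_basis[OF one_in_B b(1)] by simp
    have "\<bar>coord (y * u) b\<bar> \<le> int (K * H * t)"
      using height_leD(2)[OF height_le_mult[OF yH ut] b(1)] .
    hence "int M * \<bar>coord (y * u) b\<bar> \<le> int M * int (K * H * t)" by (rule mult_left_mono) simp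
    thus "\<bar>int M * coord (y * u) b\<bar> \<le> int M * int (K * H * t)" by (simp only: abs_mult abs_of_nat)
  qed
  finally have "\<bar>c\<bar> * int t \<le> 1 + int M * int (K * H * t)" by (simp only: abs_mult tb)
  also have "\<dots> \<le> int t + int M * int (K * H * t)" using t1 by simp
  also have "\<dots> = (1 + int M * int (K * H)) * int t" by (simp add: algebra_simps)
  finally have "\<bar>c\<bar> \<le> 1 + int M * int (K * H)" using t1 by simp
  moreover have "c = 1 + int M * int (K * H) + int (M * H)" by (simp add: c_def algebra_simps)
  ultimately show False using pos by linarith
qed

end

context complex_order
begin

text \<open>
  Suppose the sum converges. Then \<open>a p = 1 / min_norm p\<close> is summable over the primes as well, since the
  primes without an ideal of degree one contribute at most \<open>1 / p ^ 2\<close>. Sieve the elements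
  \<open>x y = 1 + M * ((K + 1) * H + y)\<close> for \<open>y\<close> in a box with side \<open>H\<close>, where \<open>M\<close> is a factorial. They are
  not units, so each one lies in a maximal ideal, over a prime larger than the threshold \<open>Y\<close>. The
  ideals over one prime capture at most a multiple of \<open>H ^ n * a p\<close> points.

  The order of the choices matters. The factor in the first alternative of \<open>card_ideal_grid_le\<close> is
  independent of \<open>M\<close>, so \<open>Y\<close>, and with it \<open>M\<close>, can be chosen to make the tail from \<open>Y\<close> on small. In
  the second alternative the factor depends on \<open>M\<close>, but there \<open>p ^ 2 \<ge> H\<close>, and \<open>H\<close> is chosen last.
\<close>
theorem not_summable_deg_one:
  "\<not> summable (\<lambda>p. if prime p \<and> (\<exists>m. deg_one p m) then 1 / real p else 0)"
proof
  assume sum_f: "summable (\<lambda>p. if prime p \<and> (\<exists>m. deg_one p m) then 1 / real p else 0)"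
  define a where "a = (\<lambda>p. if prime p then 1 / real (min_norm p) else 0)"
  have a0: "a p \<ge> 0" for p by (simp add: a_def)
  have sum_a: "summable a"
  proof (rule summable_comparison_test')
    show "summable (\<lambda>p. (if prime p \<and> (\<exists>m. deg_one p m) then 1 / real p else 0) + inverse (real p ^ 2))"
      using sum_f inverse_power_summable[of 2] by (intro summable_add) auto
    show "norm (a p) \<le> (if prime p \<and> (\<exists>m. deg_one p m) then 1 / real p else 0) + inverse (real p ^ 2)" for p
      by (auto simp: a_def min_norm_def divide_inverse)
  qed
  define c1 where "c1 = 2 * real n * (12 * K) ^ n"
  have c1: "c1 > 0" using n_pos K_ge_1 by (simp add: c1_def)
  obtain N1 where N1: "\<And>F. finite F \<Longrightarrow> F \<subseteq> {N1..} \<Longrightarrow> sum a F < 1 / (2 * c1)"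
    using summable_tail_small[OF sum_a a0, of "1 / (2 * c1)"] c1 by auto
  \<comment> \<open>The bound \<open>3 * K\<close> is the one required by \<open>card_ideals_over\<close>.\<close>
  define Y where "Y = max N1 (3 * K)"
  define M :: nat where "M = fact Y"
  have M1: "M \<ge> 1" by (simp add: M_def)
  \<comment> \<open>The elements \<open>x y\<close> have height at most \<open>M * (K + 3) * H\<close>, so \<open>(E * H) ^ n\<close> bounds the indices that occur.\<close>
  define E where "E = 3 * K * (M * (K + 3))"
  have E1: "E \<ge> 1" using K_ge_1 M1 by (simp add: E_def)
  define c2 where "c2 = 2 * real n * E ^ n"
  have c2: "c2 > 0" using n_pos E1 by (simp add: c2_def)
  obtain N2 where N2: "\<And>F. finite F \<Longrightarrow> F \<subseteq> {N2..} \<Longrightarrow> sum a F < 1 / (2 * c2)"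
    using summable_tail_small[OF sum_a a0, of "1 / (2 * c2)"] c2 by auto
  \<comment> \<open>So \<open>p ^ 2 \<ge> H\<close> puts \<open>p\<close> into the tail beyond \<open>N2\<close>.\<close>
  define H where "H = (N2 + 1) ^ 2"
  have H1: "H \<ge> 1" by (simp add: H_def)
  define x where "x = (\<lambda>y. 1 + of_nat M * (of_nat ((K + 1) * H) + y) :: complex)"
  define G where "G = grid 0 H"
  define X where "X = (\<lambda>m. {y \<in> G. x y \<in> m})"
  define P where "P = {p. prime p \<and> Y < p \<and> p \<le> (E * H) ^ n}"
  have finP: "finite P" unfolding P_def by (rule finite_subset[of _ "{..(E * H) ^ n}"]) auto
  have GR: "y \<in> R" if "y \<in> G" for y using that by (simp add: G_def grid_def)
  have xR: "x y \<in> R" if "y \<in> G" for y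
    unfolding x_def using GR[OF that] by (intro R_add R_mult R_1 R_of_nat)
  have xc: "coord (x y) b = coord 1 b * (1 + int M * int ((K + 1) * H)) + int M * coord y b" if y: "y \<in> G" and b: "b \<in> B" for y b
  proof -
    have "x y = of_int (1 + int M * int ((K + 1) * H)) * 1 + of_int (int M) * y"
      by (simp add: x_def algebra_simps)
    also have "coord \<dots> b = coord (of_int (1 + int M * int ((K + 1) * H)) * 1) b + coord (of_int (int M) * y) b"
      by (rule coord_add[OF R_scale[OF R_1] R_scale[OF GR[OF y]] b])
    also have "\<dots> = (1 + int M * int ((K + 1) * H)) * coord 1 b + int M * coord y b"
      by (simp only: coord_scale[OF R_1 b] coord_scale[OF GR[OF y] b])
    finally show ?thesis by (simp only: mult.commute)
  qed
  have yc: "0 \<le> coord y b \<and> coord y b < int H" if "y \<in> G" "b \<in> B" for y b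
    using that by (auto simp: G_def grid_def)
  define T where "T = M * (K + 3) * H"
  have xT: "height_le T (x y)" if y: "y \<in> G" for y
    unfolding height_le_def
  proof (intro conjI ballI)
    show "x y \<in> R" using y by (rule xR)
    fix b assume b: "b \<in> B"
    have one: "coord 1 b = 0 \<or> coord 1 b = 1" using coord_basis[OF one_in_B b] by auto
    have MH: "int M * int H \<ge> 1" using M1 H1 by (metis int_one_le_iff_zero_less mult_pos_pos of_nat_0_less_iff zero_less_one_class.zero_less_one less_le_trans One_nat_def Suc_le_eq)
    have My: "0 \<le> int M * coord y b" "int M * coord y b \<le> int M * int H"
      using yc[OF y b] by (auto intro: mult_left_mono)
    have T: "int T = int M * int ((K + 1) * H) + 2 * (int M * int H)"
      by (simp add: T_def algebra_simps)
    have "0 \<le> int M * int ((K + 1) * H)" by simp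
    thus "\<bar>coord (x y) b\<bar> \<le> int T"
      unfolding xc[OF y b] T using one My MH by (elim disjE) (simp_all only: mult_zero_left mult_1 abs_le_iff, linarith+)
  qed
  have x0: "x y \<noteq> 0" if y: "y \<in> G" for y
  proof
    assume "x y = 0"
    hence "coord (x y) 1 = 0" using coord_of_int[OF one_in_B, of 0] by simp
    moreover have "coord (1::complex) 1 = 1" using coord_basis[OF one_in_B one_in_B] by simp
    hence "coord (x y) 1 = 1 + int M * int ((K + 1) * H) + int M * coord y 1"
      using xc[OF y one_in_B] by (simp only: mult_1)
    moreover have "0 \<le> int M * coord y 1" using yc[OF y one_in_B] by simp
    moreover have "0 \<le> int M * int ((K + 1) * H)" by simp
    ultimately show False by linarith
  qed
  have small: "min_norm p \<le> (E * H) ^ n"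
    if "y \<in> G" "max_ideal m" "prime p" "of_nat p \<in> m" "x y \<in> m" for y p m
  proof -
    have "min_norm p \<le> (2 * (K * T) + 1) ^ n"
      using that by (intro min_norm_le[OF _ _ _ _ x0 xT]) auto
    also have "\<dots> \<le> (E * H) ^ n"
    proof (rule power_mono)
      have "K * T \<ge> 1" using K_ge_1 M1 H1 by (simp add: T_def)
      hence "2 * (K * T) + 1 \<le> 3 * (K * T)" by linarith
      also have "\<dots> = E * H" by (simp add: T_def E_def)
      finally show "2 * (K * T) + 1 \<le> E * H" .
    qed simp
    finally show ?thesis .
  qed
  have cover: "G \<subseteq> (\<Union>p\<in>P. \<Union>m\<in>ideals_over p. X m)"
  proof
    fix y assume y: "y \<in> G"
    have "x y * u \<noteq> 1" if "u \<in> R" for u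
      unfolding x_def using y that M1 H1 by (intro large_element_not_unit) (auto simp: G_def)
    then obtain m where m: "max_ideal m" "x y \<in> m"
      using exists_max_ideal[OF xR[OF y]] by blast
    obtain p where p: "prime p" "of_nat p \<in> m" using max_ideal_contains_prime[OF m x0[OF y]] by blast
    note I = max_ideal_imp_ideal[OF m(1)]
    have "Y < p"
    proof (rule ccontr)
      assume "\<not> Y < p"
      hence "p dvd M" using p(1) by (simp add: M_def prime_dvd_fact_iff)
      hence "of_int (int M) \<in> m" by (subst of_int_in_max_ideal_iff[OF m(1) p]) simp
      hence "of_nat M \<in> m" by simp
      moreover have "of_nat ((K + 1) * H) + y \<in> R" using GR[OF y] by (intro R_add R_of_nat)
      ultimately have "of_nat M * (of_nat ((K + 1) * H) + y) \<in> m" by (rule idealD(5)[OF I])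
      from ideal_diff[OF I m(2) this] have "1 \<in> m" by (simp add: x_def)
      thus False using m(1) by (simp add: max_ideal_def)
    qed
    moreover have "p \<le> (E * H) ^ n" using small[OF y m(1) p m(2)] min_norm_ge[OF p(1)] by linarith
    ultimately have "p \<in> P" using p(1) by (simp add: P_def)
    moreover have "m \<in> ideals_over p" using m p by (simp add: ideals_over_def)
    moreover have "y \<in> X m" using y m by (simp add: X_def)
    ultimately show "y \<in> (\<Union>p\<in>P. \<Union>m\<in>ideals_over p. X m)" by blast
  qed
  have over: "finite (ideals_over p) \<and> card (ideals_over p) \<le> 2 * n" if "p \<in> P" for p
    using that by (intro card_ideals_over) (auto simp: P_def Y_def)
  have finG: "finite G" unfolding G_def by (rule finite_grid)
  define w where "w = (\<lambda>p. (12 * real K) ^ n * a p + (if N2 \<le> p then real E ^ n * a p else 0))"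
  have w0: "w p \<ge> 0" for p using a0[of p] by (simp add: w_def)
  have bound: "real (card (X m)) \<le> real H ^ n * w p" if p: "p \<in> P" and m: "m \<in> ideals_over p" for p m
  proof (cases "X m = {}")
    case True
    thus ?thesis using w0[of p] by simp
  next
    case False
    then obtain y where y: "y \<in> G" "x y \<in> m" by (auto simp: X_def)
    have pp: "prime p" "Y < p" using p by (auto simp: P_def)
    have mm: "max_ideal m" "of_nat p \<in> m" using m by (auto simp: ideals_over_def)
    note I = max_ideal_imp_ideal[OF mm(1)]
    define Q where "Q = min_norm p"
    have Q1: "real Q > 0" using min_norm_ge[OF pp(1)] prime_gt_0_nat[OF pp(1)] by (simp add: Q_def)
    have aQ: "a p = 1 / real Q" using pp by (simp add: a_def Q_def)
    have QE: "Q \<le> (E * H) ^ n" unfolding Q_def using small[OF y(1) mm(1) pp(1) mm(2) y(2)] .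
    \<comment> \<open>Hence differences of the \<open>x y\<close> in \<open>m\<close> give differences of the \<open>y\<close> in \<open>m\<close>.\<close>
    have Mm: "of_nat M \<notin> m"
    proof
      assume "of_nat M \<in> m"
      hence "of_int (int M) \<in> m" by simp
      hence "int p dvd int M" by (subst (asm) of_int_in_max_ideal_iff[OF mm(1) pp(1) mm(2)])
      hence "p dvd fact Y" unfolding M_def by presburger
      thus False using pp by (simp add: prime_dvd_fact_iff)
    qed
    have diff: "u - v \<in> m" if "u \<in> X m" "v \<in> X m" for u v
    proof -
      have "x u - x v \<in> m" using that by (intro ideal_diff[OF I]) (auto simp: X_def)
      also have "x u - x v = of_nat M * (u - v)" by (simp add: x_def algebra_simps)
      finally show ?thesis
        using max_ideal_prime[OF mm(1) R_of_nat, of "u - v" M] Mm that GR by (auto simp: X_def)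
    qed
    have "card (X m) * Q \<le> (12 * K * H) ^ n \<or> card (X m) \<le> 1 \<and> H ^ n \<le> Q"
      unfolding Q_def using diff
      by (intro card_ideal_grid_le[OF mm(1) pp(1) mm(2)]) (auto simp: X_def G_def)
    thus ?thesis
    proof
      assume "card (X m) * Q \<le> (12 * K * H) ^ n"
      hence "real (card (X m) * Q) \<le> real ((12 * K * H) ^ n)" by (rule of_nat_mono)
      hence "real (card (X m)) * real Q \<le> real H ^ n * (12 * real K) ^ n"
        by (simp add: power_mult_distrib mult_ac)
      hence "real (card (X m)) \<le> real H ^ n * ((12 * real K) ^ n * a p)"
        using Q1 by (simp add: aQ field_simps)
      also have "\<dots> \<le> real H ^ n * w p" using a0[of p] by (intro mult_left_mono) (auto simp: w_def)
      finally show ?thesis .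
    next
      assume *: "card (X m) \<le> 1 \<and> H ^ n \<le> Q"
      have "H \<le> H ^ n" using H1 n_pos by (intro self_le_power) auto
      also have "\<dots> \<le> Q" using * by blast
      also have "\<dots> \<le> p ^ 2" unfolding Q_def by (rule min_norm_le_square[OF pp(1)])
      finally have "(N2 + 1) ^ 2 \<le> p ^ 2" by (simp add: H_def)
      hence N2p: "N2 + 1 \<le> p" by (rule power2_le_imp_le) simp
      have "real (card (X m)) \<le> 1" using * by simp
      also have "1 \<le> real ((E * H) ^ n) / real Q" using QE Q1 by (simp add: le_divide_eq del: of_nat_power of_nat_mult)
      also have "\<dots> = real H ^ n * (real E ^ n * a p)" by (simp add: aQ power_mult_distrib)
      also have "\<dots> \<le> real H ^ n * w p" using a0[of p] N2p by (intro mult_left_mono) (auto simp: w_def)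
      finally show ?thesis .
    qed
  qed
  have "H ^ n = card G" by (simp add: G_def card_grid)
  also have "\<dots> \<le> card (\<Union>p\<in>P. \<Union>m\<in>ideals_over p. X m)"
    using finP over finG by (intro card_mono cover) (auto simp: X_def)
  also have "\<dots> \<le> (\<Sum>p\<in>P. card (\<Union>m\<in>ideals_over p. X m))" by (rule card_UN_le[OF finP])
  also have "\<dots> \<le> (\<Sum>p\<in>P. \<Sum>m\<in>ideals_over p. card (X m))"
    using over by (intro sum_mono card_UN_le) auto
  finally have "real (H ^ n) \<le> real (\<Sum>p\<in>P. \<Sum>m\<in>ideals_over p. card (X m))" by (rule of_nat_mono)
  also have "\<dots> = (\<Sum>p\<in>P. \<Sum>m\<in>ideals_over p. real (card (X m)))" by simp
  also have "\<dots> \<le> (\<Sum>p\<in>P. 2 * real n * (real H ^ n * w p))"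
  proof (rule sum_mono)
    fix p assume p: "p \<in> P"
    have "(\<Sum>m\<in>ideals_over p. real (card (X m))) \<le> real (card (ideals_over p)) * (real H ^ n * w p)"
      using bound[OF p] by (rule sum_bounded_above)
    also have "\<dots> \<le> (2 * real n) * (real H ^ n * w p)"
    proof (rule mult_right_mono)
      have "real (card (ideals_over p)) \<le> real (2 * n)" using over[OF p] by (intro of_nat_mono) blast
      thus "real (card (ideals_over p)) \<le> 2 * real n" by simp
    qed (use w0[of p] in simp)
    finally show "(\<Sum>m\<in>ideals_over p. real (card (X m))) \<le> 2 * real n * (real H ^ n * w p)" .
  qed
  also have "\<dots> = real H ^ n * (c1 * sum a P + c2 * (\<Sum>p\<in>P. if N2 \<le> p then a p else 0))"
  proof -
    have "2 * real n * (real H ^ n * w p) = real H ^ n * (c1 * a p + c2 * (if N2 \<le> p then a p else 0))" for p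
      by (simp add: w_def c1_def c2_def algebra_simps)
    thus ?thesis by (simp only: sum_distrib_left [symmetric] sum.distrib)
  qed
  also have "\<dots> < real H ^ n * 1"
  proof (rule mult_strict_left_mono)
    have "sum a P < 1 / (2 * c1)" using finP by (intro N1) (auto simp: P_def Y_def)
    hence "c1 * sum a P < 1 / 2" using c1 by (simp add: field_simps)
    moreover have "(\<Sum>p\<in>P. if N2 \<le> p then a p else 0) = sum a {p \<in> P. N2 \<le> p}"
      using finP by (rule sum.inter_filter [symmetric])
    moreover have "sum a {p \<in> P. N2 \<le> p} < 1 / (2 * c2)" using finP by (intro N2) auto
    hence "c2 * sum a {p \<in> P. N2 \<le> p} < 1 / 2" using c2 by (simp add: field_simps)
    ultimately show "c1 * sum a P + c2 * (\<Sum>p\<in>P. if N2 \<le> p then a p else 0) < 1" by simp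
  qed (use H1 in simp)
  finally show False by simp
qed

end

section \<open>The order generated by one radical\<close>

definition rat_poly_eval :: "rat poly \<Rightarrow> complex \<Rightarrow> complex" where
  "rat_poly_eval h = poly (map_poly of_rat h)"

lemma map_poly_of_rat_add: "map_poly (of_rat :: rat \<Rightarrow> complex) (f + g) = map_poly of_rat f + map_poly of_rat g"
  by (rule poly_eqI) (simp add: coeff_map_poly of_rat_add)

lemma map_poly_of_rat_mult: "map_poly (of_rat :: rat \<Rightarrow> complex) (f * g) = map_poly of_rat f * map_poly of_rat g"
  by (rule poly_eqI) (simp add: coeff_map_poly coeff_mult of_rat_sum of_rat_mult)

lemma rational_if_coprime_power_rational:
  fixes \<rho> :: real
  assumes "\<rho> > 0" "\<rho> ^ q \<in> \<rat>" "\<rho> ^ d \<in> \<rat>" "coprime d q" "d > 0"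
  shows "\<rho> \<in> \<rat>"
proof -
  obtain u v where uv: "d * u = q * v + 1"
    using bezout_nat[of d q] assms by (metis coprime_imp_gcd_eq_1 less_numeral_extra(3))
  have "\<rho> ^ (d * u) = \<rho> ^ (q * v) * \<rho>" unfolding uv by simp
  hence "\<rho> = (\<rho> ^ d) ^ u / (\<rho> ^ q) ^ v" using assms(1) by (simp add: power_mult)
  also have "\<dots> \<in> \<rat>" by (rule Rats_divide[OF Rats_power[OF assms(3)] Rats_power[OF assms(2)]])
  finally show ?thesis .
qed

text \<open>
  Irreducibility of \<open>X ^ q - a\<close>. A rational polynomial \<open>h\<close> of least degree \<open>D\<close> with root \<open>\<alpha>\<close> divides
  \<open>X ^ q - a\<close>, so all its complex roots have the modulus \<open>\<rho> = root q a\<close>. Its constant and leading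
  coefficients show that \<open>\<rho> ^ D\<close> is rational. If \<open>0 < D < q\<close>, then \<open>\<rho>\<close> is rational, and \<open>a\<close> is a perfect
  power.
\<close>
lemma pure_powers_independent:
  fixes \<alpha> :: complex
  assumes q: "prime q" and a: "a > 0" "\<not> (\<exists>r::rat. of_nat a = r ^ q)"
    and \<alpha>: "\<alpha> ^ q = of_nat a" and c: "(\<Sum>i<q. of_int (c i) * \<alpha> ^ i) = 0" and i: "i < q"
  shows "c i = 0"
proof (rule ccontr)
  assume ci: "c i \<noteq> 0"
  define f where "f = (\<Sum>i<q. monom (rat_of_int (c i)) i)"
  have cf: "coeff f k = (if k < q then rat_of_int (c k) else 0)" for k
    by (simp add: f_def coeff_sum)
  have f0: "f \<noteq> 0"
  proof
    assume "f = 0"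
    with cf[of i] i ci show False by simp
  qed
  have df: "degree f < q"
  proof -
    have "degree f \<le> q - 1" using cf by (intro degree_le) auto
    thus ?thesis using i by linarith
  qed
  have ef: "rat_poly_eval f \<alpha> = 0"
  proof -
    have "map_poly of_rat f = (\<Sum>i<q. monom (of_int (c i)) i :: complex poly)"
      by (rule poly_eqI) (simp add: coeff_map_poly cf coeff_sum)
    thus ?thesis using c by (simp add: rat_poly_eval_def poly_sum poly_monom)
  qed
  define D where "D = (LEAST d. \<exists>h. h \<noteq> 0 \<and> rat_poly_eval h \<alpha> = 0 \<and> degree h = d)"
  have ex: "\<exists>d h. h \<noteq> 0 \<and> rat_poly_eval h \<alpha> = 0 \<and> degree h = d" using f0 ef by blast
  obtain h where h: "h \<noteq> 0" "rat_poly_eval h \<alpha> = 0" "degree h = D"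
    using LeastI_ex[OF ex] unfolding D_def by blast
  have Dmin: "D \<le> degree h'" if "h' \<noteq> 0" "rat_poly_eval h' \<alpha> = 0" for h'
    unfolding D_def using that by (intro Least_le) blast
  have Dq: "D < q" using Dmin[OF f0 ef] df by simp
  define hc where "hc = map_poly (of_rat :: rat \<Rightarrow> complex) h"
  have D0: "D > 0"
  proof (rule ccontr)
    assume "\<not> D > 0"
    then obtain k where "h = [:k:]" using h(3) degree_eq_zeroE by blast
    thus False using h by (simp add: rat_poly_eval_def map_poly_pCons)
  qed
  \<comment> \<open>Minimality makes \<open>h\<close> a divisor of \<open>X ^ q - a\<close>.\<close>
  define g where "g = monom 1 q - [:rat_of_nat a:]"
  have gc: "map_poly (of_rat :: rat \<Rightarrow> complex) g = monom 1 q - [:of_nat a:]"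
    by (rule poly_eqI) (simp add: g_def coeff_map_poly coeff_pCons of_rat_diff of_rat_minus split: nat.split)
  have "rat_poly_eval g \<alpha> = 0" using \<alpha> by (simp add: rat_poly_eval_def gc poly_monom)
  moreover have "rat_poly_eval g \<alpha> = rat_poly_eval (h * (g div h)) \<alpha> + rat_poly_eval (g mod h) \<alpha>"
    unfolding rat_poly_eval_def poly_add [symmetric] map_poly_of_rat_add [symmetric] by simp
  moreover have "rat_poly_eval (h * (g div h)) \<alpha> = 0"
    using h(2) by (simp add: rat_poly_eval_def map_poly_of_rat_mult)
  ultimately have "rat_poly_eval (g mod h) \<alpha> = 0" by simp
  hence "g mod h = 0" using Dmin[of "g mod h"] degree_mod_less[OF h(1), of g] h(3) by force
  hence "g = h * (g div h)" by (metis add.right_neutral mult_div_mod_eq)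
  hence gch: "map_poly (of_rat :: rat \<Rightarrow> complex) g = hc * map_poly of_rat (g div h)"
    unfolding hc_def map_poly_of_rat_mult [symmetric] by simp
  have hc0: "hc \<noteq> 0" "degree hc = D" "lead_coeff hc = of_rat (lead_coeff h)"
    using h unfolding hc_def by (auto simp: map_poly_eq_0_iff degree_map_poly coeff_map_poly)
  obtain A where A: "size A = degree hc" "hc = smult (lead_coeff hc) (\<Prod>x\<in>#A. [:-x, 1:])"
    using alg_closed_imp_factorization[OF hc0(1)] by blast
  define \<rho> where "\<rho> = root q (real a)"
  have q0: "q > 0" using q by (rule prime_gt_0_nat)
  have \<rho>: "\<rho> > 0" "\<rho> ^ q = real a" using a q0 by (simp_all add: \<rho>_def)
  have nA: "norm x = \<rho>" if "x \<in># A" for x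
  proof -
    have "poly hc x = 0" using that by (subst A(2)) (auto simp: poly_prod_mset prod_mset_zero_iff)
    hence "poly (monom 1 q - [:of_nat a:]) x = 0" unfolding gc[symmetric] gch by simp
    hence "x ^ q = of_nat a" by (simp add: poly_monom)
    hence "norm x ^ q = \<rho> ^ q" unfolding \<rho>(2) by (metis norm_of_nat norm_power)
    thus ?thesis using \<rho>(1) q0 by (simp add: power_eq_iff_eq_base)
  qed
  have "norm (poly (\<Prod>x\<in>#A. [:-x, 1:]) 0) = \<rho> ^ size A"
    using nA by (induction A) (auto simp: norm_mult)
  hence "norm (poly hc 0) = norm (lead_coeff hc) * \<rho> ^ D"
    using A(1) hc0(2) by (subst A(2)) (simp add: norm_mult)
  moreover have "poly hc 0 = of_rat (coeff h 0)" by (simp add: hc_def poly_0_coeff_0 coeff_map_poly)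
  moreover have nr: "norm (of_rat x :: complex) \<in> \<rat>" for x
  proof -
    have "(of_rat x :: complex) = of_real (of_rat x)" by (cases x) (simp add: of_rat_rat)
    hence "norm (of_rat x :: complex) = \<bar>of_rat x\<bar>" by (simp only: norm_of_real)
    also have "\<dots> = of_rat \<bar>x\<bar>" by simp
    finally show ?thesis by simp
  qed
  moreover have "norm (lead_coeff hc) \<noteq> 0" using hc0(1) by simp
  ultimately have "\<rho> ^ D = norm (of_rat (coeff h 0) :: complex) / norm (of_rat (lead_coeff h) :: complex)"
    using hc0(3) by (simp add: field_simps)
  also have "\<dots> \<in> \<rat>" by (rule Rats_divide[OF nr nr])
  finally have "\<rho> ^ D \<in> \<rat>" .
  moreover have "coprime D q"
    using q D0 Dq by (metis coprime_commute dvd_imp_le linorder_not_less prime_imp_coprime)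
  ultimately have "\<rho> \<in> \<rat>" using \<rho> D0 by (intro rational_if_coprime_power_rational[of \<rho> q D]) auto
  then obtain r where "\<rho> = of_rat r" by (auto simp: Rats_def)
  hence "(of_rat (r ^ q) :: real) = of_rat (of_nat a)" using \<rho>(2) by (simp add: of_rat_power)
  hence "r ^ q = of_nat a" by (simp only: of_rat_eq_iff)
  thus False using a(2) by metis
qed

text \<open>
  The subring generated by a \<open>q\<close>-th root \<open>\<alpha>\<close> of a natural number that is not a perfect power.
\<close>
locale pure_field =
  fixes q a :: nat and \<alpha> :: complex
  assumes prime_q: "prime q" and a_pos: "a > 0" and a_nonpower: "\<not> (\<exists>r::rat. of_nat a = r ^ q)"
    and alpha_power: "\<alpha> ^ q = of_nat a"
begin

lemma q_gt_1: "q > 1" using prime_q by (rule prime_gt_1_nat)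

lemma inj_alpha: "inj_on (\<lambda>i. \<alpha> ^ i) {..<q}"
proof (rule inj_onI, rule ccontr)
  fix i j assume ij: "i \<in> {..<q}" "j \<in> {..<q}" "\<alpha> ^ i = \<alpha> ^ j" "i \<noteq> j"
  define c :: "nat \<Rightarrow> int" where "c = (\<lambda>k. (if k = i then 1 else 0) - (if k = j then 1 else 0))"
  have "(\<Sum>k<q. of_int (c k) * \<alpha> ^ k) = (\<Sum>k<q. (if k = i then \<alpha> ^ k else 0) - (if k = j then \<alpha> ^ k else 0))"
    by (intro sum.cong) (auto simp: c_def)
  also have "\<dots> = 0" using ij by (simp add: sum_subtractf)
  finally have "c i = 0"
    using ij(1) by (intro pure_powers_independent[OF prime_q a_pos a_nonpower alpha_power]) auto
  thus False using ij(4) by (simp add: c_def)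
qed

sublocale complex_order "(\<lambda>i. \<alpha> ^ i) ` {..<q}"
proof
  show "1 \<in> (\<lambda>i. \<alpha> ^ i) ` {..<q}" using q_gt_1 by (intro image_eqI[of _ _ 0]) auto
  fix c :: "complex \<Rightarrow> int" and b
  assume c: "(\<Sum>b\<in>(\<lambda>i. \<alpha> ^ i) ` {..<q}. of_int (c b) * b) = 0" and b: "b \<in> (\<lambda>i. \<alpha> ^ i) ` {..<q}"
  have "(\<Sum>i<q. of_int (c (\<alpha> ^ i)) * \<alpha> ^ i) = 0" using c by (simp add: sum.reindex[OF inj_alpha])
  thus "c b = 0" using b
      pure_powers_independent[OF prime_q a_pos a_nonpower alpha_power, of "\<lambda>i. c (\<alpha> ^ i)"] by auto
next
  fix x y assume "x \<in> (\<lambda>i. \<alpha> ^ i) ` {..<q}" "y \<in> (\<lambda>i. \<alpha> ^ i) ` {..<q}"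
  then obtain i j where ij: "x = \<alpha> ^ i" "i < q" "y = \<alpha> ^ j" "j < q" by auto
  have *: "\<exists>k v. v < q \<and> x * y = of_int k * \<alpha> ^ v"
  proof (cases "i + j < q")
    case True
    thus ?thesis using ij by (intro exI[of _ 1] exI[of _ "i + j"]) (simp add: power_add)
  next
    case False
    have "x * y = \<alpha> ^ (q + (i + j - q))" using ij False by (simp add: power_add)
    also have "\<dots> = of_int (int a) * \<alpha> ^ (i + j - q)" by (simp add: power_add alpha_power)
    finally show ?thesis using ij by (intro exI[of _ "int a"] exI[of _ "i + j - q"]) auto
  qed
  then obtain k v where kv: "v < q" "x * y = of_int k * \<alpha> ^ v" by blast
  have "(\<Sum>d\<in>(\<lambda>i. \<alpha> ^ i) ` {..<q}. of_int (if d = \<alpha> ^ v then k else 0) * d)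
      = (\<Sum>d\<in>(\<lambda>i. \<alpha> ^ i) ` {..<q}. if d = \<alpha> ^ v then of_int k * \<alpha> ^ v else 0)"
    by (intro sum.cong) auto
  also have "\<dots> = x * y" using kv by auto
  finally have "x * y = (\<Sum>d\<in>(\<lambda>i. \<alpha> ^ i) ` {..<q}. of_int (if d = \<alpha> ^ v then k else 0) * d)" ..
  thus "\<exists>c :: complex \<Rightarrow> int. x * y = (\<Sum>d\<in>(\<lambda>i. \<alpha> ^ i) ` {..<q}. of_int (c d) * d)"
    by (rule exI[where x = "\<lambda>d. if d = \<alpha> ^ v then k else 0"])
qed auto

lemma n_eq_q: "n = q" using card_image[OF inj_alpha] by simp

lemma alpha_in_basis: "i < q \<Longrightarrow> \<alpha> ^ i \<in> (\<lambda>i. \<alpha> ^ i) ` {..<q}" by blast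

lemma alpha_power_in_R: "\<alpha> ^ k \<in> R"
proof -
  have "\<alpha> ^ 1 \<in> R" using q_gt_1 by (intro B_subset_R alpha_in_basis)
  thus ?thesis by (intro R_power) simp
qed

text \<open>
  Substituting \<open>r\<close> for \<open>\<alpha>\<close>. This is a ring homomorphism modulo \<open>p\<close> if \<open>r ^ q \<equiv> a\<close>.
\<close>
definition eval_at :: "int \<Rightarrow> complex \<Rightarrow> int" where
  "eval_at r z = (\<Sum>i<q. coord z (\<alpha> ^ i) * r ^ i)"

lemma eval_at_add: "z \<in> R \<Longrightarrow> w \<in> R \<Longrightarrow> eval_at r (z + w) = eval_at r z + eval_at r w"
  unfolding eval_at_def sum.distrib[symmetric]
  by (intro sum.cong refl) (simp add: coord_add[OF _ _ alpha_in_basis] distrib_right)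

lemma eval_at_scale: "z \<in> R \<Longrightarrow> eval_at r (of_int k * z) = k * eval_at r z"
  unfolding eval_at_def sum_distrib_left
  by (intro sum.cong refl) (simp add: coord_scale[OF _ alpha_in_basis])

lemma eval_at_sum: "(\<And>i. i \<in> A \<Longrightarrow> f i \<in> R) \<Longrightarrow> eval_at r (sum f A) = (\<Sum>i\<in>A. eval_at r (f i))"
proof (induction A rule: infinite_finite_induct)
  case (insert x A)
  have "sum f A \<in> R" "f x \<in> R" using insert.prems by (blast intro: R_sum)+
  moreover have "eval_at r (sum f A) = (\<Sum>i\<in>A. eval_at r (f i))" using insert.IH insert.prems by blast
  ultimately show ?case using insert.hyps by (simp add: eval_at_add)
qed (use eval_at_scale[OF R_0, of r 0] in simp_all)

lemma eval_at_power:
  assumes "k < q" shows "eval_at r (\<alpha> ^ k) = r ^ k"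
proof -
  have "eval_at r (\<alpha> ^ k) = (\<Sum>i<q. if i = k then r ^ i else 0)"
    unfolding eval_at_def
  proof (intro sum.cong refl)
    fix i assume i: "i \<in> {..<q}"
    have "\<alpha> ^ i = \<alpha> ^ k \<longleftrightarrow> i = k" using inj_alpha i assms by (auto simp: inj_on_def)
    thus "coord (\<alpha> ^ k) (\<alpha> ^ i) * r ^ i = (if i = k then r ^ i else 0)"
      using i assms by (simp add: coord_basis[OF alpha_in_basis alpha_in_basis])
  qed
  also have "\<dots> = r ^ k" using assms by simp
  finally show ?thesis .
qed

lemma eval_at_power_cong:
  assumes r: "[r ^ q = int a] (mod int p)" and k: "k < 2 * q"
  shows "[eval_at r (\<alpha> ^ k) = r ^ k] (mod int p)"
proof (cases "k < q")
  case False
  have "\<alpha> ^ k = \<alpha> ^ (q + (k - q))" using False by simp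
  also have "\<dots> = of_int (int a) * \<alpha> ^ (k - q)" by (simp add: power_add alpha_power)
  finally have "eval_at r (\<alpha> ^ k) = int a * eval_at r (\<alpha> ^ (k - q))"
    by (simp only: eval_at_scale[OF alpha_power_in_R])
  also have "\<dots> = int a * r ^ (k - q)" using k False by (subst eval_at_power) auto
  also have "[int a * r ^ (k - q) = r ^ q * r ^ (k - q)] (mod int p)"
    using r by (intro cong_mult) (auto simp: cong_sym)
  also have "r ^ q * r ^ (k - q) = r ^ k" using False by (simp flip: power_add)
  finally show ?thesis .
qed (simp add: eval_at_power)

lemma eval_at_of_int: "eval_at r (of_int k) = k"
  using eval_at_scale[OF R_1, of r k] eval_at_power[of 0 r] q_gt_1 by simp

lemma expand: "z \<in> R \<Longrightarrow> (\<Sum>i<q. of_int (coord z (\<alpha> ^ i)) * \<alpha> ^ i) = z"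
proof -
  assume "z \<in> R"
  hence "comb (coord z) = z" by (rule comb_coord)
  thus ?thesis unfolding comb_def sum.reindex[OF inj_alpha] o_def .
qed

lemma eval_at_mult:
  assumes r: "[r ^ q = int a] (mod int p)" and zw: "z \<in> R" "w \<in> R"
  shows "[eval_at r (z * w) = eval_at r z * eval_at r w] (mod int p)"
proof -
  let ?x = "\<lambda>i. coord z (\<alpha> ^ i)" and ?y = "\<lambda>j. coord w (\<alpha> ^ j)"
  have "z * w = (\<Sum>i<q. of_int (?x i) * \<alpha> ^ i) * (\<Sum>j<q. of_int (?y j) * \<alpha> ^ j)"
    by (simp only: expand[OF zw(1)] expand[OF zw(2)])
  also have "\<dots> = (\<Sum>i<q. \<Sum>j<q. of_int (?x i * ?y j) * \<alpha> ^ (i + j))"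
    by (simp only: sum_product of_int_mult_mult power_add)
  finally have "eval_at r (z * w) = eval_at r (\<Sum>i<q. \<Sum>j<q. of_int (?x i * ?y j) * \<alpha> ^ (i + j))"
    by (rule arg_cong)
  also have "\<dots> = (\<Sum>i<q. \<Sum>j<q. ?x i * ?y j * eval_at r (\<alpha> ^ (i + j)))"
    by (simp only: eval_at_sum eval_at_scale[OF alpha_power_in_R] R_sum R_scale alpha_power_in_R)
  finally have eq1: "eval_at r (z * w) = (\<Sum>i<q. \<Sum>j<q. ?x i * ?y j * eval_at r (\<alpha> ^ (i + j)))" .
  have eq2: "eval_at r z * eval_at r w = (\<Sum>i<q. \<Sum>j<q. ?x i * ?y j * r ^ (i + j))"
    unfolding eval_at_def sum_product power_add by (simp only: mult_ac)
  show ?thesis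
    unfolding eq1 eq2
    by (rule cong_sum, rule cong_sum, rule cong_mult[OF cong_refl], rule eval_at_power_cong[OF r]) simp
qed

definition root_ideal :: "nat \<Rightarrow> int \<Rightarrow> complex set" where
  "root_ideal p r = {z \<in> R. int p dvd eval_at r z}"

text \<open>
  Substitution of \<open>r\<close> is multiplicative modulo \<open>p\<close> and fixes the integers, so \<open>z\<close> is congruent to its
  value \<open>eval_at r z\<close> modulo the kernel.
\<close>
lemma root_ideal_deg_one:
  assumes p: "prime p" and r: "[r ^ q = int a] (mod int p)"
  shows "deg_one p (root_ideal p r)"
proof (rule deg_oneI)
  have "int p dvd eval_at r (u * z)" if "u \<in> R" "z \<in> R" "int p dvd eval_at r z" for u z
  proof -
    have "int p dvd eval_at r u * eval_at r z" using that(3) by simp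
    thus ?thesis using cong_dvd_iff[OF eval_at_mult[OF r that(1,2)]] by blast
  qed
  thus "is_ideal (root_ideal p r)"
    unfolding is_ideal_def root_ideal_def
    using eval_at_of_int[of r 0] by (auto simp: eval_at_add)
  show "1 \<notin> root_ideal p r"
    using eval_at_of_int[of r 1] p by (auto simp: root_ideal_def)
  show "of_nat p \<in> root_ideal p r"
    using eval_at_of_int[of r "int p"] by (simp add: root_ideal_def)
  show "\<exists>c :: int. z - of_int c \<in> root_ideal p r" if z: "z \<in> R" for z
  proof -
    have "eval_at r (z + of_int (- eval_at r z)) = 0"
      using z by (simp only: eval_at_add R_of_int eval_at_of_int right_minus)
    hence "z - of_int (eval_at r z) \<in> root_ideal p r" using z by (auto simp: root_ideal_def)
    thus ?thesis by blast
  qed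
qed (rule p)

lemma root_ideal_eq_imp_dvd:
  assumes "root_ideal p r = root_ideal p r'"
  shows "int p dvd r - r'"
proof -
  have aR: "\<alpha> \<in> R" using alpha_power_in_R[of 1] by simp
  have ev: "eval_at s (\<alpha> + of_int (- r)) = s - r" for s
  proof -
    have "eval_at s (\<alpha> + of_int (- r)) = eval_at s (\<alpha> ^ 1) + eval_at s (of_int (- r))"
      unfolding power_one_right by (rule eval_at_add[OF aR R_of_int])
    also have "\<dots> = s - r" by (simp only: eval_at_power[OF q_gt_1] eval_at_of_int) simp
    finally show ?thesis .
  qed
  have "\<alpha> + of_int (- r) \<in> R" by (rule R_add[OF aR R_of_int])
  hence "\<alpha> + of_int (- r) \<in> root_ideal p r"
    by (simp only: root_ideal_def mem_Collect_eq ev diff_self dvd_0_right simp_thms)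
  hence "\<alpha> + of_int (- r) \<in> root_ideal p r'" by (simp only: assms)
  hence "int p dvd eval_at r' (\<alpha> + of_int (- r))" unfolding root_ideal_def by blast
  thus ?thesis unfolding ev by (simp add: dvd_diff_commute)
qed

end

definition power_residue :: "nat \<Rightarrow> nat \<Rightarrow> int \<Rightarrow> bool" where
  "power_residue q p s \<longleftrightarrow> (\<exists>x. [x ^ q = s] (mod int p))"

text \<open>
  A power of a primitive root modulo \<open>p\<close>.
\<close>
lemma primitive_root_of_unity_mod:
  assumes p: "prime p" and q: "q > 0" "q dvd p - 1"
  shows "\<exists>w::nat. [w ^ q = 1] (mod p) \<and> (\<forall>i<q. \<forall>j<q. [w ^ i = w ^ j] (mod p) \<longrightarrow> i = j)"
proof -
  obtain g where g: "residue_primroot p g" using prime_primitive_root_exists[OF prime_gt_1_nat[OF p] p] by blast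
  have cop: "coprime p g" and ordg: "ord p g = p - 1"
    using g p by (auto simp: residue_primroot_def totient_prime)
  obtain e where e: "p - 1 = q * e" using q(2) by (rule dvdE)
  have "p - 1 > 0" using prime_gt_1_nat[OF p] by simp
  hence e0: "e > 0" unfolding e by simp
  have "[(g ^ e) ^ q = 1] (mod p)"
    using ord[of g p] unfolding ordg e power_mult[symmetric] by (simp only: mult.commute)
  moreover have "i = j" if ij: "i < q" "j < q" "[(g ^ e) ^ i = (g ^ e) ^ j] (mod p)" for i j
  proof -
    have "[g ^ (e * i) = g ^ (e * j)] (mod p)" using ij(3) by (simp add: power_mult)
    hence "[e * i = e * j] (mod ord p g)"
      using order_divides_expdiff[OF cop, of "e * i" "e * j"] by blast
    hence "[e * i = e * j] (mod e * q)" unfolding ordg e by (simp only: mult.commute)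
    moreover have "e * i < e * q" "e * j < e * q" using ij e0 by auto
    ultimately have "e * i = e * j" by (metis cong_less_modulus_unique_nat)
    thus ?thesis using e0 by simp
  qed
  ultimately show ?thesis by blast
qed

lemma many_roots_if_power_residue:
  assumes p: "prime p" "q > 0" "q dvd p - 1" and s: "power_residue q p s" "\<not> int p dvd s"
  shows "\<exists>rs. finite rs \<and> card rs = q \<and> (\<forall>r\<in>rs. [r ^ q = s] (mod int p)) \<and>
           (\<forall>r\<in>rs. \<forall>r'\<in>rs. int p dvd r - r' \<longrightarrow> r = r')"
proof -
  obtain w :: nat where w: "[w ^ q = 1] (mod p)" "\<And>i j. i < q \<Longrightarrow> j < q \<Longrightarrow> [w ^ i = w ^ j] (mod p) \<Longrightarrow> i = j"
    using primitive_root_of_unity_mod[OF p] by blast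
  obtain x where x: "[x ^ q = s] (mod int p)" using s by (auto simp: power_residue_def)
  have px: "\<not> int p dvd x"
  proof
    assume "int p dvd x"
    hence "int p dvd x ^ q" using p(2) by (simp add: dvd_power_iff_le dvd_trans[OF _ dvd_power])
    thus False using cong_dvd_iff[OF x] s(2) by blast
  qed
  define f where "f = (\<lambda>i. x * int w ^ i)"
  have cong: "i = j" if ij: "i < q" "j < q" "int p dvd f i - f j" for i j
  proof -
    have "int p dvd x * (int w ^ i - int w ^ j)" using ij(3) by (simp add: f_def right_diff_distrib)
    hence "int p dvd int w ^ i - int w ^ j" using px p(1) prime_dvd_mult_iff[of "int p"] by auto
    hence "[int (w ^ i) = int (w ^ j)] (mod int p)" by (simp add: cong_iff_dvd_diff)
    hence "[w ^ i = w ^ j] (mod p)" by (simp only: cong_int_iff)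
    thus ?thesis using w(2) ij by blast
  qed
  have inj: "inj_on f {..<q}"
  proof (rule inj_onI)
    fix i j assume "i \<in> {..<q}" "j \<in> {..<q}" "f i = f j"
    thus "i = j" using cong[of i j] by simp
  qed
  have roots: "[f i ^ q = s] (mod int p)" for i
  proof -
    have "[int (w ^ q) = int 1] (mod int p)" using w(1) by (simp only: cong_int_iff)
    hence "[(int w ^ q) ^ i = 1 ^ i] (mod int p)" by (intro cong_pow) simp
    hence "[x ^ q * (int w ^ q) ^ i = s * 1] (mod int p)" using x by (intro cong_mult) simp_all
    moreover have "f i ^ q = x ^ q * (int w ^ q) ^ i"
      unfolding f_def power_mult_distrib power_mult[symmetric] by (simp only: mult.commute)
    ultimately show ?thesis by simp
  qed
  show ?thesis
  proof (intro exI[of _ "f ` {..<q}"] conjI)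
    show "card (f ` {..<q}) = q" using card_image[OF inj] by simp
    show "\<forall>r\<in>f ` {..<q}. \<forall>r'\<in>f ` {..<q}. int p dvd r - r' \<longrightarrow> r = r'"
      using cong by blast
  qed (use roots in auto)
qed

text \<open>
  Raising to the power \<open>q\<close> is a bijection of the units modulo \<open>p\<close>, since \<open>q\<close> is prime to
  \<open>p - 1\<close>, and 0 is its own power.
\<close>
lemma power_residue_if_not_dvd:
  assumes p: "prime p" and q: "prime q" "\<not> q dvd p - 1"
  shows "power_residue q p (int a)"
proof (cases "p dvd a")
  case True
  have "[0 ^ q = int a] (mod int p)" using True q(1) prime_gt_0_nat[of q] by (simp add: cong_iff_dvd_diff zero_power)
  thus ?thesis unfolding power_residue_def by blast
next
  case False
  have "coprime q (p - 1)" using q by (rule prime_imp_coprime)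
  then obtain u v where uv: "q * u = (p - 1) * v + 1"
    using bezout_nat[of q "p - 1"] prime_gt_0_nat[OF q(1)] by (metis coprime_imp_gcd_eq_1 less_numeral_extra(3))
  have "[a ^ (p - 1) = 1] (mod p)" using p False by (rule fermat_theorem)
  hence "[(a ^ (p - 1)) ^ v * a = 1 ^ v * a] (mod p)" by (intro cong_mult cong_pow cong_refl)
  moreover have "(a ^ u) ^ q = (a ^ (p - 1)) ^ v * a"
    unfolding power_mult[symmetric] mult.commute[of u q] uv by simp
  ultimately have "[(a ^ u) ^ q = a] (mod p)" by simp
  hence "[int ((a ^ u) ^ q) = int a] (mod int p)" by (simp only: cong_int_iff)
  hence "[(int a ^ u) ^ q = int a] (mod int p)" by simp
  thus ?thesis unfolding power_residue_def by blast
qed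

context pure_field
begin

text \<open>
  The lower bounds for the number of roots of \<open>X ^ q - a\<close> modulo \<open>p\<close>, in one formula: \<open>q\<close> roots if
  \<open>p \<equiv> 1\<close> modulo \<open>q\<close> and \<open>a\<close> is a residue, and one root if \<open>q\<close> does not divide \<open>p - 1\<close>. The correction for
  \<open>p dvd a\<close>, where only the root 0 is left, concerns finitely many primes.
\<close>
lemma exists_root_set:
  assumes "prime p"
  shows "\<exists>rs :: int set. finite rs \<and> card rs \<le> q \<and> (\<forall>r\<in>rs. [r ^ q = int a] (mod int p)) \<and>
      (\<forall>r\<in>rs. \<forall>r'\<in>rs. int p dvd r - r' \<longrightarrow> r = r') \<and>
      (if q dvd p - 1 then (if power_residue q p (int a) then real q else 0) - (if p dvd a then real q - 1 else 0) else 1) \<le> real (card rs)"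
proof -
  have q1: "q > 1" by (rule q_gt_1)
  consider (none) "\<not> power_residue q p (int a)" 
    | (many) "power_residue q p (int a)" "q dvd p - 1" "\<not> p dvd a"
    | (one) "power_residue q p (int a)" "\<not> q dvd p - 1 \<or> p dvd a" by blast
  thus ?thesis
  proof cases
    case none
    hence "q dvd p - 1" using power_residue_if_not_dvd[OF assms prime_q] by blast
    thus ?thesis using none q1 by (intro exI[of _ "{}"]) auto
  next
    case many
    hence "\<not> int p dvd int a" by simp
    then obtain rs where "finite rs" "card rs = q" "\<forall>r\<in>rs. [r ^ q = int a] (mod int p)"
      "\<forall>r\<in>rs. \<forall>r'\<in>rs. int p dvd r - r' \<longrightarrow> r = r'"
      using many_roots_if_power_residue[OF assms _ many(2,1)] q1 by auto
    thus ?thesis using many by (intro exI[of _ rs]) simp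
  next
    case one
    then obtain x where "[x ^ q = int a] (mod int p)" by (auto simp: power_residue_def)
    thus ?thesis using one q1 by (intro exI[of _ "{x}"]) auto
  qed
qed

text \<open>
  The number of roots of \<open>X ^ q - a\<close> modulo \<open>p\<close> is at most 1 on average, by \<open>sum_deg_one_le\<close> and
  \<open>mertens_lower\<close>. Modulo the primes \<open>p\<close> for which \<open>q\<close> does not divide \<open>p - 1\<close> there is a root, so they
  cancel against the average.
\<close>
theorem sum_power_residue_le:
  "\<exists>C. \<forall>j. (\<Sum>p | prime p \<and> p \<le> 2 ^ (j * q) \<and> q dvd p - 1.
      ((if power_residue q p (int a) then real q else 0) - 1) * (ln (real p) / p)) \<le> C"
proof -
  define tgt where "tgt = (\<lambda>p. if q dvd p - 1 then (if power_residue q p (int a) then real q else 0) - (if p dvd a then real q - 1 else 0) else 1)"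
  have "\<forall>p. \<exists>rs :: int set. prime p \<longrightarrow> finite rs \<and> card rs \<le> q \<and> (\<forall>r\<in>rs. [r ^ q = int a] (mod int p)) \<and>
      (\<forall>r\<in>rs. \<forall>r'\<in>rs. int p dvd r - r' \<longrightarrow> r = r') \<and> tgt p \<le> real (card rs)"
  proof
    fix p
    show "\<exists>rs :: int set. prime p \<longrightarrow> finite rs \<and> card rs \<le> q \<and> (\<forall>r\<in>rs. [r ^ q = int a] (mod int p)) \<and>
      (\<forall>r\<in>rs. \<forall>r'\<in>rs. int p dvd r - r' \<longrightarrow> r = r') \<and> tgt p \<le> real (card rs)"
    proof (cases "prime p")
      case True
      from exists_root_set[OF True] show ?thesis unfolding tgt_def by (simp only: True simp_thms)
    qed simp
  qed
  from choice[OF this] obtain rs :: "nat \<Rightarrow> int set" where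
    rs0: "\<forall>p. prime p \<longrightarrow> finite (rs p) \<and> card (rs p) \<le> q \<and> (\<forall>r\<in>rs p. [r ^ q = int a] (mod int p)) \<and>
      (\<forall>r\<in>rs p. \<forall>r'\<in>rs p. int p dvd r - r' \<longrightarrow> r = r') \<and> tgt p \<le> real (card (rs p))"
    by (rule exE)
  have rs: "finite (rs p)" "card (rs p) \<le> q" "r \<in> rs p \<Longrightarrow> [r ^ q = int a] (mod int p)"
      "r \<in> rs p \<Longrightarrow> r' \<in> rs p \<Longrightarrow> int p dvd r - r' \<Longrightarrow> r = r'" "tgt p \<le> real (card (rs p))"
    if "prime p" for p r r'
    using mp[OF spec[OF rs0] that] by blast+
  define M where "M = (\<lambda>p. root_ideal p ` rs p)"
  have cardM: "card (M p) = card (rs p)" if "prime p" for p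
    unfolding M_def
  proof (rule card_image, rule inj_onI)
    fix r r' assume "r \<in> rs p" "r' \<in> rs p" "root_ideal p r = root_ideal p r'"
    thus "r = r'" using rs(4)[OF that] root_ideal_eq_imp_dvd[of p r r'] by simp
  qed
  have "\<exists>C. \<forall>j. (\<Sum>p | prime p \<and> p \<le> 2 ^ (j * n). card (M p) * (ln (real p) / p)) \<le> j * n * ln 2 + C"
  proof (rule sum_deg_one_le)
    show "finite (M p) \<and> card (M p) \<le> q" if "prime p" for p
      using rs(1,2)[OF that] cardM[OF that] by (simp add: M_def)
    show "deg_one p m" if pm: "prime p" "m \<in> M p" for p m
    proof -
      obtain r where r: "r \<in> rs p" "m = root_ideal p r" using pm(2) by (auto simp: M_def)
      show ?thesis unfolding r(2) by (rule root_ideal_deg_one[OF pm(1) rs(3)[OF pm(1) r(1)]])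
    qed
  qed
  then obtain C1 where C1: "\<And>j. (\<Sum>p | prime p \<and> p \<le> 2 ^ (j * q). card (M p) * (ln (real p) / p)) \<le> j * q * ln 2 + C1"
    unfolding n_eq_q by blast
  obtain C2 where C2: "\<And>N. N \<ge> 1 \<Longrightarrow> ln (real N) - C2 \<le> (\<Sum>p | prime p \<and> p \<le> N. ln (real p) / real p)"
    using mertens_lower by blast
  define C3 where "C3 = (\<Sum>p\<in>prime_factors a. (real q - 1) * (ln (real p) / p))"
  have w0: "ln (real p) / real p \<ge> 0" if "prime p" for p using prime_ge_1_nat[OF that] by simp
  show ?thesis
  proof (intro exI allI)
    fix j :: nat
    define P where "P = {p::nat. prime p \<and> p \<le> 2 ^ (j * q)}"
    have finP: "finite P" unfolding P_def by (rule finite_subset[of _ "{..2 ^ (j * q)}"]) auto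
    have Pp: "prime p" if "p \<in> P" for p using that by (simp add: P_def)
    have "real j * q * ln 2 = ln (real (2 ^ (j * q)))" by (simp add: ln_realpow)
    hence "real j * q * ln 2 - C2 \<le> (\<Sum>p\<in>P. ln (real p) / p)"
      using C2[of "2 ^ (j * q)"] by (simp add: P_def)
    moreover have "(\<Sum>p\<in>P. tgt p * (ln (real p) / p)) \<le> (\<Sum>p\<in>P. card (M p) * (ln (real p) / p))"
      using Pp w0 rs(5) cardM by (intro sum_mono mult_right_mono) auto
    moreover have "(\<Sum>p\<in>P. card (M p) * (ln (real p) / p)) \<le> real j * q * ln 2 + C1"
      using C1[of j] by (simp add: P_def)
    moreover have "(\<Sum>p\<in>P. tgt p * (ln (real p) / p)) - (\<Sum>p\<in>P. ln (real p) / p) = (\<Sum>p\<in>P. (tgt p - 1) * (ln (real p) / p))"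
      by (simp only: sum_subtractf left_diff_distrib mult_1)
    ultimately have le: "(\<Sum>p\<in>P. (tgt p - 1) * (ln (real p) / p)) \<le> C1 + C2" by linarith
    \<comment> \<open>Outside \<open>Q\<close> the summand \<open>tgt p - 1\<close> vanishes.\<close>
    define Q where "Q = {p\<in>P. q dvd p - 1}"
    have "(\<Sum>p\<in>Q. ((if power_residue q p (int a) then real q else 0) - 1) * (ln (real p) / p))
        = (\<Sum>p\<in>Q. (tgt p - 1) * (ln (real p) / p) + (if p dvd a then (real q - 1) * (ln (real p) / p) else 0))"
    proof (rule sum.cong[OF refl])
      have alg: "(A - 1) * W = (A - (if D then c else 0) - 1) * W + (if D then c * W else 0)" for A W c :: real and D
        by (cases D) (simp_all add: algebra_simps)
      fix p assume "p \<in> Q"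
      hence "tgt p = (if power_residue q p (int a) then real q else 0) - (if p dvd a then real q - 1 else 0)"
        by (simp add: Q_def tgt_def)
      thus "((if power_residue q p (int a) then real q else 0) - 1) * (ln (real p) / p)
        = (tgt p - 1) * (ln (real p) / p) + (if p dvd a then (real q - 1) * (ln (real p) / p) else 0)"
        by (simp only: alg[of "if power_residue q p (int a) then real q else 0"])
    qed
    also have "\<dots> = (\<Sum>p\<in>Q. (tgt p - 1) * (ln (real p) / p)) + (\<Sum>p\<in>Q. if p dvd a then (real q - 1) * (ln (real p) / p) else 0)"
      by (rule sum.distrib)
    also have "(\<Sum>p\<in>Q. (tgt p - 1) * (ln (real p) / p)) = (\<Sum>p\<in>P. (tgt p - 1) * (ln (real p) / p))"
      using finP by (intro sum.mono_neutral_left) (auto simp: Q_def tgt_def)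
    also have "(\<Sum>p\<in>Q. if p dvd a then (real q - 1) * (ln (real p) / p) else 0) = (\<Sum>p\<in>{p\<in>Q. p dvd a}. (real q - 1) * (ln (real p) / p))"
      using finP by (intro sum.inter_filter [symmetric]) (simp add: Q_def)
    also have "\<dots> \<le> C3" unfolding C3_def
    proof (rule sum_mono2)
      show "{p \<in> Q. p dvd a} \<subseteq> prime_factors a"
        using a_pos by (auto simp: Q_def P_def in_prime_factors_iff)
      show "0 \<le> (real q - 1) * (ln (real p) / p)" if "p \<in> prime_factors a - {p \<in> Q. p dvd a}" for p
        using that q_gt_1 w0[of p] by (intro mult_nonneg_nonneg) (auto simp: in_prime_factors_iff)
    qed auto
    finally have "(\<Sum>p\<in>Q. ((if power_residue q p (int a) then real q else 0) - 1) * (ln (real p) / p)) \<le> (\<Sum>p\<in>P. (tgt p - 1) * (ln (real p) / p)) + C3"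
      by simp
    also have "\<dots> \<le> C1 + C2 + C3" using le by simp
    also have "Q = {p. prime p \<and> p \<le> 2 ^ (j * q) \<and> q dvd p - 1}" by (auto simp: Q_def P_def)
    finally show "(\<Sum>p | prime p \<and> p \<le> 2 ^ (j * q) \<and> q dvd p - 1.
      ((if power_residue q p (int a) then real q else 0) - 1) * (ln (real p) / p)) \<le> C1 + C2 + C3" .
  qed
qed

end

section \<open>An order for several radicals\<close>

definition int_span :: "complex set \<Rightarrow> complex set" where
  "int_span B = {z. \<exists>c :: complex \<Rightarrow> int. z = (\<Sum>b\<in>B. of_int (c b) * b)}"

definition int_independent :: "complex set \<Rightarrow> bool" where
  "int_independent B \<longleftrightarrow> (\<forall>c :: complex \<Rightarrow> int. (\<Sum>b\<in>B. of_int (c b) * b) = 0 \<longrightarrow> (\<forall>b\<in>B. c b = 0))"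

lemma int_span_add: "z \<in> int_span B \<Longrightarrow> w \<in> int_span B \<Longrightarrow> z + w \<in> int_span B"
proof -
  assume "z \<in> int_span B" "w \<in> int_span B"
  then obtain c d :: "complex \<Rightarrow> int" where "z = (\<Sum>b\<in>B. of_int (c b) * b)" "w = (\<Sum>b\<in>B. of_int (d b) * b)"
    by (auto simp: int_span_def)
  hence "z + w = (\<Sum>b\<in>B. of_int (c b + d b) * b)" by (simp add: sum.distrib distrib_right)
  thus ?thesis unfolding int_span_def by (intro CollectI exI[of _ "\<lambda>b. c b + d b"])
qed

lemma int_span_scale: "z \<in> int_span B \<Longrightarrow> of_int k * z \<in> int_span B"
proof -
  assume "z \<in> int_span B"
  then obtain c :: "complex \<Rightarrow> int" where "z = (\<Sum>b\<in>B. of_int (c b) * b)" by (auto simp: int_span_def)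
  hence "of_int k * z = (\<Sum>b\<in>B. of_int (k * c b) * b)" by (simp add: sum_distrib_left mult.assoc)
  thus ?thesis unfolding int_span_def by (intro CollectI exI[of _ "\<lambda>b. k * c b"])
qed

lemma int_span_base:
  assumes "finite B" "a \<in> B" shows "a \<in> int_span B"
proof -
  have "(\<Sum>b\<in>B. of_int (if b = a then 1 else 0) * b) = (\<Sum>b\<in>B. if b = a then a else 0)"
    by (intro sum.cong) auto
  also have "\<dots> = a" using assms by simp
  finally have "a = (\<Sum>b\<in>B. of_int (if b = a then 1 else 0) * b)" ..
  thus ?thesis unfolding int_span_def by (intro CollectI exI[of _ "\<lambda>b. if b = a then 1 else 0"])
qed

lemma int_span_0: "0 \<in> int_span B"
  unfolding int_span_def by (intro CollectI exI[of _ "\<lambda>b. 0"]) simp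

lemma int_span_sum: "(\<And>i. i \<in> A \<Longrightarrow> f i \<in> int_span B) \<Longrightarrow> sum f A \<in> int_span B"
  by (induction A rule: infinite_finite_induct) (simp_all add: int_span_0 int_span_add)

text \<open>
  The coefficient of \<open>m\<close> in a relation does not vanish, for otherwise \<open>B\<close> itself would be dependent.
\<close>
lemma dependent_multiple_in_span:
  assumes "finite B" "int_independent B" "\<not> int_independent (insert m B)" "m \<notin> B"
  shows "\<exists>N>0. of_nat N * m \<in> int_span B"
proof -
  obtain c :: "complex \<Rightarrow> int" and b where c: "(\<Sum>b\<in>insert m B. of_int (c b) * b) = 0" "b \<in> insert m B" "c b \<noteq> 0"
    using assms(3) by (auto simp: int_independent_def)
  have s: "of_int (c m) * m + (\<Sum>b\<in>B. of_int (c b) * b) = 0" using c(1) assms by simp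
  have cm: "c m \<noteq> 0"
  proof
    assume cm: "c m = 0"
    hence "(\<Sum>b\<in>B. of_int (c b) * b) = 0" using s by simp
    hence "\<forall>b\<in>B. c b = 0" using assms(2) unfolding int_independent_def by blast
    thus False using c(2,3) cm by auto
  qed
  have "of_int (c m) * m = - (\<Sum>b\<in>B. of_int (c b) * b)" using s by (simp add: add_eq_0_iff2)
  also have "\<dots> = (\<Sum>b\<in>B. of_int (- c b) * b)" by (simp add: sum_negf)
  finally have "of_int (c m) * m \<in> int_span B" unfolding int_span_def by (intro CollectI exI[of _ "\<lambda>b. - c b"])
  hence "of_int (sgn (c m)) * (of_int (c m) * m) \<in> int_span B" by (rule int_span_scale)
  also have "of_int (sgn (c m)) * (of_int (c m) * m) = of_int (\<bar>c m\<bar>) * m"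
    by (simp add: abs_sgn mult_ac)
  also have "\<dots> = of_nat (nat \<bar>c m\<bar>) * m" by simp
  finally show ?thesis using cm by (intro exI[of _ "nat \<bar>c m\<bar>"]) auto
qed

text \<open>
  The monomials in the radicals with exponents below \<open>q\<close> are closed under multiplication up to integer
  factors. Choose a maximal independent set \<open>B0\<close> of monomials that contains 1. Some \<open>M > 0\<close> carries
  every monomial into the span of \<open>B0\<close>. Scaling all elements of \<open>B0\<close> but 1 by \<open>M\<close> clears the
  denominators in the products, so the new set spans a ring.
\<close>
theorem exists_order_of_radicals:
  fixes \<Gamma> :: "complex set"
  assumes fin: "finite \<Gamma>" and q: "q \<ge> 2" and rad: "\<And>g. g \<in> \<Gamma> \<Longrightarrow> \<exists>k :: int. g ^ q = of_int k"
  shows "\<exists>B N. complex_order B \<and> N > 0 \<and> (\<forall>g\<in>\<Gamma>. of_nat N * g \<in> int_span B)"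
proof -
  from rad have "\<forall>g. \<exists>k :: int. g \<in> \<Gamma> \<longrightarrow> g ^ q = of_int k" by blast
  from choice[OF this] obtain kk :: "complex \<Rightarrow> int" where kk: "\<And>g. g \<in> \<Gamma> \<Longrightarrow> g ^ q = of_int (kk g)" by blast
  define mon where "mon = (\<lambda>e. \<Prod>g\<in>\<Gamma>. g ^ (e g :: nat))"
  define Mon where "Mon = mon ` (\<Gamma> \<rightarrow>\<^sub>E {..<q})"
  have finMon: "finite Mon" unfolding Mon_def using fin by (intro finite_imageI finite_PiE) auto
  have monI: "mon e \<in> Mon" if "\<And>g. g \<in> \<Gamma> \<Longrightarrow> e g < q" for e
  proof -
    have "mon e = mon (restrict e \<Gamma>)" unfolding mon_def by (intro prod.cong) auto
    thus ?thesis unfolding Mon_def using that by auto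
  qed
  have one_Mon: "1 \<in> Mon" using monI[of "\<lambda>_. 0"] q by (simp add: mon_def)
  have gen_Mon: "g \<in> Mon" if g: "g \<in> \<Gamma>" for g
  proof -
    have "mon (\<lambda>x. if x = g then 1 else 0) = (\<Prod>x\<in>\<Gamma>. if x = g then g else 1)"
      unfolding mon_def by (intro prod.cong) auto
    also have "\<dots> = g" using fin g by simp
    finally show ?thesis using monI[of "\<lambda>x. if x = g then 1 else 0"] q by simp
  qed
  have mult_Mon: "\<exists>k :: int. \<exists>w\<in>Mon. u * v = of_int k * w" if uv: "u \<in> Mon" "v \<in> Mon" for u v
  proof -
    obtain e e' where e: "u = mon e" "v = mon e'" using uv by (auto simp: Mon_def)
    define s where "s = (\<lambda>g. e g + e' g)"
    have "u * v = (\<Prod>g\<in>\<Gamma>. g ^ s g)" by (simp add: e mon_def s_def power_add prod.distrib)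
    also have "\<dots> = (\<Prod>g\<in>\<Gamma>. of_int (kk g ^ (s g div q)) * g ^ (s g mod q))"
    proof (rule prod.cong[OF refl])
      fix g assume g: "g \<in> \<Gamma>"
      have "g ^ s g = g ^ (q * (s g div q) + s g mod q)" by simp
      also have "\<dots> = (g ^ q) ^ (s g div q) * g ^ (s g mod q)" by (simp only: power_add power_mult)
      finally show "g ^ s g = of_int (kk g ^ (s g div q)) * g ^ (s g mod q)" by (simp add: kk[OF g])
    qed
    also have "\<dots> = of_int (\<Prod>g\<in>\<Gamma>. kk g ^ (s g div q)) * mon (\<lambda>g. s g mod q)"
      by (simp add: mon_def prod.distrib)
    finally have "u * v = of_int (\<Prod>g\<in>\<Gamma>. kk g ^ (s g div q)) * mon (\<lambda>g. s g mod q)" .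
    moreover have "mon (\<lambda>g. s g mod q) \<in> Mon" using q by (intro monI) simp
    ultimately show ?thesis by blast
  qed
  define \<C> where "\<C> = {B. B \<subseteq> Mon \<and> 1 \<in> B \<and> int_independent B}"
  have "finite \<C>" unfolding \<C>_def using finMon by (intro finite_subset[OF _ finite_Pow_iff[THEN iffD2, OF finMon]]) auto
  moreover have "{1} \<in> \<C>" using one_Mon by (simp add: \<C>_def int_independent_def)
  ultimately obtain B0 where B0: "B0 \<in> \<C>" "\<And>B. B \<in> \<C> \<Longrightarrow> B0 \<subseteq> B \<Longrightarrow> B0 = B"
    using finite_has_maximal[of \<C>] by blast
  have B0': "B0 \<subseteq> Mon" "1 \<in> B0" "int_independent B0" using B0(1) by (auto simp: \<C>_def)
  have finB0: "finite B0" using B0'(1) finMon by (rule finite_subset)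
  have ex: "\<exists>N>0. of_nat N * m \<in> int_span B0" if m: "m \<in> Mon" for m
  proof (cases "m \<in> B0")
    case True
    thus ?thesis using int_span_base[OF finB0 True] by (intro exI[of _ 1]) simp
  next
    case False
    hence "insert m B0 \<notin> \<C>" using B0(2)[of "insert m B0"] by blast
    hence "\<not> int_independent (insert m B0)" using m B0' by (auto simp: \<C>_def)
    from dependent_multiple_in_span[OF finB0 B0'(3) this False] show ?thesis .
  qed
  hence "\<forall>m. \<exists>N. m \<in> Mon \<longrightarrow> N > 0 \<and> of_nat N * m \<in> int_span B0" by blast
  from choice[OF this] obtain Nf :: "complex \<Rightarrow> nat" where Nf: "\<And>m. m \<in> Mon \<Longrightarrow> Nf m > 0"
      "\<And>m. m \<in> Mon \<Longrightarrow> of_nat (Nf m) * m \<in> int_span B0" by blast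
  define M where "M = (\<Prod>m\<in>Mon. Nf m)"
  have M0: "M > 0" unfolding M_def using Nf(1) by (intro prod_pos) auto
  have M_span: "of_nat M * m \<in> int_span B0" if m: "m \<in> Mon" for m
  proof -
    have "M = Nf m * (\<Prod>m'\<in>Mon - {m}. Nf m')" unfolding M_def using finMon m by (rule prod.remove)
    hence "of_nat M * m = of_int (int (\<Prod>m'\<in>Mon - {m}. Nf m')) * (of_nat (Nf m) * m)" by simp
    also have "\<dots> \<in> int_span B0" by (rule int_span_scale[OF Nf(2)[OF m]])
    finally show ?thesis .
  qed
  define B where "B = insert 1 ((\<lambda>b. of_nat M * b) ` (B0 - {1}))"
  have finB: "finite B" using finB0 by (simp add: B_def)
  have oneB: "1 \<in> int_span B" using finB by (rule int_span_base) (simp add: B_def)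
  have scaled: "of_nat M * z \<in> int_span B" if z: "z \<in> int_span B0" for z
  proof -
    obtain c :: "complex \<Rightarrow> int" where c: "z = (\<Sum>b\<in>B0. of_int (c b) * b)" using z by (auto simp: int_span_def)
    have "of_nat M * z = (\<Sum>b\<in>B0. of_int (c b) * (of_nat M * b))"
      by (simp add: c sum_distrib_left mult_ac)
    also have "\<dots> \<in> int_span B"
    proof (rule int_span_sum, rule int_span_scale)
      fix b assume b: "b \<in> B0"
      show "of_nat M * b \<in> int_span B"
      proof (cases "b = 1")
        case True
        have "of_int (int M) * 1 \<in> int_span B" by (rule int_span_scale[OF oneB])
        thus ?thesis using True by simp
      next
        case False
        hence "of_nat M * b \<in> B" using b unfolding B_def by blast
        thus ?thesis by (rule int_span_base[OF finB])
      qed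
    qed
    finally show ?thesis .
  qed
  have MM: "of_nat M * (of_nat M * m) \<in> int_span B" if "m \<in> Mon" for m
    by (rule scaled[OF M_span[OF that]])
  have notin: "1 \<notin> (\<lambda>b. of_nat M * b) ` (B0 - {1})"
  proof
    assume "1 \<in> (\<lambda>b. of_nat M * b) ` (B0 - {1})"
    then obtain b where "1 = of_nat M * b" "b \<in> B0 - {1}" by (rule imageE)
    hence b: "b \<in> B0" "b \<noteq> 1" "of_nat M * b = 1" by simp_all
    define c :: "complex \<Rightarrow> int" where "c = (\<lambda>x. if x = b then int M else if x = 1 then -1 else 0)"
    have "(\<Sum>x\<in>B0. of_int (c x) * x) = (\<Sum>x\<in>B0. (if x = b then of_nat M * b else 0) + (if x = 1 then -1 else 0))"
      using b(2) by (intro sum.cong) (auto simp: c_def)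
    also have "\<dots> = 0" using b B0'(2) finB0 by (simp add: sum.distrib)
    finally have "c 1 = 0" using B0'(2,3) unfolding int_independent_def by blast
    thus False using b(2) by (simp add: c_def)
  qed
  have inj: "inj_on (\<lambda>b. of_nat M * b :: complex) (B0 - {1})" using M0 by (auto simp: inj_on_def)
  have "complex_order B"
  proof
    show "finite B" by (rule finB)
    show "1 \<in> B" by (simp add: B_def)
    fix c :: "complex \<Rightarrow> int" and b
    assume c: "(\<Sum>b\<in>B. of_int (c b) * b) = 0" and b: "b \<in> B"
    define c' where "c' = (\<lambda>b. if b = 1 then c 1 else c (of_nat M * b) * int M)"
    have "(\<Sum>b\<in>B. of_int (c b) * b) = of_int (c 1) + (\<Sum>b\<in>(\<lambda>b. of_nat M * b) ` (B0 - {1}). of_int (c b) * b)"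
      unfolding B_def using notin finB0 by (subst sum.insert) auto
    also have "(\<Sum>b\<in>(\<lambda>b. of_nat M * b) ` (B0 - {1}). of_int (c b) * b) = (\<Sum>b\<in>B0 - {1}. of_int (c (of_nat M * b)) * (of_nat M * b))"
      by (simp add: sum.reindex[OF inj])
    also have "\<dots> = (\<Sum>b\<in>B0 - {1}. of_int (c' b) * b)"
      by (intro sum.cong refl) (simp add: c'_def)
    also have "of_int (c 1) + \<dots> = (\<Sum>b\<in>B0. of_int (c' b) * b)"
      using sum.remove[OF finB0 B0'(2), of "\<lambda>b. of_int (c' b) * b"] by (simp add: c'_def)
    finally have "(\<Sum>b\<in>B0. of_int (c' b) * b) = 0" using c by simp
    hence c'0: "\<forall>b\<in>B0. c' b = 0" using B0'(3) unfolding int_independent_def by blast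
    from b consider "b = 1" | b' where "b' \<in> B0" "b' \<noteq> 1" "b = of_nat M * b'" by (auto simp: B_def)
    thus "c b = 0"
    proof cases
      case 1 thus ?thesis using c'0 B0'(2) by (auto simp: c'_def)
    next
      case 2
      hence "c' b' = 0" using c'0 by blast
      thus ?thesis using 2 M0 by (simp add: c'_def)
    qed
  next
    fix x y assume xy: "x \<in> B" "y \<in> B"
    have "x * y \<in> int_span B"
    proof (cases "x = 1 \<or> y = 1")
      case True
      thus ?thesis using int_span_base[OF finB xy(1)] int_span_base[OF finB xy(2)] by auto
    next
      case False
      then obtain b b' where b: "b \<in> B0" "x = of_nat M * b" "b' \<in> B0" "y = of_nat M * b'"
        using xy by (auto simp: B_def)
      obtain k :: int and w where kw: "w \<in> Mon" "b * b' = of_int k * w"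
        using mult_Mon[of b b'] b B0'(1) by blast
      have "x * y = of_nat M * (of_nat M * (b * b'))" by (simp add: b mult_ac)
      also have "\<dots> = of_int k * (of_nat M * (of_nat M * w))" unfolding kw(2) by (simp only: mult_ac)
      also have "\<dots> \<in> int_span B" by (rule int_span_scale[OF MM[OF kw(1)]])
      finally show ?thesis .
    qed
    thus "\<exists>c :: complex \<Rightarrow> int. x * y = (\<Sum>d\<in>B. of_int (c d) * d)" by (simp add: int_span_def)
  qed
  moreover have "of_nat (M * M) * g \<in> int_span B" if "g \<in> \<Gamma>" for g
    using MM[OF gen_Mon[OF that]] by (simp add: mult.assoc)
  moreover have "M * M > 0" using M0 by simp
  ultimately show ?thesis by blast
qed

context complex_order
begin

lemma R_eq_int_span: "R = int_span B"
  by (auto simp: R_def comb_def int_span_def)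

lemma deg_one_power_cong:
  assumes m: "is_ideal m" and x: "x \<in> R" "x - of_int u \<in> m"
  shows "x ^ k - of_int (u ^ k) \<in> m"
proof (induction k)
  case 0 thus ?case using idealD(2)[OF m] by simp
next
  case (Suc k)
  have "x * (x ^ k - of_int (u ^ k)) + of_int (u ^ k) * (x - of_int u) \<in> m"
    by (rule idealD(3)[OF m idealD(4)[OF m Suc x(1)] idealD(4)[OF m x(2) R_of_int]])
  also have "x * (x ^ k - of_int (u ^ k)) + of_int (u ^ k) * (x - of_int u) = x ^ Suc k - of_int (u ^ Suc k)"
    by (simp add: algebra_simps)
  finally show ?case .
qed

text \<open>
  Only a multiple \<open>N * g\<close> of the radical is in \<open>R\<close>. It is congruent to an integer \<open>u\<close>, and dividing
  \<open>u\<close> by \<open>N\<close> modulo \<open>p\<close> gives the root \<open>w\<close>.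
\<close>
lemma deg_one_scaled_radical:
  assumes d: "deg_one p m" and N: "\<not> p dvd N" "of_nat N * g \<in> R" and g: "g ^ q = of_int s"
  shows "\<exists>w u. [w ^ q = s] (mod int p) \<and> of_nat N * g - of_int u \<in> m \<and> [w * int N = u] (mod int p)"
proof -
  note D = deg_oneD[OF d]
  obtain u :: int where u: "of_nat N * g - of_int u \<in> m" using d N(2) by (auto simp: deg_one_def)
  have "(of_nat N * g) ^ q - of_int (u ^ q) \<in> m" by (rule deg_one_power_cong[OF D(4) N(2) u])
  also have "(of_nat N * g) ^ q - of_int (u ^ q) = of_int (int N ^ q * s - u ^ q)"
    by (simp add: power_mult_distrib g)
  finally have "int p dvd int N ^ q * s - u ^ q" by (subst (asm) of_int_in_max_ideal_iff[OF D(1-3)])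
  hence 1: "[int N ^ q * s = u ^ q] (mod int p)" by (simp add: cong_iff_dvd_diff)
  have "coprime p N" using D(2) N(1) by (rule prime_imp_coprime)
  hence "coprime (int N) (int p)" by (simp add: coprime_commute)
  then obtain v where v: "[int N * v = 1] (mod int p)" using cong_solve_coprime_int by blast
  have "[(v * u) ^ q = v ^ q * (int N ^ q * s)] (mod int p)"
    unfolding power_mult_distrib by (intro cong_mult cong_refl cong_sym[OF 1])
  also have "v ^ q * (int N ^ q * s) = (int N * v) ^ q * s" by (simp only: power_mult_distrib mult_ac)
  finally have "[(v * u) ^ q = (int N * v) ^ q * s] (mod int p)" .
  also have "[(int N * v) ^ q * s = 1 ^ q * s] (mod int p)" by (intro cong_mult cong_pow v cong_refl)
  finally have "[(v * u) ^ q = s] (mod int p)" by simp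
  moreover have "[(int N * v) * u = 1 * u] (mod int p)" by (intro cong_mult v cong_refl)
  hence "[v * u * int N = u] (mod int p)" by (simp add: mult_ac)
  ultimately show ?thesis using u by blast
qed

text \<open>
  The image \<open>w\<close> of \<open>z\<close> satisfies \<open>w ^ q \<equiv> 1\<close>. It is not 1, because the relation \<open>\<Sum> z ^ i = 0\<close> would
  become \<open>q \<equiv> 0\<close>. So \<open>w\<close> has order \<open>q\<close> modulo \<open>p\<close>, and \<open>q\<close> divides \<open>p - 1\<close>.
\<close>
lemma deg_one_root_of_unity:
  assumes d: "deg_one p m" and N: "\<not> p dvd N" "of_nat N * z \<in> R" and q: "prime q" "p \<noteq> q"
    and z: "z ^ q = 1" "(\<Sum>i<q. z ^ i) = 0"
  shows "q dvd p - 1"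
proof -
  note D = deg_oneD[OF d]
  obtain w u where wu: "[w ^ q = 1] (mod int p)" "of_nat N * z - of_int u \<in> m" "[w * int N = u] (mod int p)"
    using deg_one_scaled_radical[OF d N, of q 1] z(1) by auto
  have w1: "\<not> [w = 1] (mod int p)"
  proof
    assume "[w = 1] (mod int p)"
    hence "[w * int N = 1 * int N] (mod int p)" by (intro cong_mult cong_refl)
    hence uN: "[u = int N] (mod int p)" using cong_trans[OF cong_sym[OF wu(3)]] by simp
    \<comment> \<open>The relation \<open>\<Sum> z ^ i = 0\<close>, multiplied by \<open>N ^ (q - 1)\<close> to make sense in \<open>R\<close>.\<close>
    define t where "t = (\<Sum>i<q. int N ^ (q - Suc i) * u ^ i)"
    have "(\<Sum>i<q. of_int (int N ^ (q - Suc i)) * ((of_nat N * z) ^ i - of_int (u ^ i))) \<in> m"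
      by (intro ideal_sum[OF D(4)] idealD(4)[OF D(4)] deg_one_power_cong[OF D(4) N(2) wu(2)] R_of_int)
    also have "(\<Sum>i<q. of_int (int N ^ (q - Suc i)) * ((of_nat N * z) ^ i - of_int (u ^ i)))
        = (\<Sum>i<q. of_int (int N ^ (q - Suc i)) * (of_nat N * z) ^ i) - of_int t"
      by (simp add: t_def sum_subtractf right_diff_distrib)
    also have "(\<Sum>i<q. of_int (int N ^ (q - Suc i)) * (of_nat N * z) ^ i) = (\<Sum>i<q. of_nat N ^ (q - 1) * z ^ i)"
    proof (rule sum.cong[OF refl])
      fix i assume "i \<in> {..<q}"
      hence "q - 1 = (q - Suc i) + i" by simp
      hence "of_nat N ^ (q - 1) = (of_nat N ^ (q - Suc i) * of_nat N ^ i :: complex)" by (simp only: power_add)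
      thus "of_int (int N ^ (q - Suc i)) * (of_nat N * z) ^ i = of_nat N ^ (q - 1) * z ^ i"
        by (simp add: power_mult_distrib)
    qed
    also have "\<dots> = 0" by (simp add: sum_distrib_left[symmetric] z(2))
    finally have "of_int (- t) \<in> m" by simp
    hence pt: "int p dvd t" by (subst (asm) of_int_in_max_ideal_iff[OF D(1-3)]) simp
    have "[t = (\<Sum>i<q. int N ^ (q - Suc i) * int N ^ i)] (mod int p)"
      unfolding t_def by (intro cong_sum cong_mult cong_refl cong_pow uN)
    also have "(\<Sum>i<q. int N ^ (q - Suc i) * int N ^ i) = (\<Sum>i<q. int N ^ (q - 1))"
      by (intro sum.cong refl) (simp flip: power_add)
    also have "\<dots> = int (q * N ^ (q - 1))" by simp
    finally have "int p dvd int (q * N ^ (q - 1))" using pt cong_dvd_iff by blast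
    hence "p dvd q * N ^ (q - 1)" by (simp only: int_dvd_int_iff)
    hence "p dvd q \<or> p dvd N" using D(2) by (auto simp: prime_dvd_mult_iff dest: prime_dvd_power)
    thus False using N(1) q D(2) primes_dvd_imp_eq by blast
  qed
  define w' where "w' = nat (w mod int p)"
  have p0: "p > 0" using D(2) by (rule prime_gt_0_nat)
  have w': "[int w' = w] (mod int p)" using p0 by (simp add: w'_def cong_def)
  have "[int w' ^ q = 1] (mod int p)" using cong_trans[OF cong_pow[OF w'] wu(1)] .
  hence "[int (w' ^ q) = int 1] (mod int p)" by simp
  hence wq: "[w' ^ q = 1] (mod p)" by (simp only: cong_int_iff)
  hence "ord p w' dvd q" by (simp only: ord_divides)
  hence ordq: "ord p w' = 1 \<or> ord p w' = q" using q(1) by (simp add: prime_nat_iff)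
  have "ord p w' \<noteq> 1"
  proof
    assume "ord p w' = 1"
    hence "[w' ^ 1 = 1] (mod p)" using ord[of w' p] by (simp only:)
    hence "[int w' = int 1] (mod int p)" by (simp only: cong_int_iff power_one_right)
    thus False using w1 w' cong_trans[OF cong_sym[OF w']] by auto
  qed
  hence oq: "ord p w' = q" using ordq by blast
  hence "coprime p w'" using ord_eq_0[of p w'] prime_gt_0_nat[OF q(1)] by auto
  from order_divides_totient[OF this] show ?thesis using D(2) oq by (simp add: totient_prime)
qed

end

section \<open>Sets of non-powers\<close>

lemma exists_primitive_root_of_unity:
  assumes "q \<ge> 3"
  shows "\<exists>z::complex. z ^ q = 1 \<and> (\<Sum>i<q. z ^ i) = 0"
proof -
  define z where "z = cis (2 * pi / q)"
  have zq: "z ^ q = 1" using assms by (simp add: z_def DeMoivre)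
  have "sin (2 * pi / q) > 0" using assms by (intro sin_gt_zero) (auto simp: field_simps)
  hence "Im z \<noteq> 0" by (simp add: z_def)
  hence z1: "z \<noteq> 1" by auto
  have "(\<Sum>i<q. z ^ i) = 0" using zq z1 by (simp add: geometric_sum)
  thus ?thesis using zq by blast
qed

text \<open>
  Apply \<open>not_summable_deg_one\<close> to an order that contains multiples of a primitive \<open>q\<close>-th root of unity and
  of \<open>q\<close>-th roots of the elements of \<open>S\<close>. Up to finitely many exceptions, a prime below an ideal of degree
  one is \<open>1\<close> modulo \<open>q\<close>, and all of \<open>S\<close> consists of residues.
\<close>
theorem not_summable_all_power_residues:
  assumes q: "prime q" "odd q" and S: "finite S"
  shows "\<not> summable (\<lambda>p. if prime p \<and> q dvd p - 1 \<and> (\<forall>s\<in>S. power_residue q p s) then 1 / real p else 0)"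
proof
  let ?h = "\<lambda>p. if prime p \<and> q dvd p - 1 \<and> (\<forall>s\<in>S. power_residue q p s) then 1 / real p else 0"
  assume sum_h: "summable ?h"
  have q2: "q \<ge> 2" using q(1) by (rule prime_ge_2_nat)
  have q3: "q \<ge> 3" using q2 q(2) by (cases "q = 2") auto
  obtain z :: complex where z: "z ^ q = 1" "(\<Sum>i<q. z ^ i) = 0" using exists_primitive_root_of_unity[OF q3] by blast
  define g where "g = (\<lambda>s::int. complex_of_real (root q (real_of_int s)))"
  have g: "g s ^ q = of_int s" for s
    using odd_real_root_pow[OF q(2), of "real_of_int s"] by (simp add: g_def flip: of_real_power)
  define \<Gamma> where "\<Gamma> = insert z (g ` S)"
  have "\<exists>k :: int. x ^ q = of_int k" if "x \<in> \<Gamma>" for x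
    using that g z(1) by (auto simp: \<Gamma>_def intro: exI[of _ 1])
  hence "\<exists>B N. complex_order B \<and> N > 0 \<and> (\<forall>x\<in>\<Gamma>. of_nat N * x \<in> int_span B)"
    using S q2 by (intro exists_order_of_radicals) (auto simp: \<Gamma>_def)
  then obtain B N where B: "complex_order B" and N: "N > 0" "\<And>x. x \<in> \<Gamma> \<Longrightarrow> of_nat N * x \<in> int_span B"
    by blast
  interpret complex_order B by (rule B)
  let ?f = "\<lambda>p. if prime p \<and> (\<exists>m. deg_one p m) then 1 / real p else 0"
  have key: "q dvd p - 1 \<and> (\<forall>s\<in>S. power_residue q p s)" if p: "deg_one p m" "p > N" "p > q" for p m
  proof
    have pN: "\<not> p dvd N" using p(2) N(1) by (auto dest: dvd_imp_le)
    show "q dvd p - 1"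
      using N(2) p(3) by (intro deg_one_root_of_unity[OF p(1) pN _ q(1) _ z]) (auto simp: \<Gamma>_def R_eq_int_span)
    show "\<forall>s\<in>S. power_residue q p s"
    proof
      fix s assume s: "s \<in> S"
      have "of_nat N * g s \<in> R" using N(2) s by (auto simp: \<Gamma>_def R_eq_int_span)
      from deg_one_scaled_radical[OF p(1) pN this g] show "power_residue q p s"
        unfolding power_residue_def by blast
    qed
  qed
  have "summable ?f"
  proof (rule summable_comparison_test')
    show "summable (\<lambda>p. ?h p + (if p \<in> {..N + q} then 1 / real p else 0))"
      by (intro summable_add sum_h summable_If_finite_set) auto
    fix p :: nat
    show "norm (?f p) \<le> ?h p + (if p \<in> {..N + q} then 1 / real p else 0)"
    proof (cases "p \<le> N + q")
      case True thus ?thesis by auto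
    next
      case False
      thus ?thesis using key[of p] by auto
    qed
  qed
  thus False using not_summable_deg_one by blast
qed

text \<open>
  As \<open>q\<close> is odd, \<open>-1\<close> is a \<open>q\<close>-th power, and signs can be ignored.
\<close>
lemma power_residue_abs:
  assumes "odd q" shows "power_residue q p (int (nat \<bar>s\<bar>)) \<longleftrightarrow> power_residue q p s"
proof (cases "s \<ge> 0")
  case False
  have neg: "power_residue q p (- t)" if t: "power_residue q p t" for t
  proof -
    obtain x where "[x ^ q = t] (mod int p)" using t by (auto simp: power_residue_def)
    hence "[- (x ^ q) = - t] (mod int p)" by (simp add: cong_minus_minus_iff)
    hence "[(- x) ^ q = - t] (mod int p)" using assms by (simp add: power_minus_odd)
    thus ?thesis unfolding power_residue_def by blast
  qed
  thus ?thesis using neg[of s] neg[of "- s"] False by auto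
qed simp

lemma not_perfect_power_abs:
  assumes q: "odd q" and s: "\<not> perfect_power q s"
  shows "nat \<bar>s\<bar> > 0" "\<not> (\<exists>r::rat. of_nat (nat \<bar>s\<bar>) = r ^ q)"
proof -
  have q0: "q > 0" using q by (rule odd_pos)
  show ex: "\<not> (\<exists>r::rat. of_nat (nat \<bar>s\<bar>) = r ^ q)"
  proof
    assume "\<exists>r::rat. of_nat (nat \<bar>s\<bar>) = r ^ q"
    then obtain r :: rat where r: "of_nat (nat \<bar>s\<bar>) = r ^ q" by blast
    hence "rat_of_int s = (if s \<ge> 0 then r else - r) ^ q" using q by (auto simp: power_minus_odd)
    thus False using s unfolding perfect_power_def by blast
  qed
  show "nat \<bar>s\<bar> > 0"
  proof (rule ccontr)
    assume "\<not> nat \<bar>s\<bar> > 0"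
    hence "rat_of_nat (nat \<bar>s\<bar>) = 0 ^ q" using q0 by simp
    thus False using ex by blast
  qed
qed

lemma sum_power_residue_int_le:
  assumes q: "prime q" "odd q" and s: "\<not> perfect_power q s"
  shows "\<exists>C. \<forall>j. (\<Sum>p | prime p \<and> p \<le> 2 ^ (j * q) \<and> q dvd p - 1.
      ((if power_residue q p s then real q else 0) - 1) * (ln (real p) / p)) \<le> C"
proof -
  define a where "a = nat \<bar>s\<bar>"
  interpret pure_field q a "complex_of_real (root q (real a))"
  proof
    show "complex_of_real (root q (real a)) ^ q = of_nat a"
      using prime_gt_0_nat[OF q(1)] by (simp flip: of_real_power)
  qed (use q not_perfect_power_abs[OF q(2) s] in \<open>simp_all add: a_def\<close>)
  have eq: "power_residue q p (int a) \<longleftrightarrow> power_residue q p s" for p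
    unfolding a_def by (rule power_residue_abs[OF q(2)])
  show ?thesis using sum_power_residue_le unfolding eq .
qed

text \<open>
  Let \<open>f p\<close> be \<open>q\<close> times the number of residues in \<open>S\<close> minus \<open>card S\<close>. If the theorem fails, then \<open>f\<close> is
  nonnegative beyond \<open>\<Delta>\<close>, and it is at least 1 at the primes where all of \<open>S\<close> consists of residues. The
  weighted sums of \<open>f\<close> are bounded above, so the reciprocals of those primes would be summable. It is these
  primes that turn the average value \<open>card S / q\<close> into a strict inequality.
\<close>
theorem exists_prime_few_power_residues:
  assumes q: "prime q" "odd q" and S: "finite S" "S \<noteq> {}" "\<And>s. s \<in> S \<Longrightarrow> \<not> perfect_power q s" and D: "\<Delta> > 0"
  shows "\<exists>p. prime p \<and> \<not> p dvd \<Delta> \<and> q * card {s\<in>S. power_residue q p s} < card S"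
proof (rule ccontr)
  assume neg: "\<not> ?thesis"
  have q2: "q \<ge> 2" using q(1) by (rule prime_ge_2_nat)
  have q3: "q \<ge> 3" using q2 q(2) by (cases "q = 2") auto
  define f where "f = (\<lambda>p. \<Sum>s\<in>S. (if power_residue q p s then real q else 0) - 1)"
  define w where "w = (\<lambda>p::nat. ln (real p) / real p)"
  have w0: "w p \<ge> 0" for p by (cases "p = 0") (simp_all add: w_def)
  have fcard: "f p = real (q * card {s\<in>S. power_residue q p s}) - real (card S)" for p
  proof -
    have "(\<Sum>s\<in>S. if power_residue q p s then real q else 0) = (\<Sum>s\<in>{s\<in>S. power_residue q p s}. real q)"
      using S(1) by (rule sum.inter_filter [symmetric])
    thus ?thesis by (simp add: f_def sum_subtractf)
  qed
  have f0: "f p \<ge> 0" if "prime p" "p > \<Delta>" for p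
  proof -
    have "\<not> p dvd \<Delta>" using that D by (auto dest: dvd_imp_le)
    hence "card S \<le> q * card {s\<in>S. power_residue q p s}" using neg that(1) by (meson not_less)
    thus ?thesis unfolding fcard by (simp del: of_nat_mult)
  qed
  from S(3) have "\<forall>s. \<exists>C. s \<in> S \<longrightarrow> (\<forall>j. (\<Sum>p | prime p \<and> p \<le> 2 ^ (j * q) \<and> q dvd p - 1.
      ((if power_residue q p s then real q else 0) - 1) * w p) \<le> C)"
    using sum_power_residue_int_le[OF q] unfolding w_def by blast
  from choice[OF this] obtain C where C: "\<forall>s. s \<in> S \<longrightarrow> (\<forall>j. (\<Sum>p | prime p \<and> p \<le> 2 ^ (j * q) \<and> q dvd p - 1.
      ((if power_residue q p s then real q else 0) - 1) * w p) \<le> C s)" by (rule exE)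
  define Q where "Q = (\<lambda>j. {p. prime p \<and> p \<le> 2 ^ (j * q) \<and> q dvd p - 1})"
  have finQ: "finite (Q j)" for j unfolding Q_def by (rule finite_subset[of _ "{..2 ^ (j * q)}"]) auto
  have upper: "(\<Sum>p\<in>Q j. f p * w p) \<le> sum C S" for j
  proof -
    have "(\<Sum>p\<in>Q j. f p * w p) = (\<Sum>p\<in>Q j. \<Sum>s\<in>S. ((if power_residue q p s then real q else 0) - 1) * w p)"
      by (simp only: f_def sum_distrib_right)
    also have "\<dots> = (\<Sum>s\<in>S. \<Sum>p\<in>Q j. ((if power_residue q p s then real q else 0) - 1) * w p)"
      by (rule sum.swap)
    also have "\<dots> \<le> sum C S" using C unfolding Q_def by (intro sum_mono) blast
    finally show ?thesis .
  qed
  define E where "E = (\<Sum>p\<le>\<Delta>. real (card S) * w p) + (\<Sum>p\<le>\<Delta>. 1 / real p)"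
  let ?h = "\<lambda>p. if prime p \<and> q dvd p - 1 \<and> (\<forall>s\<in>S. power_residue q p s) then 1 / real p else 0"
  have h_le: "?h p \<le> f p * w p" if p: "prime p" "p > \<Delta>" "q dvd p - 1" for p
  proof (cases "\<forall>s\<in>S. power_residue q p s")
    case True
    hence "f p = (real q - 1) * real (card S)" by (simp add: f_def)
    moreover have "real q - 1 \<ge> 1" using q2 by simp
    moreover have "real (card S) \<ge> 1" using S by (simp add: Suc_le_eq card_gt_0_iff)
    ultimately have f1: "f p \<ge> 1" using mult_mono[of 1 "real q - 1" 1 "real (card S)"] by simp
    have "p - 1 > 0" using prime_gt_1_nat[OF p(1)] by simp
    hence "q \<le> p - 1" using p(3) by (rule dvd_imp_le[rotated])
    \<comment> \<open>This ensures \<open>ln p \<ge> 1\<close>, so the weight is at least \<open>1 / p\<close>.\<close>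
    hence p3: "p \<ge> 3" using q3 by simp
    have "exp 1 \<le> real p" using exp_le p3 by simp
    hence "ln (exp 1) \<le> ln (real p)" by (subst ln_le_cancel_iff) (use p3 in auto)
    hence "1 / real p \<le> w p" unfolding w_def by (intro divide_right_mono) auto
    also have "\<dots> \<le> f p * w p" using f1 w0[of p] mult_right_mono[of 1 "f p" "w p"] by simp
    finally show ?thesis using True p by simp
  next
    case False
    thus ?thesis using f0[OF p(1,2)] w0[of p] by auto
  qed
  have bound: "(\<Sum>p<N. ?h p) \<le> sum C S + E" for N
  proof -
    have h0: "?h p \<ge> 0" for p by simp
    have "N < 2 ^ N" by simp
    also have "(2::nat) ^ N \<le> 2 ^ (N * q)" using q2 by (intro power_increasing) auto
    finally have NQ: "N \<le> 2 ^ (N * q)" by simp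
    define A where "A = {p\<in>Q N. \<Delta> < p}"
    define A' where "A' = {p\<in>Q N. p \<le> \<Delta>}"
    have finA: "finite A" "finite A'" using finQ by (auto simp: A_def A'_def)
    have "(\<Sum>p<N. ?h p) = (\<Sum>p\<in>{p\<in>{..<N}. ?h p \<noteq> 0}. ?h p)"
      by (rule sum.mono_neutral_right) auto
    also have "\<dots> \<le> (\<Sum>p\<in>{..\<Delta>} \<union> A. ?h p)"
    proof (rule sum_mono2)
      show "{p \<in> {..<N}. ?h p \<noteq> 0} \<subseteq> {..\<Delta>} \<union> A"
        using NQ by (auto simp: A_def Q_def not_le split: if_splits)
    qed (use finA h0 in auto)
    also have "\<dots> = (\<Sum>p\<le>\<Delta>. ?h p) + (\<Sum>p\<in>A. ?h p)"
      using finA by (intro sum.union_disjoint) (auto simp: A_def)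
    also have "(\<Sum>p\<le>\<Delta>. ?h p) \<le> (\<Sum>p\<le>\<Delta>. 1 / real p)" by (rule sum_mono) simp
    also have "(\<Sum>p\<in>A. ?h p) \<le> (\<Sum>p\<in>A. f p * w p)"
      by (rule sum_mono, rule h_le) (auto simp: A_def Q_def)
    also have "(\<Sum>p\<in>A. f p * w p) = (\<Sum>p\<in>Q N. f p * w p) - (\<Sum>p\<in>A'. f p * w p)"
    proof -
      have "Q N = A \<union> A'" by (auto simp: A_def A'_def)
      hence "(\<Sum>p\<in>Q N. f p * w p) = (\<Sum>p\<in>A. f p * w p) + (\<Sum>p\<in>A'. f p * w p)"
        using finA by (simp only:) (rule sum.union_disjoint, auto simp: A_def A'_def)
      thus ?thesis by simp
    qed
    also have "\<dots> \<le> sum C S + (\<Sum>p\<le>\<Delta>. real (card S) * w p)"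
    proof -
      have "- (\<Sum>p\<in>A'. f p * w p) = (\<Sum>p\<in>A'. - f p * w p)" by (simp add: sum_negf)
      also have "\<dots> \<le> (\<Sum>p\<in>A'. real (card S) * w p)"
        using w0 by (intro sum_mono mult_right_mono) (auto simp: fcard simp del: of_nat_mult)
      also have "\<dots> \<le> (\<Sum>p\<le>\<Delta>. real (card S) * w p)"
        using w0 by (intro sum_mono2) (auto simp: A'_def)
      finally show ?thesis using upper[of N] by linarith
    qed
    finally show ?thesis by (simp add: E_def)
  qed
  have "summable ?h"
    by (rule summableI_nonneg_bounded[where x = "sum C S + E"]) (use bound in auto)
  thus False using not_summable_all_power_residues[OF q S(1)] by blast
qed


lemma bigomega_prime_mult:
  assumes "prime p" "N > 0"
  shows "bigomega (p * N) = Suc (bigomega N)"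
proof -
  have "p \<noteq> 0" using assms(1) by auto
  thus ?thesis using assms unfolding bigomega_def
    by (simp add: prime_factorization_mult prime_factorization_prime)
qed

text \<open>
  The prime \<open>p\<close> removes all but the residues \<open>S'\<close> from \<open>S\<close>. As \<open>q * card S' < card S\<close> is strict, the
  bound \<open>1 + q * (\<Sum>i\<le>k. q ^ i)\<close> on \<open>S\<close> drops to \<open>\<Sum>i\<le>k. q ^ i\<close> for \<open>S'\<close>.
\<close>
lemma exists_modulus_without_power:
  assumes q: "prime q" "odd q" and D: "\<Delta> > 0"
  shows "finite S \<Longrightarrow> (\<And>s. s \<in> S \<Longrightarrow> \<not> perfect_power q s) \<Longrightarrow> card S < (\<Sum>i\<le>k. q ^ i) \<Longrightarrow>
    \<exists>N>0. bigomega N \<le> k \<and> gcd N \<Delta> = 1 \<and> \<not> contains_power_mod q S N"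
proof (induction k arbitrary: S)
  case 0
  hence "S = {}" by simp
  thus ?case by (intro exI[of _ 1]) (simp add: bigomega_def contains_power_mod_def)
next
  case (Suc k)
  show ?case
  proof (cases "S = {}")
    case True
    thus ?thesis by (intro exI[of _ 1]) (simp add: bigomega_def contains_power_mod_def)
  next
    case False
    obtain p where p: "prime p" "\<not> p dvd \<Delta>" "q * card {s\<in>S. power_residue q p s} < card S"
      using exists_prime_few_power_residues[OF q Suc.prems(1) False Suc.prems(2) D] by blast
    define S' where "S' = {s\<in>S. power_residue q p s}"
    have geo: "(\<Sum>i\<le>Suc k. q ^ i) = 1 + q * (\<Sum>i\<le>k. q ^ i)"
      by (subst sum.atMost_Suc_shift) (simp add: sum_distrib_left)
    have "q * card S' < q * (\<Sum>i\<le>k. q ^ i)"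
      using p(3) Suc.prems(3) unfolding S'_def geo by linarith
    hence "card S' < (\<Sum>i\<le>k. q ^ i)" by simp
    moreover have "finite S'" using Suc.prems(1) by (simp add: S'_def)
    ultimately obtain N where N: "N > 0" "bigomega N \<le> k" "gcd N \<Delta> = 1" "\<not> contains_power_mod q S' N"
      using Suc.IH[of S'] Suc.prems(2) by (auto simp: S'_def)
    have "\<not> contains_power_mod q S (p * N)"
    proof
      assume "contains_power_mod q S (p * N)"
      then obtain s x where sx: "s \<in> S" "[x ^ q = s] (mod int (p * N))" by (auto simp: contains_power_mod_def)
      have "[x ^ q = s] (mod int p)" by (rule cong_dvd_modulus[OF sx(2)]) simp
      hence "s \<in> S'" using sx(1) by (auto simp: S'_def power_residue_def)
      moreover have "[x ^ q = s] (mod int N)" by (rule cong_dvd_modulus[OF sx(2)]) simp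
      ultimately show False using N(4) by (auto simp: contains_power_mod_def)
    qed
    moreover have "coprime p \<Delta>" using p(1,2) by (rule prime_imp_coprime)
    hence "gcd (p * N) \<Delta> = 1" using N(3) by (simp only: coprime_iff_gcd_eq_1 [symmetric] coprime_mult_left_iff simp_thms)
    moreover have "p * N > 0" using N(1) prime_gt_0_nat[OF p(1)] by simp
    moreover have "bigomega (p * N) \<le> Suc k" using bigomega_prime_mult[OF p(1) N(1)] N(2) by simp
    ultimately show ?thesis by (intro exI[of _ "p * N"] conjI)
  qed
qed

theorem proposition4p4:
  fixes q k :: nat and S :: "int set"
  assumes "prime q" and "odd q" and "k \<ge> 1"
    and "finite S" and "\<forall>s\<in>S. \<not> perfect_power q s"
    and "S \<in> power_sets k q"
  shows "real (card S) \<ge> (real q ^ (k + 1) - 1) / (real q - 1) \<and>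
         (real q ^ (k + 1) - 1) / (real q - 1) = (\<Sum>i\<le>k. real q ^ i)"
proof
  have q1: "real q > 1" using prime_gt_1_nat[OF assms(1)] by simp
  have "(real q - 1) * (\<Sum>i\<le>k. real q ^ i) = real q ^ (k + 1) - 1"
    using power_diff_1_eq[of "real q" "k + 1"] by (simp add: lessThan_Suc_atMost)
  thus eq: "(real q ^ (k + 1) - 1) / (real q - 1) = (\<Sum>i\<le>k. real q ^ i)"
    using q1 by (simp add: field_simps)
  obtain \<Delta> where D: "\<Delta> > 0" "\<And>N. N > 0 \<Longrightarrow> bigomega N \<le> k \<Longrightarrow> gcd N \<Delta> = 1 \<Longrightarrow> contains_power_mod q S N"
    using assms(6) by (auto simp: power_sets_def contains_power_mod_almost_every_def)
  have "\<not> card S < (\<Sum>i\<le>k. q ^ i)"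
  proof
    assume less: "card S < (\<Sum>i\<le>k. q ^ i)"
    have "\<not> perfect_power q s" if "s \<in> S" for s using assms(5) that by (rule bspec)
    from exists_modulus_without_power[OF assms(1,2) D(1) assms(4) this less]
    obtain N where N: "N > 0 \<and> bigomega N \<le> k \<and> gcd N \<Delta> = 1 \<and> \<not> contains_power_mod q S N"
      by (rule exE)
    with D(2)[of N] show False by simp
  qed
  hence "real (\<Sum>i\<le>k. q ^ i) \<le> real (card S)" by (intro of_nat_mono) simp
  thus "real (card S) \<ge> (real q ^ (k + 1) - 1) / (real q - 1)" unfolding eq by simp
qed

end
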